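(* Let $W(e^{-\pi-1})\le\lambda\le W(e^{\pi-1})$ (so that $\frac\pi4\le\omega\le\frac{3\pi}4$), let $N$ be a positive integer, let $z=\lambda a$ and $\theta=\arg a$ with $|\theta|<-\omega+\pi$. Then \[ |R_N(a,\lambda)|\le\left|\frac{a^N}{(z+a)^{2N+1}}\right|\frac{2(\lambda+1)^{2N+1}}{\sqrt{2\pi}}\int_0^{+\infty}t^{N-\frac12}e^{-t|\lambda+\log\lambda+1+\pi i|}\left|\Gamma^\ast(te^{i\omega})\right|dt\;\times\;\frac12\bigl(C_1(\theta)+C_2(\theta)\bigr), \] where \[ C_1(\theta)=\begin{cases}|\csc(\theta-\omega)| & \text{if }\omega-\pi<\theta<\omega-\frac\pi2,\\ 1 & \text{if }\omega-\frac\pi2\le\theta<-\omega+\pi,\end{cases} \qquad C_2(\theta)=\begin{cases}|\csc(\theta+\omega)| & \text{if }-\omega+\frac\pi2<\theta<-\omega+\pi,\\ 1 & \text{if }\omega-\pi<\theta\le-\omega+\frac\pi2.\end{cases} \]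
   Context: For $\lambda>0$, $\omega=\omega(\lambda)=\arg(\lambda+\log\lambda+1+\pi i)\in(0,\pi)$; $a$ is a nonzero complex number. $W$ is the principal branch of the Lambert $W$-function. With $z=\lambda a$, the remainder $R_N(a,\lambda)$ is defined by \[ \Gamma(-a,z)=z^{-a}e^{-z}\left(\sum_{n=0}^{N-1}\frac{a^n b_n(-\lambda)}{(z+a)^{2n+1}}+R_N(a,\lambda)\right) \] (principal values; $\Gamma(\cdot,\cdot)$ is the upper incomplete gamma function), where \[ b_n(-\lambda)=(\lambda+1)^n\left[\frac{d^n}{dt^n}\left(\frac{(\lambda+1)t}{\lambda e^t+t-\lambda}\right)^{n+1}\right]_{t=0} \] and the function in the bracket takes the value $1$ at its removable singularity $t=0$. The scaled gamma function is $\Gamma^\ast(z)=\Gamma(z)/(\sqrt{2\pi}\,z^{z-\frac12}e^{-z})$ for $|\arg z|<\pi$. *)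

theory Defs
  imports "HOL-Analysis.Analysis"
begin

text \<open>
  Principal branch of the Lambert function on its real domain: for
  \<open>x \<ge> - exp (- 1)\<close> it is the unique solution \<open>w \<ge> - 1\<close> of \<open>w * exp w = x\<close>.
\<close>
definition lambert_W :: "real \<Rightarrow> real" where
  "lambert_W x = (THE w. - 1 \<le> w \<and> w * exp w = x)"

text \<open>
  Principal value of the upper incomplete gamma function, the integral of
  \<open>t powr (s - 1) * exp (- t)\<close> along a path from \<open>z\<close> to \<open>+\<infinity>\<close> that
  avoids the nonpositive reals.  The path is taken to be the horizontal ray
  \<open>t = z + u\<close> with \<open>u \<ge> 0\<close>, which is admissible for every \<open>z \<notin> \<real>\<^sub>\<le>\<^sub>0\<close>.
\<close>
definition upper_Gamma :: "complex \<Rightarrow> complex \<Rightarrow> complex" where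
  "upper_Gamma s z =
     integral {0..} (\<lambda>u::real. (z + of_real u) powr (s - 1) * exp (- (z + of_real u)))"

text \<open>The scaled gamma function, meant for \<open>z \<notin> \<real>\<^sub>\<le>\<^sub>0\<close>.\<close>
definition scaled_Gamma :: "complex \<Rightarrow> complex" where
  "scaled_Gamma z =
     Gamma z / (of_real (sqrt (2 * pi)) * z powr (z - 1 / 2) * exp (- z))"

text \<open>\<open>b_neg n lam\<close> is the coefficient \<open>b\<^sub>n(-lam)\<close>.\<close>
definition b_neg :: "nat \<Rightarrow> real \<Rightarrow> complex" where
  "b_neg n lam =
     (of_real lam + 1) ^ n *
     (deriv ^^ n) (\<lambda>t::complex.
        (if t = 0 then 1
         else (of_real lam + 1) * t / (of_real lam * exp t + t - of_real lam)) ^ (n + 1)) 0"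

text \<open>The defining equation of the remainder \<open>R\<^sub>N(a, lam)\<close>, solved for the remainder.\<close>
definition remainder :: "nat \<Rightarrow> complex \<Rightarrow> real \<Rightarrow> complex" where
  "remainder N a lam =
     (let z = of_real lam * a in
       upper_Gamma (- a) z / (z powr (- a) * exp (- z))
       - (\<Sum>n<N. a ^ n * b_neg n lam / (z + a) ^ (2 * n + 1)))"

definition base_point :: "real \<Rightarrow> complex" where
  "base_point lam = of_real (lam + ln lam + 1) + of_real pi * \<i>"

definition omega :: "real \<Rightarrow> real" where
  "omega lam = Arg (base_point lam)"

definition csc :: "real \<Rightarrow> real" where
  "csc x = 1 / sin x"

text \<open>
  The factors \<open>C\<^sub>1(\<theta>)\<close> and \<open>C\<^sub>2(\<theta>)\<close>, meant for \<open>\<bar>\<theta>\<bar> < pi - \<omega>\<close>; on that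
  range the \<open>else\<close> branches are exactly \<open>\<omega> - pi / 2 \<le> \<theta>\<close> and
  \<open>\<theta> \<le> pi / 2 - \<omega>\<close> respectively.
\<close>
definition C1 :: "real \<Rightarrow> real \<Rightarrow> real" where
  "C1 \<omega> \<theta> = (if \<omega> - pi < \<theta> \<and> \<theta> < \<omega> - pi / 2 then \<bar>csc (\<theta> - \<omega>)\<bar> else 1)"

definition C2 :: "real \<Rightarrow> real \<Rightarrow> real" where
  "C2 \<omega> \<theta> = (if - \<omega> + pi / 2 < \<theta> \<and> \<theta> < - \<omega> + pi then \<bar>csc (\<theta> + \<omega>)\<bar> else 1)"

end

(*
  Substituting t = z e^v turns the normalised function F(a) = z^a e^z Gamma(-a, z), z = lam a,
  into the Laplace integral of exp(-a f(v)) over v >= 0 with phase f(v) = lam (e^v - 1) + v.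
  The same integral over v <= 0 continues to a second branch F1 near the negative axis, and
  F - F1 = Gamma(-a) z^a e^z =: J(a) across Im a <> 0, because the upper and the lower incomplete
  gamma functions add up to Gamma. Both branches have the asymptotic expansion with coefficients
  n! [s^n] (f^(-1))'(s), uniformly on the closed sectors |arg a| <= pi - omega and
  |arg (-a)| <= omega: on half-planes by integration by parts, beyond them because J is
  exponentially small there. Cauchy's formula for both sectors then expresses the remainder as a
  Cauchy transform of a^N J(a) over the two rays arg a = +-(pi - omega), where |J| is the scaled
  gamma function times an exponential; bounding the kernel 1/|s - a| gives C1 and C2.
*)
theory Submission
  imports Defs "HOL-Complex_Analysis.Complex_Analysis" "HOL-Real_Asymp.Real_Asymp"
begin

section \<open>Integrals over a half-line\<close>

text \<open>Write L = \<open>lam + ln lam + 1\<close>. At the point -t e^(i phi) the scaled gamma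
  function leaves in |J| the exponential of -t (L cos phi + pi sin phi); phi =
  \<open>omega lam\<close> maximises this bracket, and the maximum is
  \<open>norm (base_point lam)\<close>. This singles out the two rays. They lie on the imaginary
  axis only for L = 0, so one of the two sectors overhangs the half-plane on which its Laplace
  integral converges: that of F if L > 0, that of F1 if L < 0. Controlling the overhang is the main
  obstacle. The restriction pi/4 <= omega <= 3 pi/4 keeps it inside |Re a| <= |Im a|, where crude
  one-sided forms of Stirling's bound already give |a| |J| <= 2 exp(-|a|/10); it also makes the
  value 1 admissible in C1 and C2 over the whole middle range. Both branches carry the same partial
  sum, which drops out of their difference, so only J is left on the rays. The remainders must be
  controlled at both ends of the sectors: boundedness as s tends to 0 comes from the factor s^N with
  N > 0, decay as s tends to infinity from the next order of the expansion.\<close>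

lemma integral_exhaustion_tendsto:
  fixes f :: "'a::euclidean_space \<Rightarrow> 'b::euclidean_space"
  assumes f: "f absolutely_integrable_on A"
    and A: "\<And>n. A' n \<in> sets lebesgue" "\<And>n. A' n \<subseteq> A"
    and ev: "\<And>x. x \<in> A \<Longrightarrow> \<forall>\<^sub>F n in sequentially. x \<in> A' n"
  shows "(\<lambda>n. integral (A' n) f) \<longlonglongrightarrow> integral A f"
proof -
  let ?f = "\<lambda>n x. if x \<in> A' n then f x else 0"
  have eq: "integral A (?f n) = integral (A' n) f" for n
    using A(2)[of n] by (simp add: integral_restrict_Int Int_absorb2)
  have "(\<lambda>n. integral A (?f n)) \<longlonglongrightarrow> integral A f"
  proof (rule dominated_convergence)
    show "?f n integrable_on A" for n
    proof -
      have "f absolutely_integrable_on A' n"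
        using f A set_integrable_subset by blast
      then have "f integrable_on A' n"
        using set_lebesgue_integral_eq_integral(1) by blast
      moreover have "A' n \<inter> A = A' n" using A(2) by blast
      ultimately show ?thesis by (simp add: integrable_restrict_Int)
    qed
    show "(\<lambda>x. norm (f x)) integrable_on A"
      using f by (simp add: absolutely_integrable_on_def)
    show "norm (?f n x) \<le> norm (f x)" for n x by simp
    show "(\<lambda>n. ?f n x) \<longlonglongrightarrow> f x" if "x \<in> A" for x
      using ev[OF that] by (intro tendsto_eventually) (elim eventually_mono, simp)
  qed
  then show ?thesis by (simp add: eq)
qed

lemma integral_halfline_tendsto:
  fixes f :: "real \<Rightarrow> 'b::euclidean_space"
  assumes f: "f absolutely_integrable_on {c..}" and X: "filterlim X at_top sequentially"
  shows "(\<lambda>n. integral {c..X n} f) \<longlonglongrightarrow> integral {c..} f"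
proof (rule integral_exhaustion_tendsto[OF f])
  show "\<forall>\<^sub>F n in sequentially. x \<in> {c..X n}" if "x \<in> {c..}" for x
    using X that by (auto simp: filterlim_at_top)
qed auto

lemma absolutely_integrable_on_halfline_exp_bound:
  fixes f :: "real \<Rightarrow> complex"
  assumes "continuous_on {0..} f" "\<delta> > 0" "\<And>u. 0 \<le> u \<Longrightarrow> norm (f u) \<le> C * exp (- \<delta> * u)"
  shows "f absolutely_integrable_on {0..}"
proof (rule measurable_bounded_by_integrable_imp_absolutely_integrable)
  show "f \<in> borel_measurable (lebesgue_on {0..})"
    by (intro continuous_imp_measurable_on_sets_lebesgue assms) auto
  show "(\<lambda>u. C * exp (- \<delta> * u)) integrable_on {0..}"
    using has_integral_mult_right[OF has_integral_exp_minus_to_infinity[OF assms(2), of 0], of C]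
    by (auto simp: integrable_on_def)
qed (use assms in auto)

lemma integral_halfline_FTC:
  fixes \<Phi> :: "real \<Rightarrow> complex"
  assumes int: "\<phi> absolutely_integrable_on {0..}"
    and der: "\<And>x. 0 \<le> x \<Longrightarrow> (\<Phi> has_vector_derivative \<phi> x) (at x)"
    and lim: "(\<Phi> \<longlongrightarrow> L) at_top"
  shows "integral {0..} \<phi> = L - \<Phi> 0"
proof -
  have "integral {0..real n} \<phi> = \<Phi> (real n) - \<Phi> 0" for n
    by (intro integral_unique fundamental_theorem_of_calculus)
       (auto intro: has_vector_derivative_at_within der)
  moreover have "(\<lambda>n. integral {0..real n} \<phi>) \<longlonglongrightarrow> integral {0..} \<phi>"
    by (intro integral_halfline_tendsto int filterlim_real_sequentially)
  moreover have "(\<lambda>n. \<Phi> (real n) - \<Phi> 0) \<longlonglongrightarrow> L - \<Phi> 0"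
    by (intro tendsto_intros filterlim_compose[OF lim filterlim_real_sequentially])
  ultimately show ?thesis
    using LIMSEQ_unique by simp
qed

text \<open>The change of variables is made on [0, n] and passed to the limit on each side
  separately, hence absolute integrability is asked of both integrands.\<close>

lemma integral_halfline_substitution:
  fixes f :: "real \<Rightarrow> complex"
  assumes f: "f absolutely_integrable_on {g 0..}" "continuous_on {g 0..} f"
    and gf: "(\<lambda>x. g' x *\<^sub>R f (g x)) absolutely_integrable_on {0..}"
    and g: "\<And>x. 0 \<le> x \<Longrightarrow> (g has_field_derivative g' x) (at x)"
    and mono: "\<And>x y. 0 \<le> x \<Longrightarrow> x \<le> y \<Longrightarrow> g x \<le> g y" and lim: "filterlim g at_top at_top"
  shows "integral {g 0..} f = integral {0..} (\<lambda>x. g' x *\<^sub>R f (g x))"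
proof -
  have "integral {0..real n} (\<lambda>x. g' x *\<^sub>R f (g x)) = integral {g 0..g (real n)} f" for n
  proof (intro integral_unique has_integral_substitution)
    show "g ` {0..real n} \<subseteq> {g 0..g (real n)}" using mono by auto
    show "continuous_on {g 0..g (real n)} f" by (rule continuous_on_subset[OF f(2)]) auto
  qed (auto intro: mono has_field_derivative_at_within g)
  moreover have "(\<lambda>n. integral {0..real n} (\<lambda>x. g' x *\<^sub>R f (g x))) 
      \<longlonglongrightarrow> integral {0..} (\<lambda>x. g' x *\<^sub>R f (g x))"
    by (intro integral_halfline_tendsto gf filterlim_real_sequentially)
  moreover have "(\<lambda>n. integral {g 0..g (real n)} f) \<longlonglongrightarrow> integral {g 0..} f"
    by (intro integral_halfline_tendsto f filterlim_compose[OF lim filterlim_real_sequentially])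
  ultimately show ?thesis
    using LIMSEQ_unique by simp
qed

text \<open>The truncations to [0, n] are holomorphic by the Leibniz rule, and the tail beyond n is
  at most \<open>exp C * (exp (- \<delta> * n) / \<delta>)\<close> uniformly on a closed disc.
  Writing the integrand as \<open>exp (A z u)\<close> reduces local domination to a linear bound on
  the real part of the exponent.\<close>

lemma holomorphic_on_integral_halfline_exp:
  fixes A A' :: "complex \<Rightarrow> real \<Rightarrow> complex"
  assumes D: "open D"
    and der: "\<And>z u. z \<in> D \<Longrightarrow> 0 \<le> u \<Longrightarrow> ((\<lambda>z. A z u) has_field_derivative A' z u) (at z)"
    and contA: "continuous_on (D \<times> {0..}) (\<lambda>(z,u). A z u)"
    and contA': "continuous_on (D \<times> {0..}) (\<lambda>(z,u). A' z u)"
    and bound: "\<And>z0. z0 \<in> D \<Longrightarrow> \<exists>e>0. \<exists>C. \<exists>\<delta>>0. cball z0 e \<subseteq> D \<and>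
                  (\<forall>z\<in>cball z0 e. \<forall>u\<ge>0. Re (A z u) \<le> C - \<delta> * u)"
  shows "(\<lambda>z. integral {0..} (\<lambda>u. exp (A z u))) holomorphic_on D"
proof -
  have "\<exists>e>0. (\<lambda>z. integral {0..} (\<lambda>u. exp (A z u))) holomorphic_on ball z0 e" if z0: "z0 \<in> D" for z0
  proof -
    obtain e C \<delta> where e: "e > 0" "\<delta> > 0" "cball z0 e \<subseteq> D"
      and B: "\<And>z u. z \<in> cball z0 e \<Longrightarrow> u \<ge> 0 \<Longrightarrow> Re (A z u) \<le> C - \<delta> * u"
      using bound[OF z0] by metis
    have B': "norm (exp (A z u)) \<le> exp C * exp (- \<delta> * u)" if "z \<in> cball z0 e" "u \<ge> 0" for z u
      using B[OF that] by (simp add: norm_exp_eq_Re flip: exp_add)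
    have cont1: "continuous_on {0..} (\<lambda>u. exp (A z u))" if "z \<in> D" for z
      using that
      by (intro continuous_intros continuous_on_compose2[OF contA, of _ "\<lambda>u. (z, u)", simplified])
         auto
    have ai: "(\<lambda>u. exp (A z u)) absolutely_integrable_on {0..}" if "z \<in> cball z0 e" for z
      using that e B'
      by (intro absolutely_integrable_on_halfline_exp_bound[of _ \<delta> "exp C"] cont1) auto
    let ?g = "\<lambda>n z. integral (cbox 0 (real n)) (\<lambda>u. exp (A z u))"
    have hol: "?g n holomorphic_on cball z0 e" for n
    proof (rule leibniz_rule_holomorphic)
      show "((\<lambda>z. exp (A z t)) has_field_derivative exp (A z t) * A' z t) (at z within cball z0 e)"
        if "z \<in> cball z0 e" "t \<in> cbox 0 (real n)" for z t
        using that e(3) by (intro has_field_derivative_at_within[OF DERIV_fun_exp[OF der]]) auto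
      show "(\<lambda>u. exp (A z u)) integrable_on cbox 0 (real n)" if "z \<in> cball z0 e" for z
        using that e by (intro integrable_continuous continuous_on_subset[OF cont1]) auto
      show "continuous_on (cball z0 e \<times> cbox 0 (real n)) (\<lambda>(z, t). exp (A z t) * A' z t)"
        using continuous_on_mult[OF continuous_on_exp[OF contA] contA']
        by (rule continuous_on_subset[OF continuous_on_eq]) (use e in \<open>auto simp: split_beta\<close>)
    qed auto
    have ul: "uniform_limit (cball z0 e) ?g (\<lambda>z. integral {0..} (\<lambda>u. exp (A z u))) sequentially"
    proof -
      have diff: "norm (?g n z - integral {0..} (\<lambda>u. exp (A z u))) \<le> exp C * (exp (- \<delta> * real n) / \<delta>)"
        if z: "z \<in> cball z0 e" for n z
      proof -
        have i1: "(\<lambda>u. exp (A z u)) integrable_on {0..}"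
          using ai[OF z] set_lebesgue_integral_eq_integral(1) by blast
        have i2: "(\<lambda>u. exp (A z u)) integrable_on {0..real n}"
          using z e by (intro integrable_continuous_interval continuous_on_subset[OF cont1]) auto
        have i3: "(\<lambda>u. exp (A z u)) integrable_on {real n..}"
          using ai[OF z] set_integrable_subset[of lebesgue "{0..}" _ "{real n..}"]
            set_lebesgue_integral_eq_integral(1) by force
        have "((\<lambda>u. exp (A z u)) has_integral (integral {0..real n} (\<lambda>u. exp (A z u)) 
                + integral {real n..} (\<lambda>u. exp (A z u)))) ({0..real n} \<union> {real n..})"
          by (rule has_integral_Un) 
             (use i2 i3 in \<open>auto intro!: negligible_subset[OF negligible_sing, of _ "real n"]\<close>)
        also have "{0..real n} \<union> {real n..} = {0..}" by auto
        finally have "integral {0..} (\<lambda>u. exp (A z u)) = integral {0..real n} (\<lambda>u. exp (A z u)) 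
                + integral {real n..} (\<lambda>u. exp (A z u))"
          by (rule integral_unique)
        then have "norm (?g n z - integral {0..} (\<lambda>u. exp (A z u))) = 
           norm (integral {real n..} (\<lambda>u. exp (A z u)))" by simp
        also have "\<dots> \<le> integral {real n..} (\<lambda>u. exp C * exp (- \<delta> * u))"
          using has_integral_mult_right[OF has_integral_exp_minus_to_infinity[OF e(2), of "real n"],
                  of "exp C"] B'[OF z]
          by (intro integral_norm_bound_integral i3) (auto simp: integrable_on_def simp del: norm_exp_eq_Re)
        also have "\<dots> = exp C * (exp (- \<delta> * real n) / \<delta>)"
          using has_integral_exp_minus_to_infinity[OF e(2), of "real n"]
          by (subst integral_mult_right) (auto simp: integral_unique)
        finally show ?thesis .
      qed
      have "(\<lambda>n. exp C * (exp (- \<delta> * real n) / \<delta>)) \<longlonglongrightarrow> exp C * (0 / \<delta>)"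
      proof (intro tendsto_intros)
        show "(\<lambda>n. exp (- \<delta> * real n)) \<longlonglongrightarrow> 0"
          using e(2) by real_asymp
      qed (use e in auto)
      then have lim: "(\<lambda>n. exp C * (exp (- \<delta> * real n) / \<delta>)) \<longlonglongrightarrow> 0" by simp
      show ?thesis
      proof (rule uniform_limitI)
        fix \<epsilon> :: real assume "\<epsilon> > 0"
        then have "\<forall>\<^sub>F n in sequentially. exp C * (exp (- \<delta> * real n) / \<delta>) < \<epsilon>"
          using order_tendstoD(2)[OF lim] by blast
        then show "\<forall>\<^sub>F n in sequentially. \<forall>z\<in>cball z0 e.
             dist (?g n z) (integral {0..} (\<lambda>u. exp (A z u))) < \<epsilon>"
        proof eventually_elim
          case (elim n)
          then show ?case
            unfolding dist_norm using diff[of _ n] le_less_trans by blast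
        qed
      qed
    qed
    have "(\<lambda>z. integral {0..} (\<lambda>u. exp (A z u))) holomorphic_on ball z0 e"
      by (rule holomorphic_uniform_limit[OF _ ul])
         (use holomorphic_on_imp_continuous_on[OF hol] holomorphic_on_subset[OF hol ball_subset_cball]
            in \<open>auto simp del: cbox_interval\<close>)
    with e show ?thesis by blast
  qed
  then show ?thesis
    by (meson Elementary_Metric_Spaces.open_ball analytic_on_def analytic_on_open D)
qed

section \<open>The upper incomplete gamma function\<close>

lemma slit_plane_open: "open (- \<real>\<^sub>\<le>\<^sub>0 :: complex set)"
  by (simp add: open_Compl)

lemma slit_plane_add_nonneg:
  fixes z :: complex
  assumes "z \<notin> \<real>\<^sub>\<le>\<^sub>0" "0 < r" "0 \<le> u"
  shows "of_real r * z + of_real u \<notin> \<real>\<^sub>\<le>\<^sub>0"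
proof
  assume "of_real r * z + of_real u \<in> \<real>\<^sub>\<le>\<^sub>0"
  then have "r * Re z + u \<le> 0" "r * Im z = 0"
    by (auto simp: complex_nonpos_Reals_iff)
  then have "r * Re z \<le> 0" "Im z = 0" using assms by auto
  then show False
    using assms by (auto simp: complex_nonpos_Reals_iff mult_le_0_iff)
qed

text \<open>The tangent bound for ln at \<open>x / K\<close>. The free parameter \<open>K\<close>
  makes the coefficient of \<open>x\<close> as small as desired, so that a multiple of the logarithm
  can be absorbed by an exponential.\<close>

lemma abs_ln_le:
  assumes "0 < m" "m \<le> x" "1 \<le> K"
  shows "\<bar>ln x\<bar> \<le> \<bar>ln m\<bar> + ln K + x / (K::real)"
proof -
  have "ln (x / K) \<le> x / K - 1" using assms by (intro ln_le_minus_one) auto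
  then have 1: "ln x \<le> ln K + x / K" using assms by (simp add: ln_div)
  have "ln m \<le> ln x" "0 \<le> ln K" "0 \<le> x / K" using assms by auto
  with 1 show ?thesis by linarith
qed

text \<open>Locally uniform domination: on a small disc the power grows at most like exp(|w|/2),
  where w = r z + u, against the factor exp(-Re w).\<close>

lemma upper_Gamma_integrand_bound:
  assumes z0: "z0 \<notin> \<real>\<^sub>\<le>\<^sub>0" and r: "0 < r"
  shows "\<exists>e>0. \<exists>C. \<exists>\<delta>>0. cball z0 e \<subseteq> - \<real>\<^sub>\<le>\<^sub>0 \<and>
           (\<forall>z\<in>cball z0 e. \<forall>u\<ge>0. Re ((p + q * z - 1) * Ln (of_real r * z + of_real u) 
              - (of_real r * z + of_real u)) \<le> C - \<delta> * u)"
proof -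
  obtain e where e: "e > 0" "cball z0 e \<subseteq> - \<real>\<^sub>\<le>\<^sub>0"
    using slit_plane_open z0 by (metis Compl_iff open_contains_cball)
  \<comment> \<open>The modulus of r z + u is the distance of r z from the point -u of the slit, so
    one positive distance \<open>m\<close> bounds it from below for all u at once.\<close>
  have "compact ((\<lambda>z. of_real r * z) ` cball z0 e)"
    by (intro compact_continuous_image continuous_intros) auto
  moreover have "((\<lambda>z. of_real r * z) ` cball z0 e) \<inter> \<real>\<^sub>\<le>\<^sub>0 = {}"
    using e(2) slit_plane_add_nonneg[OF _ r, of _ 0] by auto
  ultimately obtain m where m: "m > 0"
    and m': "\<And>z y. z \<in> cball z0 e \<Longrightarrow> y \<in> \<real>\<^sub>\<le>\<^sub>0 \<Longrightarrow> m \<le> dist (of_real r * z) y"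
    using separate_compact_closed[OF _ closed_nonpos_Reals_complex] by (metis image_eqI)
  define M where "M = norm z0 + e"
  have M: "norm z \<le> M" if "z \<in> cball z0 e" for z
    using that norm_triangle_ineq2[of z z0] by (simp add: M_def dist_norm norm_minus_commute)
  have M0: "0 \<le> M" using e by (simp add: M_def)
  define B where "B = norm p + norm q * M + 1"
  have B0: "B \<ge> 1" using M0 by (simp add: B_def)
  \<comment> \<open>The exponent has modulus at most \<open>B\<close>, so this \<open>K\<close>
    makes the linear part of the logarithm bound contribute |w|/2, which costs half of the decay and
    leaves the rate 1/2.\<close>
  define K where "K = 2 * B"
  define C where "C = B * (\<bar>ln m\<bar> + ln K + pi) + r * M / 2 + r * M"
  have "Re ((p + q * z - 1) * Ln (of_real r * z + of_real u) - (of_real r * z + of_real u))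
      \<le> C - (1/2) * u" if z: "z \<in> cball z0 e" and u: "0 \<le> u" for z u
  proof -
    let ?w = "of_real r * z + of_real u"
    have w0: "?w \<notin> \<real>\<^sub>\<le>\<^sub>0" using slit_plane_add_nonneg[OF _ r u] z e(2) by auto
    then have w1: "?w \<noteq> 0" by auto
    have wm: "m \<le> norm ?w"
      using m'[OF z, of "- of_real u"] u by (auto simp: dist_norm complex_nonpos_Reals_iff)
    have "norm ?w \<le> norm (of_real r * z) + norm (of_real u :: complex)" by (rule norm_triangle_ineq)
    also have "\<dots> \<le> r * M + u" using M[OF z] r u by (simp add: norm_mult mult_left_mono)
    finally have wM: "norm ?w \<le> r * M + u" .
    have "norm (p + q * z - 1) \<le> norm p + norm (q * z) + 1"
      by (metis norm_triangle_ineq norm_triangle_ineq4 norm_one add_right_mono order_trans)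
    also have "norm (q * z) \<le> norm q * M" using M[OF z] by (simp add: norm_mult mult_left_mono)
    finally have SB: "norm (p + q * z - 1) \<le> B" by (simp add: B_def)
    have "norm (Ln ?w) \<le> \<bar>Re (Ln ?w)\<bar> + \<bar>Im (Ln ?w)\<bar>" by (rule cmod_le)
    also have "\<dots> \<le> \<bar>ln (norm ?w)\<bar> + pi"
      using w1 mpi_less_Im_Ln[OF w1] Im_Ln_le_pi[OF w1] by simp
    also have "\<dots> \<le> \<bar>ln m\<bar> + ln K + norm ?w / K + pi"
      using abs_ln_le[OF m wm, of K] B0 by (simp add: K_def)
    finally have LB: "norm (Ln ?w) \<le> \<bar>ln m\<bar> + ln K + norm ?w / K + pi" .
    have "Re ((p + q * z - 1) * Ln ?w) \<le> norm (p + q * z - 1) * norm (Ln ?w)"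
      by (metis complex_Re_le_cmod norm_mult)
    also have "\<dots> \<le> B * (\<bar>ln m\<bar> + ln K + norm ?w / K + pi)"
      using SB LB B0 by (intro mult_mono) auto
    also have "\<dots> = B * (\<bar>ln m\<bar> + ln K + pi) + norm ?w / 2"
      using B0 by (simp add: K_def field_simps)
    also have "\<dots> \<le> B * (\<bar>ln m\<bar> + ln K + pi) + (r * M + u) / 2" using wM by simp
    finally have 1: "Re ((p + q * z - 1) * Ln ?w) \<le> B * (\<bar>ln m\<bar> + ln K + pi) + (r * M + u) / 2" .
    have "\<bar>Re z\<bar> \<le> M" using abs_Re_le_cmod[of z] M[OF z] by linarith
    then have "- M \<le> Re z" by linarith
    then have "r * (- M) \<le> r * Re z" using r by (intro mult_left_mono) auto
    then have "- Re ?w \<le> r * M - u" by simp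
    with 1 show ?thesis unfolding C_def by (simp add: field_simps)
  qed
  then show ?thesis
    using e(2)
    by - (rule exI[of _ e], rule conjI[OF e(1)], rule exI[of _ C], rule exI[of _ "1/2"],
      simp del: minus_complex.sel plus_complex.sel times_complex.sel)
qed

lemma upper_Gamma_eq_exp_integral:
  assumes "z \<notin> \<real>\<^sub>\<le>\<^sub>0"
  shows "upper_Gamma s z = integral {0..} (\<lambda>u. exp ((s - 1) * Ln (z + of_real u) - (z + of_real u)))"
  unfolding upper_Gamma_def
proof (intro integral_cong)
  fix u :: real assume "u \<in> {0..}"
  then have "z + of_real u \<noteq> 0" using slit_plane_add_nonneg[of z 1 u] assms by auto
  then show "(z + of_real u) powr (s - 1) * exp (- (z + of_real u)) =
      exp ((s - 1) * Ln (z + of_real u) - (z + of_real u))"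
    by (simp add: powr_def exp_diff exp_minus divide_inverse exp_add)
qed

text \<open>Order and argument are affine in one variable in order to cover two uses: a fixed order
  (q = 0, r = 1), and the order -a with argument lam a, as a function of a alone.\<close>

lemma upper_Gamma_holomorphic:
  assumes r: "0 < r"
  shows "(\<lambda>z. upper_Gamma (p + q * z) (of_real r * z)) holomorphic_on - \<real>\<^sub>\<le>\<^sub>0"
proof -
  have ne: "of_real r * z + of_real u \<notin> \<real>\<^sub>\<le>\<^sub>0" "of_real r * z + of_real u \<noteq> 0" 
    if "z \<notin> \<real>\<^sub>\<le>\<^sub>0" "0 \<le> u" for z :: complex and u
    using slit_plane_add_nonneg[OF that(1) r that(2)] by auto
  have "(\<lambda>z. integral {0..} (\<lambda>u. exp ((p + q * z - 1) * Ln (of_real r * z + of_real u) 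
              - (of_real r * z + of_real u)))) holomorphic_on - \<real>\<^sub>\<le>\<^sub>0"
  proof (rule holomorphic_on_integral_halfline_exp[where A' = 
        "\<lambda>z u. q * Ln (of_real r * z + of_real u) 
           + (p + q * z - 1) * (of_real r / (of_real r * z + of_real u)) - of_real r"])
    show "open (- \<real>\<^sub>\<le>\<^sub>0 :: complex set)" by (rule slit_plane_open)
    show "((\<lambda>z. (p + q * z - 1) * Ln (of_real r * z + of_real u) - (of_real r * z + of_real u)) 
        has_field_derivative q * Ln (of_real r * z + of_real u) 
           + (p + q * z - 1) * (of_real r / (of_real r * z + of_real u)) - of_real r) (at z)"
      if "z \<in> - \<real>\<^sub>\<le>\<^sub>0" "0 \<le> u" for z u
      using ne[of z u] that by (auto intro!: derivative_eq_intros simp: divide_inverse)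
    show "continuous_on ((- \<real>\<^sub>\<le>\<^sub>0) \<times> {0..}) (\<lambda>(z, u). (p + q * z - 1) * Ln (of_real r * z + of_real u)
         - (of_real r * z + of_real u))"
      unfolding split_beta using ne by (intro continuous_intros) auto
    show "continuous_on ((- \<real>\<^sub>\<le>\<^sub>0) \<times> {0..}) (\<lambda>(z, u). q * Ln (of_real r * z + of_real u) 
           + (p + q * z - 1) * (of_real r / (of_real r * z + of_real u)) - of_real r)"
      unfolding split_beta using ne by (intro continuous_intros) auto
  qed (rule upper_Gamma_integrand_bound[OF _ r], simp)
  moreover have "upper_Gamma (p + q * z) (of_real r * z) = 
      integral {0..} (\<lambda>u. exp ((p + q * z - 1) * Ln (of_real r * z + of_real u) 
              - (of_real r * z + of_real u)))" if "z \<in> - \<real>\<^sub>\<le>\<^sub>0" for z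
    using slit_plane_add_nonneg[OF _ r, of z 0] that by (intro upper_Gamma_eq_exp_integral) auto
  ultimately show ?thesis
    by (metis (no_types, lifting) holomorphic_cong)
qed

lemma upper_Gamma_integrand_absolutely_integrable:
  fixes z s :: complex
  assumes "z \<notin> \<real>\<^sub>\<le>\<^sub>0"
  shows "(\<lambda>u. (z + of_real u) powr (s - 1) * exp (- (z + of_real u))) absolutely_integrable_on {0..}"
proof -
  have ne: "z + of_real u \<notin> \<real>\<^sub>\<le>\<^sub>0" "z + of_real u \<noteq> 0" if "0 \<le> u" for u
    using slit_plane_add_nonneg[OF assms zero_less_one that] by auto
  obtain e C \<delta> where e: "e > 0" and C: "\<delta> > 0" and
    B: "\<forall>z'\<in>cball z e. \<forall>u\<ge>0. Re ((s + 0 * z' - 1) * Ln (of_real 1 * z' + of_real u) 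
          - (of_real 1 * z' + of_real u)) \<le> C - \<delta> * u"
    using upper_Gamma_integrand_bound[OF assms zero_less_one, of s 0]
    by (elim exE conjE) (rule that, assumption+)
  have B': "Re ((s - 1) * Ln (z + of_real u) - (z + of_real u)) \<le> C - \<delta> * u" if "0 \<le> u" for u
    using bspec[OF B, of z] e that by simp
  show ?thesis
  proof (rule absolutely_integrable_on_halfline_exp_bound[OF _ C])
    show "continuous_on {0..} (\<lambda>u. (z + of_real u) powr (s - 1) * exp (- (z + of_real u)))"
    proof -
      have "0 \<le> Re z + u \<or> Im z \<noteq> 0" if "0 \<le> u" for u
        using ne(1)[OF that] by (auto simp: complex_nonpos_Reals_iff)
      then show ?thesis using ne(2) by (intro continuous_intros) auto
    qed
    show "norm ((z + of_real u) powr (s - 1) * exp (- (z + of_real u))) \<le> exp C * exp (- \<delta> * u)"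
      if "0 \<le> u" for u
    proof -
      have "(z + of_real u) powr (s - 1) * exp (- (z + of_real u)) =
          exp ((s - 1) * Ln (z + of_real u) - (z + of_real u))"
        using ne[OF that] by (simp add: powr_def exp_diff exp_minus divide_inverse exp_add)
      then show ?thesis
        using B'[OF that] by (simp flip: exp_add)
    qed
  qed
qed

text \<open>Identity theorem with the positive axis as the set of agreement. \<open>S\<close> is
  left free because it is applied both to the slit plane and to the right half-plane.\<close>

lemma slit_plane_identity:
  fixes f g :: "complex \<Rightarrow> complex"
  assumes "f holomorphic_on S" "g holomorphic_on S" "open S" "connected S" "{z. Im z = 0 \<and> Re z > 0} \<subseteq> S"
    and "\<And>x. 0 < x \<Longrightarrow> f (of_real x) = g (of_real x)" and "z \<in> S"
  shows "f z = g z"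
proof -
  have "f z - g z = 0"
  proof (rule analytic_continuation[where f = "\<lambda>z. f z - g z" and w = z and S = S and U = "{z. Im z = 0 \<and> Re z > 0}" and \<xi> = 1])
    show "(\<lambda>z. f z - g z) holomorphic_on S" by (intro holomorphic_intros assms)
    show "(1::complex) islimpt {z. Im z = 0 \<and> Re z > 0}"
      unfolding islimpt_approachable
    proof (intro allI impI)
      fix e :: real assume "e > 0"
      then show "\<exists>x'\<in>{z. Im z = 0 \<and> Re z > 0}. x' \<noteq> 1 \<and> dist x' 1 < e"
        by (intro bexI[of _ "1 + of_real (e / 2)"]) (auto simp: dist_norm simp del: of_real_divide)
    qed
    show "f z - g z = 0" if "z \<in> {z. Im z = 0 \<and> Re z > 0}" for z
    proof -
      from that have "z = of_real (Re z)" "Re z > 0" by (auto simp: complex_eq_iff)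
      with assms(6)[of "Re z"] show ?thesis by simp
    qed
  qed (use assms in auto)
  then show ?thesis by simp
qed

lemma slit_plane_connected: "connected (- \<real>\<^sub>\<le>\<^sub>0 :: complex set)"
proof -
  have "(\<real>\<^sub>\<le>\<^sub>0 :: complex set) = of_real ` {..0}"
    by (auto simp: nonpos_Reals_def)
  then show ?thesis
    using starlike_imp_connected[OF starlike_slotted_complex_plane_left[of 0]] by simp
qed

section \<open>Splitting the complete gamma function into its upper and lower parts\<close>

lemma continuous_on_Gamma_integrand:
  "continuous_on {0<..} (\<lambda>t. complex_of_real t powr (s - 1) / of_real (exp t))"
  by (intro continuous_intros) auto

lemma upper_Gamma_of_real:
  assumes s: "Re s > 0" and x: "0 < x"
  shows "upper_Gamma s (of_real x) = integral {x..} (\<lambda>t. complex_of_real t powr (s - 1) / of_real (exp t))"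
proof -
  let ?f = "\<lambda>t. complex_of_real t powr (s - 1) / of_real (exp t)"
  have ai0: "?f absolutely_integrable_on {0<..}"
    using absolutely_integrable_Gamma_integral'[OF s] .
  have ai: "?f absolutely_integrable_on {x..}"
    by (rule set_integrable_subset[OF ai0]) (use x in auto)
  have eq: "integral {x + 0..} ?f = integral {0..} (\<lambda>u. 1 *\<^sub>R ?f (x + u))"
  proof (rule integral_halfline_substitution)
    show "?f absolutely_integrable_on {x + 0..}" using ai by simp
    show "continuous_on {x + 0..} ?f"
      by (rule continuous_on_subset[OF continuous_on_Gamma_integrand]) (use x in auto)
    show "(\<lambda>u. 1 *\<^sub>R ?f (x + u)) absolutely_integrable_on {0..}"
    proof -
      have "(of_real x + of_real u) powr (s - 1) * exp (- (of_real x + of_real u)) = 1 *\<^sub>R ?f (x + u)" for u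
        by (simp add: exp_minus exp_diff divide_inverse exp_add flip: exp_of_real)
      then show ?thesis
        using upper_Gamma_integrand_absolutely_integrable[of "of_real x" s] x by simp
    qed
    show "filterlim ((+) x) at_top at_top" by real_asymp
  qed (auto intro!: derivative_eq_intros)
  show ?thesis using eq unfolding upper_Gamma_def
    by (simp add: exp_minus exp_diff divide_inverse exp_add flip: exp_of_real)
qed

text \<open>Substituting t = x exp(-v) takes x^s out of the lower incomplete gamma integral. What
  remains is entire in x and can be continued; up to a factor exp x it is already a Laplace integral
  over a negative half-line.\<close>

lemma lower_Gamma_of_real:
  assumes s: "Re s > 0" and x: "0 < x"
  shows "integral {0<..x} (\<lambda>t. complex_of_real t powr (s - 1) / of_real (exp t)) = 
    of_real x powr s * integral {0..} (\<lambda>v. exp (- s * of_real v - of_real x * of_real (exp (- v))))"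
proof -
  let ?f = "\<lambda>t. complex_of_real t powr (s - 1) / of_real (exp t)"
  let ?h = "\<lambda>v. exp (- s * of_real v - of_real x * of_real (exp (- v)))"
  have ai0: "?f absolutely_integrable_on {0<..}"
    using absolutely_integrable_Gamma_integral'[OF s] .
  have ai: "?f absolutely_integrable_on {0<..x}"
    by (rule set_integrable_subset[OF ai0]) auto
  have aih: "?h absolutely_integrable_on {0..}"
  proof (rule absolutely_integrable_on_halfline_exp_bound[where \<delta> = "Re s" and C = 1])
    show "norm (?h u) \<le> 1 * exp (- Re s * u)" if "0 \<le> u" for u
      using x by simp
  qed (use s in \<open>auto intro!: continuous_intros\<close>)
  \<comment> \<open>The lower limit approaches 0 through the images of the right endpoints of [0, n]
    under the substitution.\<close>
  have lim1: "(\<lambda>n. integral {x * exp (- real n)..x} ?f) \<longlonglongrightarrow> integral {0<..x} ?f"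
  proof (rule integral_exhaustion_tendsto[OF ai])
    show "\<forall>\<^sub>F n in sequentially. y \<in> {x * exp (- real n)..x}" if y: "y \<in> {0<..x}" for y
    proof -
      have "(\<lambda>n. x * exp (- real n)) \<longlonglongrightarrow> 0" by real_asymp
      then have "\<forall>\<^sub>F n in sequentially. x * exp (- real n) < y"
        using y by (intro order_tendstoD(2)) auto
      then show ?thesis by eventually_elim (use y in auto)
    qed
    show "{x * exp (- real n)..x} \<subseteq> {0<..x}" for n
      using less_le_trans[OF mult_pos_pos[OF x exp_gt_zero[of "- real n"]]] by auto
  qed auto
  have inth: "?h integrable_on {0..real n}" for n
    by (intro integrable_continuous_interval continuous_intros)
  have lim2: "(\<lambda>n. of_real x powr s * integral {0..real n} ?h) 
      \<longlonglongrightarrow> of_real x powr s * integral {0..} ?h"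
    by (intro tendsto_mult tendsto_const integral_halfline_tendsto aih filterlim_real_sequentially)
  have eq: "integral {x * exp (- real n)..x} ?f = of_real x powr s * integral {0..real n} ?h" for n
  proof -
    have sub: "(\<lambda>v. x * exp (- v)) ` {0..real n} \<subseteq> {x * exp (- real n)..x}"
      using x by auto
    have "((\<lambda>v. (- x * exp (- v)) *\<^sub>R ?f (x * exp (- v))) has_integral
        (integral {x * exp (- 0)..x * exp (- real n)} ?f 
         - integral {x * exp (- real n)..x * exp (- 0)} ?f)) {0..real n}"
    proof (rule has_integral_substitution_general[of "{}", OF _ _ sub])
      show "continuous_on {x * exp (- real n)..x} ?f"
        by (rule continuous_on_subset[OF continuous_on_Gamma_integrand])
           (use less_le_trans[OF mult_pos_pos[OF x exp_gt_zero[of "- real n"]]] in auto)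
      show "continuous_on {0..real n} (\<lambda>v. x * exp (- v))" by (intro continuous_intros)
      show "((\<lambda>v. x * exp (- v)) has_real_derivative - x * exp (- v)) (at v within {0..real n})" for v
        by (auto intro!: derivative_eq_intros)
    qed auto
    \<comment> \<open>The substitution is decreasing, so the general rule returns a difference of
      integrals for both orders of the endpoints. This one runs over an empty interval, or over a
      single point if n = 0.\<close>
    moreover have "integral {x * exp (- 0)..x * exp (- real n)} ?f = 0"
    proof (cases n)
      case (Suc m)
      then have "x * exp (- real n) < x" using x by auto
      then show ?thesis by auto
    qed auto
    ultimately have *: "((\<lambda>v. (- x * exp (- v)) *\<^sub>R ?f (x * exp (- v))) has_integral
        (- integral {x * exp (- real n)..x} ?f)) {0..real n}" by simp
    have "- ((- x * exp (- v)) *\<^sub>R ?f (x * exp (- v))) = of_real x powr s * ?h v" for v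
    proof -
      have l: "Ln (of_real (x * exp (- v))) = of_real (ln x) - of_real v"
        using x by (subst Ln_of_real) (auto simp: ln_mult)
      have x': "complex_of_real x = exp (of_real (ln x))"
        using x by (metis exp_ln exp_of_real)
      have "?f (x * exp (- v)) = exp ((s - 1) * (of_real (ln x) - of_real v) - of_real x * of_real (exp (- v)))"
        using x l by (simp add: powr_def exp_diff exp_of_real[symmetric])
      moreover have "complex_of_real (x * exp (- v)) = exp (of_real (ln x) - of_real v)"
        using x' by (simp add: exp_diff exp_minus divide_inverse flip: exp_of_real)
      ultimately have "- ((- x * exp (- v)) *\<^sub>R ?f (x * exp (- v))) = exp (of_real (ln x) - of_real v) *
          exp ((s - 1) * (of_real (ln x) - of_real v) - of_real x * of_real (exp (- v)))"
        by (simp add: scaleR_conv_of_real)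
      also have "\<dots> = exp (s * of_real (ln x)) * ?h v"
        unfolding exp_add[symmetric] by (rule arg_cong[where f = exp]) (simp add: algebra_simps)
      also have "exp (s * of_real (ln x)) = of_real x powr s"
        using x by (simp add: powr_def Ln_of_real)
      finally show ?thesis .
    qed
    then have "((\<lambda>v. of_real x powr s * ?h v) has_integral integral {x * exp (- real n)..x} ?f) {0..real n}"
      using has_integral_neg[OF *] by simp
    moreover have "((\<lambda>v. of_real x powr s * ?h v) has_integral of_real x powr s * integral {0..real n} ?h) {0..real n}"
      by (intro has_integral_mult_right integrable_integral inth)
    ultimately show ?thesis by (rule has_integral_unique)
  qed
  show ?thesis using LIMSEQ_unique[OF lim1 lim2[folded eq]] .
qed

text \<open>For positive z this is additivity of Euler's integral. With s held fixed both summands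
  are holomorphic in z on the slit plane, so it extends there; only afterwards are s = -a and z =
  lam a tied together.\<close>

lemma Gamma_split:
  assumes s: "Re s > 0" and z: "z \<notin> \<real>\<^sub>\<le>\<^sub>0"
  shows "upper_Gamma s z + z powr s * integral {0..} (\<lambda>v. exp (- s * of_real v - z * of_real (exp (- v)))) = Gamma s"
proof (rule slit_plane_identity[where f = "\<lambda>z. upper_Gamma s z + z powr s * integral {0..} 
    (\<lambda>v. exp (- s * of_real v - z * of_real (exp (- v))))" and g = "\<lambda>_. Gamma s" and S = "- \<real>\<^sub>\<le>\<^sub>0"])
  have "(\<lambda>z. integral {0..} (\<lambda>v. exp (- s * of_real v - z * of_real (exp (- v))))) holomorphic_on UNIV"
  proof (rule holomorphic_on_integral_halfline_exp[where A' = "\<lambda>z v. - of_real (exp (- v))"])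
    show "\<exists>e>0. \<exists>C. \<exists>\<delta>>0. cball z0 e \<subseteq> UNIV \<and> (\<forall>z\<in>cball z0 e. \<forall>v\<ge>0.
         Re (- s * of_real v - z * of_real (exp (- v))) \<le> C - \<delta> * v)" for z0
    proof (rule exI[of _ 1], intro conjI, simp, rule exI[of _ "norm z0 + 1"], rule exI[of _ "Re s"], 
        intro conjI ballI allI impI)
      fix z and v :: real assume z: "z \<in> cball z0 1" and v: "0 \<le> v"
      have "norm z \<le> norm z0 + 1"
        using z norm_triangle_ineq2[of z z0] by (simp add: dist_norm norm_minus_commute)
      moreover have "- Re z \<le> norm z" using abs_Re_le_cmod[of z] by linarith
      moreover have "- (Re z * exp (- v)) \<le> norm z"
      proof -
        have "- (Re z * exp (- v)) \<le> \<bar>Re z\<bar> * exp (- v)" by (metis abs_ge_minus_self abs_exp_cancel abs_mult)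
        also have "\<dots> \<le> \<bar>Re z\<bar> * 1" using v by (intro mult_left_mono) auto
        also have "\<dots> \<le> norm z" using abs_Re_le_cmod[of z] by simp
        finally show ?thesis .
      qed
      ultimately show "Re (- s * of_real v - z * of_real (exp (- v))) \<le> norm z0 + 1 - Re s * v" by simp
    qed (use s in auto)
  qed (auto intro!: derivative_eq_intros continuous_intros simp: split_beta)
  then have hol: "(\<lambda>z. integral {0..} (\<lambda>v. exp (- s * of_real v - z * of_real (exp (- v))))) holomorphic_on - \<real>\<^sub>\<le>\<^sub>0"
    by (rule holomorphic_on_subset) auto
  have "(\<lambda>z. upper_Gamma s z) holomorphic_on - \<real>\<^sub>\<le>\<^sub>0"
    using upper_Gamma_holomorphic[of 1 s 0] by simp
  then show "(\<lambda>z. upper_Gamma s z + z powr s * integral {0..} 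
    (\<lambda>v. exp (- s * of_real v - z * of_real (exp (- v))))) holomorphic_on - \<real>\<^sub>\<le>\<^sub>0"
    by (intro holomorphic_intros hol) auto
  show "upper_Gamma s (of_real x) + of_real x powr s * integral {0..} 
    (\<lambda>v. exp (- s * of_real v - of_real x * of_real (exp (- v)))) = Gamma s" if x: "0 < x" for x
  proof -
    let ?f = "\<lambda>t. complex_of_real t powr (s - 1) / of_real (exp t)"
    have ai0: "?f absolutely_integrable_on {0<..}"
      using absolutely_integrable_Gamma_integral'[OF s] .
    have 1: "(?f has_integral integral {0<..x} ?f) {0<..x}"
      by (intro integrable_integral set_lebesgue_integral_eq_integral(1) set_integrable_subset[OF ai0]) auto
    have 2: "(?f has_integral integral {x..} ?f) {x..}"
      using x by (intro integrable_integral set_lebesgue_integral_eq_integral(1) set_integrable_subset[OF ai0]) auto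
    have "(?f has_integral (integral {0<..x} ?f + integral {x..} ?f)) ({0<..x} \<union> {x..})"
      by (rule has_integral_Un[OF 1 2], rule negligible_subset[OF negligible_sing[of x]]) auto
    moreover have "{0<..x} \<union> {x..} = {0<..}" using x by auto
    moreover have "(?f has_integral Gamma s) {0<..}"
    proof -
      have n1: "negligible {t \<in> {0..} - {0<..}. ?f t \<noteq> 0}"
        by (rule negligible_subset[OF negligible_sing[of 0]]) auto
      have n2: "negligible {t \<in> {0<..} - {0..}. ?f t \<noteq> 0}"
        by (rule negligible_subset[OF negligible_empty]) auto
      show ?thesis
        by (rule iffD1[OF has_integral_spike_set_eq[OF n1 n2] Gamma_integral_complex[OF s]])
    qed
    ultimately have "integral {0<..x} ?f + integral {x..} ?f = Gamma s"
      by (simp only: has_integral_unique)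
    then show ?thesis
      using upper_Gamma_of_real[OF s x] lower_Gamma_of_real[OF s x] by (simp add: add.commute)
  qed
  show "open (- \<real>\<^sub>\<le>\<^sub>0 :: complex set)" by (rule slit_plane_open)
  show "connected (- \<real>\<^sub>\<le>\<^sub>0 :: complex set)" by (rule slit_plane_connected)
  show "{z. Im z = 0 \<and> 0 < Re z} \<subseteq> - \<real>\<^sub>\<le>\<^sub>0" by (auto simp: complex_nonpos_Reals_iff)
qed (use z in auto)

section \<open>Laplace integrals of the phase function\<close>

definition phase :: "real \<Rightarrow> real \<Rightarrow> real" where
  "phase lam t = lam * (exp t - 1) + t"

text \<open>The integral of exp(-a f) from 0 to sg times infinity. The prefactor is the orientation;
  thanks to it both branches have the same expansion coefficients.\<close>

definition laplace_branch :: "real \<Rightarrow> real \<Rightarrow> complex \<Rightarrow> complex" where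
  "laplace_branch lam sg a = of_real sg * integral {0..} (\<lambda>v. exp (- a * of_real (phase lam (sg * v))))"

definition normalized_Gamma :: "real \<Rightarrow> complex \<Rightarrow> complex" where
  "normalized_Gamma lam a = 
     upper_Gamma (- a) (of_real lam * a) / ((of_real lam * a) powr (- a) * exp (- (of_real lam * a)))"

definition Gamma_jump :: "real \<Rightarrow> complex \<Rightarrow> complex" where
  "Gamma_jump lam a = Gamma (- a) * (of_real lam * a) powr a * exp (of_real lam * a)"

text \<open>exp t - 1 has the sign of t, so the exponential part of the phase only helps the linear
  part.\<close>

lemma phase_sign_ge:
  assumes "0 < lam" "sg = 1 \<or> sg = - 1" "0 \<le> v"
  shows "v \<le> sg * phase lam (sg * v)"
  using assms by (auto simp: phase_def mult_le_0_iff)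

lemma norm_exp_phase_le:
  assumes "0 < lam" "sg = 1 \<or> sg = - 1" "0 \<le> v" "0 \<le> d" "d \<le> sg * Re a"
  shows "norm (exp (- a * of_real (phase lam (sg * v)))) \<le> exp (- d * v)"
proof -
  have "d * v \<le> (sg * Re a) * (sg * phase lam (sg * v))"
    using assms phase_sign_ge[OF assms(1-3)] by (intro mult_mono) auto
  also have "\<dots> = Re a * phase lam (sg * v)" using assms(2) by auto
  finally show ?thesis by simp
qed

lemma laplace_branch_holomorphic:
  assumes lam: "0 < lam" and sg: "sg = 1 \<or> sg = - 1"
  shows "laplace_branch lam sg holomorphic_on {a. sg * Re a > 0}"
proof -
  have op: "open {a. sg * Re a > 0}" by (intro open_Collect_less continuous_intros)
  have "(\<lambda>a. integral {0..} (\<lambda>v. exp (- a * of_real (phase lam (sg * v))))) 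
      holomorphic_on {a. sg * Re a > 0}"
  proof (rule holomorphic_on_integral_halfline_exp[OF op, where A' = "\<lambda>a v. - of_real (phase lam (sg * v))"])
    fix a0 assume a0: "a0 \<in> {a. sg * Re a > 0}"
    define d where "d = sg * Re a0 / 2"
    have d: "d > 0" using a0 by (simp add: d_def)
    have *: "d \<le> sg * Re a" if "a \<in> cball a0 d" for a
    proof -
      have "\<bar>Re a0 - Re a\<bar> \<le> d" using that abs_Re_le_cmod[of "a0 - a"] by (simp add: dist_norm)
      then show ?thesis using sg unfolding d_def by (elim disjE) (simp_all add: abs_if split: if_splits)
    qed
    have sub: "cball a0 d \<subseteq> {a. sg * Re a > 0}" using * d by fastforce
    have bd: "\<forall>a\<in>cball a0 d. \<forall>v\<ge>0. Re (- a * of_real (phase lam (sg * v))) \<le> 0 - d * v"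
    proof (intro ballI allI impI)
      fix a and v :: real assume "a \<in> cball a0 d" "0 \<le> v"
      then show "Re (- a * of_real (phase lam (sg * v))) \<le> 0 - d * v"
        using norm_exp_phase_le[OF lam sg, of v d a] d *[of a] by simp
    qed
    show "\<exists>e>0. \<exists>C. \<exists>\<delta>>0. cball a0 e \<subseteq> {a. sg * Re a > 0} \<and> (\<forall>a\<in>cball a0 e. \<forall>v\<ge>0. 
        Re (- a * of_real (phase lam (sg * v))) \<le> C - \<delta> * v)"
      by (rule exI[of _ d], rule conjI[OF d], rule exI[of _ 0], rule exI[of _ d])
         (use d sub bd in blast)
  qed (auto intro!: derivative_eq_intros continuous_intros simp: split_beta phase_def)
  then show ?thesis unfolding laplace_branch_def by (intro holomorphic_intros)
qed

lemma normalized_Gamma_holomorphic: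
  assumes "0 < lam"
  shows "normalized_Gamma lam holomorphic_on - \<real>\<^sub>\<le>\<^sub>0"
proof -
  have "of_real lam * z \<notin> \<real>\<^sub>\<le>\<^sub>0" if "z \<in> - \<real>\<^sub>\<le>\<^sub>0" for z :: complex
    using slit_plane_add_nonneg[OF _ assms, of z 0] that by auto
  moreover have "of_real lam * z \<noteq> 0" if "z \<in> - \<real>\<^sub>\<le>\<^sub>0" for z :: complex
    using assms that by auto
  moreover have "(\<lambda>a. upper_Gamma (- a) (of_real lam * a)) holomorphic_on - \<real>\<^sub>\<le>\<^sub>0"
    using upper_Gamma_holomorphic[OF assms, of 0 "-1"] by simp
  ultimately show ?thesis
    unfolding normalized_Gamma_def by (intro holomorphic_intros) (auto simp: powr_def)
qed

lemma Gamma_jump_holomorphic: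
  assumes "0 < lam"
  shows "Gamma_jump lam holomorphic_on {a. Im a \<noteq> 0}"
proof -
  have "of_real lam * z \<notin> \<real>\<^sub>\<le>\<^sub>0" if "z \<in> {a. Im a \<noteq> 0}" for z :: complex
    using assms that by (auto simp: complex_nonpos_Reals_iff)
  moreover have "- z \<notin> \<int>\<^sub>\<le>\<^sub>0" if "z \<in> {a. Im a \<noteq> 0}" for z :: complex
    using that by (auto elim!: nonpos_Ints_cases simp: complex_eq_iff)
  ultimately show ?thesis
    unfolding Gamma_jump_def by (intro holomorphic_intros) auto
qed

text \<open>The substitution is z + u = z exp t. It maps t >= 0 onto the horizontal ray of
  \<open>upper_Gamma\<close> only when z is real, so it is carried out there and continued
  afterwards.\<close>

lemma normalized_Gamma_of_real:
  assumes lam: "0 < lam" and x: "0 < x"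
  shows "normalized_Gamma lam (of_real x) = laplace_branch lam 1 (of_real x)"
proof -
  define z where "z = lam * x"
  have z: "z > 0" using assms by (simp add: z_def)
  have zn: "complex_of_real z \<notin> \<real>\<^sub>\<le>\<^sub>0" using z by auto
  let ?f = "\<lambda>u. (of_real z + complex_of_real u) powr (- of_real x - 1) * exp (- (of_real z + complex_of_real u))"
  let ?g = "\<lambda>t. z * (exp t - 1)"
  let ?h = "\<lambda>t. exp (- of_real x * complex_of_real (phase lam (1 * t)))"
  have fin: "?f absolutely_integrable_on {0..}"
    using upper_Gamma_integrand_absolutely_integrable[OF zn, of "- of_real x"] .
  have hint: "?h absolutely_integrable_on {0..}"
  proof (rule absolutely_integrable_on_halfline_exp_bound[where \<delta> = x and C = 1])
    show "norm (?h t) \<le> 1 * exp (- x * t)" if "0 \<le> t" for t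
      using norm_exp_phase_le[OF lam, of 1 t x "of_real x"] that x by simp
  qed (use x in \<open>auto intro!: continuous_intros simp: phase_def\<close>)
  have eq: "(z * exp t) *\<^sub>R ?f (?g t) = of_real z powr (- of_real x) * exp (- of_real z) * ?h t" for t
  proof -
    have 1: "of_real z + complex_of_real (?g t) = exp (of_real (ln z) + of_real t)"
      using z by (simp add: algebra_simps exp_add exp_of_real)
    have 2: "Ln (of_real z + complex_of_real (?g t)) = of_real (ln z) + of_real t"
      unfolding 1 by (subst Ln_exp) auto
    have 3: "complex_of_real (z * exp t) = exp (of_real (ln z) + of_real t)"
      using z by (simp add: algebra_simps exp_add exp_of_real)
    have 4: "of_real z powr (- of_real x) = exp (- of_real x * complex_of_real (ln z))"
      using z by (simp add: powr_def Ln_of_real)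
    have 5: "?f (?g t) = exp ((- of_real x - 1) * (of_real (ln z) + of_real t)) * exp (- (of_real z + complex_of_real (?g t)))"
      unfolding powr_def 2 unfolding 1 by simp
    show ?thesis unfolding scaleR_conv_of_real 3 4 5 unfolding exp_add[symmetric] mult.assoc[symmetric]
      by (rule arg_cong[where f = exp]) (simp add: algebra_simps phase_def z_def)
  qed
  have "integral {?g 0..} ?f = integral {0..} (\<lambda>t. (z * exp t) *\<^sub>R ?f (?g t))"
  proof (rule integral_halfline_substitution)
    show "?f absolutely_integrable_on {?g 0..}" using fin by simp
    show "continuous_on {?g 0..} ?f" using z by (intro continuous_intros) (auto simp: complex_eq_iff)
    show "(\<lambda>t. (z * exp t) *\<^sub>R ?f (?g t)) absolutely_integrable_on {0..}"
      unfolding eq using hint by (rule set_integrable_mult_right)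
    show "filterlim ?g at_top at_top" using z by real_asymp
    show "?g s \<le> ?g t" if "s \<le> t" for s t using that z by simp
  qed (auto intro!: derivative_eq_intros)
  also have "\<dots> = of_real z powr (- of_real x) * exp (- of_real z) * integral {0..} ?h"
    unfolding eq by (rule integral_mult_right)
  finally have "upper_Gamma (- of_real x) (of_real z) = 
      of_real z powr (- of_real x) * exp (- of_real z) * integral {0..} ?h"
    unfolding upper_Gamma_def by simp
  then show ?thesis
    using z lam x unfolding normalized_Gamma_def laplace_branch_def z_def by (simp add: powr_def)
qed

lemma normalized_Gamma_eq_laplace:
  assumes lam: "0 < lam" and a: "Re a > 0"
  shows "normalized_Gamma lam a = laplace_branch lam 1 a"
proof (rule slit_plane_identity[where f = "normalized_Gamma lam" and g = "laplace_branch lam 1"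
      and S = "{a. 1 * Re a > 0}"])
  show "normalized_Gamma lam holomorphic_on {a. 1 * Re a > 0}"
    by (rule holomorphic_on_subset[OF normalized_Gamma_holomorphic[OF lam]])
       (auto simp: complex_nonpos_Reals_iff)
  show "laplace_branch lam 1 holomorphic_on {a. 1 * Re a > 0}"
    by (rule laplace_branch_holomorphic[OF lam]) simp
  show "open {a. 1 * Re a > 0}" by (intro open_Collect_less continuous_intros)
  show "connected {a. 1 * Re a > 0}"
    using convex_halfspace_Re_gt[of 0] by (simp add: convex_connected)
qed (use normalized_Gamma_of_real[OF lam] a in auto)

text \<open>Here -a has positive real part, so \<open>Gamma_split\<close> applies at s = -a. Since z
  + a v - z exp(-v) = -a f(-v), the lower integral times exp z is the Laplace integral over the
  negative half-line.\<close>

lemma normalized_Gamma_minus_jump: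
  assumes lam: "0 < lam" and a: "Re a < 0" "Im a \<noteq> 0"
  shows "normalized_Gamma lam a - Gamma_jump lam a = laplace_branch lam (- 1) a"
proof -
  define z where "z = of_real lam * a"
  let ?I = "integral {0..} (\<lambda>v. exp (- (- a) * of_real v - z * of_real (exp (- v))))"
  have z: "z \<notin> \<real>\<^sub>\<le>\<^sub>0" using lam a by (auto simp: z_def complex_nonpos_Reals_iff)
  then have z0: "z \<noteq> 0" by auto
  have "upper_Gamma (- a) z + z powr (- a) * ?I = Gamma (- a)"
    by (rule Gamma_split) (use a z in auto)
  then have 1: "upper_Gamma (- a) z = Gamma (- a) - z powr (- a) * ?I" by (simp add: algebra_simps)
  have 2: "z powr (- a) * z powr a = 1" using z0 by (simp add: powr_minus)
  have "normalized_Gamma lam a = Gamma_jump lam a - exp z * ?I"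
    unfolding normalized_Gamma_def Gamma_jump_def z_def[symmetric] 1
    using z0 2 by (simp add: field_simps exp_minus powr_minus)
  also have "exp z * ?I = integral {0..} (\<lambda>v. exp z * exp (- (- a) * of_real v - z * of_real (exp (- v))))"
    by simp
  also have "(\<lambda>v. exp z * exp (- (- a) * of_real v - z * of_real (exp (- v)))) = 
      (\<lambda>v. exp (- a * of_real (phase lam (- 1 * v))))"
    unfolding exp_add[symmetric]
    by (intro ext arg_cong[where f = exp]) (simp add: phase_def z_def algebra_simps)
  finally show ?thesis by (simp add: laplace_branch_def)
qed

section \<open>Asymptotic expansion by repeated integration by parts\<close>

definition sigmoid :: "real \<Rightarrow> complex \<Rightarrow> complex" where
  "sigmoid lam t = of_real lam * exp t / (1 + of_real lam * exp t)"

text \<open>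
  Integrating \<open>exp (- a * f)\<close> by parts replaces the weight \<open>g\<close> by the derivative of \<open>g / f'\<close>.
  In terms of \<open>u = sigmoid lam t\<close> one has \<open>1 / f' = 1 - u\<close> and \<open>u' = u * (1 - u)\<close>, so that all
  the weights are polynomials in \<open>u\<close>; from the first step on they contain the integrable factor
  \<open>u * (1 - u)\<close>, which makes the bounds uniform up to the imaginary axis.
\<close>
fun ibp_poly :: "nat \<Rightarrow> complex poly" where
  "ibp_poly 0 = 1"
| "ibp_poly (Suc n) = [:0, 1, -1:] * pderiv ([:1, -1:] * ibp_poly n)"

text \<open>The n-th weight divided by f' at t = 0, that is, the boundary term of the n-th
  integration by parts.\<close>

definition ibp_coeff :: "real \<Rightarrow> nat \<Rightarrow> complex" where
  "ibp_coeff lam n = poly ([:1, -1:] * ibp_poly n) (sigmoid lam 0)"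

lemma sigmoid_has_field_derivative:
  assumes "1 + of_real lam * exp t \<noteq> 0"
  shows "(sigmoid lam has_field_derivative sigmoid lam t * (1 - sigmoid lam t)) (at t)"
  unfolding sigmoid_def using assms
  by (auto intro!: derivative_eq_intros simp: field_simps power2_eq_square)

lemma one_minus_sigmoid:
  assumes "1 + of_real lam * exp t \<noteq> 0"
  shows "1 - sigmoid lam t = 1 / (1 + of_real lam * exp t)"
  unfolding sigmoid_def using assms by (simp add: field_simps)

lemma poly_one_minus_sigmoid:
  assumes "1 + of_real lam * exp t \<noteq> 0"
  shows "poly ([:1, -1:] * p) (sigmoid lam t) * (1 + of_real lam * exp t) = poly p (sigmoid lam t)"
proof -
  have "poly ([:1, -1:] * p) (sigmoid lam t) = (1 - sigmoid lam t) * poly p (sigmoid lam t)"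
    by (simp add: algebra_simps)
  then show ?thesis unfolding one_minus_sigmoid[OF assms] using assms by simp
qed

lemma ibp_poly_has_field_derivative:
  assumes "1 + of_real lam * exp t \<noteq> 0"
  shows "((\<lambda>t. poly ([:1, -1:] * ibp_poly n) (sigmoid lam t)) has_field_derivative 
           poly (ibp_poly (Suc n)) (sigmoid lam t)) (at t)"
proof -
  have "((\<lambda>t. poly ([:1, -1:] * ibp_poly n) (sigmoid lam t)) has_field_derivative 
       poly (pderiv ([:1, -1:] * ibp_poly n)) (sigmoid lam t) * (sigmoid lam t * (1 - sigmoid lam t))) (at t)"
    by (rule DERIV_chain2[OF poly_DERIV sigmoid_has_field_derivative[OF assms]])
  moreover have "poly (pderiv ([:1, -1:] * ibp_poly n)) (sigmoid lam t) * (sigmoid lam t * (1 - sigmoid lam t)) =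
      poly (ibp_poly (Suc n)) (sigmoid lam t)"
    by (simp add: algebra_simps)
  ultimately show ?thesis by (simp only:)
qed

lemma real_sigmoid:
  assumes "0 < lam"
  shows "sigmoid lam (of_real t) = of_real (lam * exp t / (1 + lam * exp t))"
    and "0 < lam * exp t / (1 + lam * exp t)" "lam * exp t / (1 + lam * exp t) < 1"
    and "1 + of_real lam * exp (complex_of_real t) \<noteq> 0"
proof -
  have *: "1 + lam * exp t > 0" using assms by (simp add: add_pos_pos)
  show "sigmoid lam (of_real t) = of_real (lam * exp t / (1 + lam * exp t))"
    by (simp add: sigmoid_def flip: exp_of_real)
  show "0 < lam * exp t / (1 + lam * exp t)" "lam * exp t / (1 + lam * exp t) < 1"
    using * assms by auto
  have "1 + of_real lam * exp (complex_of_real t) = of_real (1 + lam * exp t)"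
    by (simp flip: exp_of_real)
  then show "1 + of_real lam * exp (complex_of_real t) \<noteq> 0" using * by (metis of_real_eq_0_iff less_irrefl)
qed

lemma poly_bounded_unit_interval: "\<exists>C\<ge>0. \<forall>x\<in>{0..1}. norm (poly p (complex_of_real x)) \<le> C"
proof -
  have "compact ((\<lambda>x. poly p (complex_of_real x)) ` {0..1})"
    by (intro compact_continuous_image continuous_intros) auto
  then obtain C where "\<forall>y\<in>(\<lambda>x. poly p (complex_of_real x)) ` {0..1}. norm y \<le> C"
    using compact_imp_bounded bounded_iff by blast
  then show ?thesis by (intro exI[of _ "max C 0"]) (auto simp: le_max_iff_disj)
qed

lemma ibp_poly_bound:
  assumes "0 < lam"
  shows "\<exists>C\<ge>0. \<forall>t. norm (poly p (sigmoid lam (of_real t))) \<le> C"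
  using poly_bounded_unit_interval[of p] real_sigmoid[OF assms] by (metis atLeastAtMost_iff less_imp_le)

text \<open>u (1 - u) is the derivative of u, which stays between 0 and 1. This gives a mass bound
  that does not involve a.\<close>

lemma sigmoid_density_integral:
  assumes lam: "0 < lam" and sg: "sg = 1 \<or> sg = - 1"
  defines "u \<equiv> \<lambda>t. lam * exp t / (1 + lam * exp (t::real))"
  shows "(\<lambda>v. u (sg * v) * (1 - u (sg * v))) integrable_on {0..}"
    and "integral {0..} (\<lambda>v. u (sg * v) * (1 - u (sg * v))) \<le> 1"
proof -
  have *: "1 + lam * exp t > 0" for t using lam by (simp add: add_pos_pos)
  have u01: "0 < u t" "u t < 1" for t using real_sigmoid[OF lam, of t] unfolding u_def by auto
  have der: "((\<lambda>v. sg * u (sg * v)) has_real_derivative u (sg * v) * (1 - u (sg * v))) (at v)" for v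
  proof -
    have sg2: "sg * sg = 1" using sg by auto
    have "(u has_real_derivative u t * (1 - u t)) (at t)" for t
      unfolding u_def using *[of t]
      by (auto intro!: derivative_eq_intros simp: field_simps power2_eq_square)
    then have "((\<lambda>v. sg * u (sg * v)) has_real_derivative sg * (u (sg * v) * (1 - u (sg * v)) * sg)) (at v)"
      by (intro DERIV_cmult DERIV_chain2[where f = u and g = "\<lambda>v. sg * v" and x = v]) 
         (auto intro!: derivative_eq_intros)
    also have "sg * (u (sg * v) * (1 - u (sg * v)) * sg) = (sg * sg) * (u (sg * v) * (1 - u (sg * v)))"
      by (simp only: ac_simps)
    finally show ?thesis by (simp add: sg2)
  qed
  have part: "((\<lambda>v. u (sg * v) * (1 - u (sg * v))) has_integral (sg * u (sg * real n) - sg * u (sg * 0))) {0..real n}" for n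
    by (intro fundamental_theorem_of_calculus)
       (auto intro: has_field_derivative_at_within[OF der] simp flip: has_real_derivative_iff_has_vector_derivative)
  have le1: "integral {0..real n} (\<lambda>v. u (sg * v) * (1 - u (sg * v))) \<le> 1" for n
  proof -
    have "sg * u (sg * real n) - sg * u (sg * 0) \<le> 1"
      using sg u01[of "sg * real n"] u01[of 0] by auto
    then show ?thesis using integral_unique[OF part[of n]] by simp
  qed
  let ?w = "\<lambda>v. u (sg * v) * (1 - u (sg * v))"
  let ?k = "\<lambda>n v. if v \<in> {0..real n} then ?w v else 0"
  have ik: "?k n integrable_on {0..}" "integral {0..} (?k n) = integral {0..real n} ?w" for n
  proof -
    have 1: "{0..real n} \<inter> {0..} = {0..real n}" by auto
    show "?k n integrable_on {0..}"
      using part[of n] unfolding integrable_restrict_Int 1 by (auto simp: integrable_on_def)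
    show "integral {0..} (?k n) = integral {0..real n} ?w"
      unfolding integral_restrict_Int by (rule arg_cong[where f = "\<lambda>S. integral S ?w"]) auto
  qed
  have w0: "0 \<le> ?w v" for v using u01[of "sg * v"] by simp
  have conv: "(\<lambda>n. ?k n v) \<longlonglongrightarrow> ?w v" if "v \<in> {0..}" for v
  proof -
    have "\<forall>\<^sub>F n in sequentially. v \<le> real n" by real_asymp
    then show ?thesis using that by (intro tendsto_eventually) (elim eventually_mono, simp)
  qed
  have 0: "0 \<le> integral {0..} (?k n)" for n using ik(1) w0 by (intro integral_nonneg) auto
  have "?w integrable_on {0..} \<and> (\<lambda>n. integral {0..} (?k n)) \<longlonglongrightarrow> integral {0..} ?w"
  proof (rule monotone_convergence_increasing)
    show "bounded (range (\<lambda>n. integral {0..} (?k n)))"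
      unfolding bounded_iff using 0 ik le1 by (intro exI[of _ 1]) auto
  qed (use ik w0 conv in auto)
  then show "?w integrable_on {0..}" "integral {0..} ?w \<le> 1"
    using LIMSEQ_le_const2[of "\<lambda>n. integral {0..} (?k n)" "integral {0..} ?w" 1] ik le1 by auto
qed

lemma laplace_branch_ibp:
  assumes lam: "0 < lam" and sg: "sg = 1 \<or> sg = - 1" and a: "sg * Re a > 0"
  defines "E \<equiv> \<lambda>v. exp (- a * complex_of_real (phase lam (sg * v)))"
    and "s \<equiv> \<lambda>v. sigmoid lam (of_real (sg * v))"
  shows "(\<lambda>v. E v * poly p (s v)) absolutely_integrable_on {0..}"
    and "of_real sg * integral {0..} (\<lambda>v. E v * poly (ibp_poly n) (s v)) = 
      (ibp_coeff lam n + of_real sg * integral {0..} (\<lambda>v. E v * poly (ibp_poly (Suc n)) (s v))) / a"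
proof -
  have a0: "a \<noteq> 0" using a by auto
  note nz = real_sigmoid(4)[OF lam]
  have "1 + of_real lam * exp (complex_of_real sg * complex_of_real v) \<noteq> 0" for v
    using nz[of "sg * v"] by simp
  then have cs: "continuous_on A s" for A
    unfolding s_def sigmoid_def by (intro continuous_intros) auto
  have cE: "continuous_on A E" for A
    unfolding E_def phase_def by (intro continuous_intros)
  show ai: "(\<lambda>v. E v * poly p (s v)) absolutely_integrable_on {0..}" for p
  proof -
    obtain C where C: "C \<ge> 0" "\<And>t. norm (poly p (sigmoid lam (of_real t))) \<le> C"
      using ibp_poly_bound[OF lam] by blast
    show ?thesis
    proof (rule absolutely_integrable_on_halfline_exp_bound[OF _ a])
      show "norm (E v * poly p (s v)) \<le> C * exp (- (sg * Re a) * v)" if "0 \<le> v" for v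
      proof -
        have "norm (E v) \<le> exp (- (sg * Re a) * v)"
          unfolding E_def using a by (intro norm_exp_phase_le[OF lam sg that]) auto
        then have "norm (E v) * norm (poly p (s v)) \<le> exp (- (sg * Re a) * v) * C"
          using C(1) unfolding s_def by (intro mult_mono C(2)) auto
        then show ?thesis by (simp add: norm_mult mult.commute)
      qed
    qed (intro continuous_intros cs cE)
  qed
  define Q where "Q = [:1, -1:] * ibp_poly n"
  \<comment> \<open>Since E' = -a sg f' E and Q is the n-th weight divided by f', differentiating
    this function reproduces sg times the old integrand and subtracts sg/a times the one with the
    next weight. It vanishes at infinity, and -\<Phi>(0) is the boundary term.\<close>
  define \<Phi> where "\<Phi> = (\<lambda>v. - (E v * poly Q (s v)) / a)"
  define \<phi> where "\<phi> = (\<lambda>v. of_real sg * (E v * poly (ibp_poly n) (s v)) 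
      - of_real sg * (E v * poly (ibp_poly (Suc n)) (s v)) / a)"
  have der: "(\<Phi> has_vector_derivative \<phi> v) (at v)" for v
  proof -
    let ?t = "complex_of_real (sg * v)"
    have dE: "((\<lambda>x. exp (- a * (of_real lam * (exp (of_real sg * x) - 1) + of_real sg * x))) has_field_derivative
        - a * of_real sg * (1 + of_real lam * exp ?t) * E v) (at (of_real v))"
      unfolding E_def phase_def
      by (rule derivative_eq_intros refl | simp)+ (simp add: algebra_simps flip: exp_of_real)
    have dQ: "((\<lambda>x. poly Q (sigmoid lam (of_real sg * x))) has_field_derivative 
        poly (ibp_poly (Suc n)) (s v) * of_real sg) (at (of_real v))"
      unfolding Q_def s_def
      by (rule DERIV_chain2[where g = "\<lambda>x. of_real sg * x" and x = "of_real v"])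
         (use ibp_poly_has_field_derivative[of lam "of_real (sg * v)" n, OF nz] in \<open>auto intro!: derivative_eq_intros\<close>)
    have Ev: "exp (- a * (of_real lam * (exp (of_real sg * of_real v) - 1) + of_real sg * of_real v)) = E v" for v
      unfolding E_def phase_def by (simp add: exp_of_real[symmetric])
    have sv: "sigmoid lam (of_real sg * of_real v) = s v" for v by (simp add: s_def)
    have Qs: "poly Q (s v) * (1 + of_real lam * exp ?t) = poly (ibp_poly n) (s v)"
      unfolding Q_def s_def by (rule poly_one_minus_sigmoid[OF nz])
    have "((\<lambda>x. - (exp (- a * (of_real lam * (exp (of_real sg * x) - 1) + of_real sg * x)) 
          * poly Q (sigmoid lam (of_real sg * x))) / a) has_field_derivative
        - ((- a * of_real sg * (1 + of_real lam * exp ?t) * E v) * poly Q (s v) +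
          poly (ibp_poly (Suc n)) (s v) * of_real sg * E v) / a) (at (of_real v))"
      using DERIV_cdivide[OF DERIV_minus[OF DERIV_mult[OF dE dQ]], of a]
      unfolding Ev sv by simp
    also have "- ((- a * of_real sg * (1 + of_real lam * exp ?t) * E v) * poly Q (s v) +
          poly (ibp_poly (Suc n)) (s v) * of_real sg * E v) / a = 
        of_real sg * (E v * (poly Q (s v) * (1 + of_real lam * exp ?t))) 
          - of_real sg * (E v * poly (ibp_poly (Suc n)) (s v)) / a"
      using a0 by (simp add: divide_simps)
    finally have "((\<lambda>x. - (exp (- a * (of_real lam * (exp (of_real sg * x) - 1) + of_real sg * x)) 
          * poly Q (sigmoid lam (of_real sg * x))) / a) has_field_derivative \<phi> v) (at (of_real v))"
      unfolding Qs \<phi>_def .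
    from has_vector_derivative_real_field[OF this] show ?thesis
      unfolding \<Phi>_def Ev sv .
  qed
  have lim: "(\<Phi> \<longlongrightarrow> 0) at_top"
  proof -
    obtain C where C: "C \<ge> 0" "\<And>t. norm (poly Q (sigmoid lam (of_real t))) \<le> C"
      using ibp_poly_bound[OF lam] by blast
    have "\<forall>\<^sub>F v in at_top. norm (\<Phi> v) \<le> C / norm a * exp (- (sg * Re a) * v)"
      using eventually_ge_at_top[of 0]
    proof eventually_elim
      case (elim v)
      have "norm (E v) \<le> exp (- (sg * Re a) * v)"
        unfolding E_def using a elim by (intro norm_exp_phase_le[OF lam sg]) auto
      then have "norm (E v) * norm (poly Q (s v)) \<le> exp (- (sg * Re a) * v) * C"
        using C(1) unfolding s_def by (intro mult_mono C(2)) auto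
      then show ?case unfolding \<Phi>_def
        by (simp add: norm_mult norm_divide divide_right_mono mult.commute)
    qed
    moreover have "((\<lambda>v. C / norm a * exp (- (sg * Re a) * v)) \<longlongrightarrow> 0) at_top"
    proof -
      have "((\<lambda>v. exp (- k * v)) \<longlongrightarrow> 0) at_top" if "k > 0" for k :: real 
        using that by real_asymp
      from this[OF a]
      have "((\<lambda>v. exp (- (sg * Re a) * v)) \<longlongrightarrow> 0) at_top" .
      from tendsto_mult_right_zero[OF this] show ?thesis .
    qed
    ultimately show ?thesis by (rule Lim_null_comparison)
  qed
  have i: "(\<lambda>v. E v * poly p (s v)) integrable_on {0..}" for p
    using ai set_lebesgue_integral_eq_integral(1) by blast
  have "\<phi> absolutely_integrable_on {0..}"
    unfolding \<phi>_def using ai[of "ibp_poly n"] ai[of "ibp_poly (Suc n)"]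
    by (intro set_integral_diff(1) set_integrable_mult_right set_integrable_divide) auto
  from integral_halfline_FTC[OF this der lim]
  have "integral {0..} \<phi> = ibp_coeff lam n / a"
    by (simp add: \<Phi>_def E_def s_def phase_def ibp_coeff_def Q_def)
  moreover have "integral {0..} \<phi> = of_real sg * integral {0..} (\<lambda>v. E v * poly (ibp_poly n) (s v)) -
      of_real sg * integral {0..} (\<lambda>v. E v * poly (ibp_poly (Suc n)) (s v)) / a"
  proof -
    have "integral {0..} (\<lambda>v. of_real sg * (E v * poly p (s v)) - of_real sg * (E v * poly q (s v)) / a) =
      of_real sg * integral {0..} (\<lambda>v. E v * poly p (s v)) - of_real sg * integral {0..} (\<lambda>v. E v * poly q (s v)) / a"
      for p q
      using has_integral_diff[OF has_integral_mult_right[OF integrable_integral[OF i[of p]], of "of_real sg"]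
          has_integral_divide[OF has_integral_mult_right[OF integrable_integral[OF i[of q]], of "of_real sg"], of a]]
      by (rule integral_unique)
    then show ?thesis unfolding \<phi>_def .
  qed
  ultimately show "of_real sg * integral {0..} (\<lambda>v. E v * poly (ibp_poly n) (s v)) = 
      (ibp_coeff lam n + of_real sg * integral {0..} (\<lambda>v. E v * poly (ibp_poly (Suc n)) (s v))) / a"
    by (simp add: add_divide_distrib algebra_simps)
qed

lemma laplace_branch_expansion:
  assumes lam: "0 < lam" and sg: "sg = 1 \<or> sg = - 1" and a: "sg * Re a > 0"
  shows "laplace_branch lam sg a = (\<Sum>n<N. ibp_coeff lam n / a ^ Suc n) + of_real sg * integral {0..} 
     (\<lambda>v. exp (- a * of_real (phase lam (sg * v))) * poly (ibp_poly N) (sigmoid lam (of_real (sg * v)))) / a ^ N"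
proof (induction N)
  case 0
  show ?case by (simp add: laplace_branch_def)
next
  case (Suc N)
  show ?case unfolding Suc laplace_branch_ibp(2)[OF lam sg a, of N]
    by (simp add: add_divide_distrib divide_divide_eq_left mult.commute)
qed

text \<open>The expansion is taken one order further. The next weight is a bounded polynomial times
  u (1 - u), and |E| <= 1 on the half-plane, so its integral is bounded even where the decay of E
  degenerates near the imaginary axis.\<close>

lemma laplace_branch_remainder_bounded:
  assumes lam: "0 < lam" and sg: "sg = 1 \<or> sg = - 1"
  shows "\<exists>C. \<forall>a. sg * Re a > 0 \<longrightarrow> 
    norm (a ^ Suc N * (laplace_branch lam sg a - (\<Sum>n<N. ibp_coeff lam n / a ^ Suc n))) \<le> C"
proof -
  define u where "u = (\<lambda>t. lam * exp t / (1 + lam * exp (t::real)))"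
  let ?P = "pderiv ([:1, -1:] * ibp_poly N)"
  obtain C where C: "C \<ge> 0" "\<And>t. norm (poly ?P (sigmoid lam (of_real t))) \<le> C"
    using ibp_poly_bound[OF lam] by blast
  have ui: "(\<lambda>v. u (sg * v) * (1 - u (sg * v))) integrable_on {0..}"
    "integral {0..} (\<lambda>v. u (sg * v) * (1 - u (sg * v))) \<le> 1"
    using sigmoid_density_integral[OF lam sg] unfolding u_def by auto
  have "norm (a ^ Suc N * (laplace_branch lam sg a - (\<Sum>n<N. ibp_coeff lam n / a ^ Suc n))) 
      \<le> norm (ibp_coeff lam N) + C" if a: "sg * Re a > 0" for a
  proof -
    have a0: "a \<noteq> 0" using a by auto
    let ?I = "integral {0..} (\<lambda>v. exp (- a * of_real (phase lam (sg * v))) 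
        * poly (ibp_poly (Suc N)) (sigmoid lam (of_real (sg * v))))"
    have "laplace_branch lam sg a - (\<Sum>n<N. ibp_coeff lam n / a ^ Suc n) =
        (ibp_coeff lam N + of_real sg * ?I) / a ^ Suc N"
      using laplace_branch_expansion[OF lam sg a, of "Suc N"] by (simp add: add_divide_distrib)
    then have "a ^ Suc N * (laplace_branch lam sg a - (\<Sum>n<N. ibp_coeff lam n / a ^ Suc n)) =
       ibp_coeff lam N + of_real sg * ?I" using a0 by simp
    moreover have "norm ?I \<le> integral {0..} (\<lambda>v. C * (u (sg * v) * (1 - u (sg * v))))"
    proof (rule integral_norm_bound_integral)
      show "(\<lambda>v. exp (- a * of_real (phase lam (sg * v))) 
        * poly (ibp_poly (Suc N)) (sigmoid lam (of_real (sg * v)))) integrable_on {0..}"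
        using laplace_branch_ibp(1)[OF lam sg a] set_lebesgue_integral_eq_integral(1) by blast
      show "(\<lambda>v. C * (u (sg * v) * (1 - u (sg * v)))) integrable_on {0..}"
        using has_integral_mult_right[OF integrable_integral[OF ui(1)]] by (auto simp: integrable_on_def)
      fix v :: real assume "v \<in> {0..}"
      then have "norm (exp (- a * of_real (phase lam (sg * v)))) \<le> 1"
        using norm_exp_phase_le[OF lam sg, of v 0 a] a by simp
      moreover have "norm (poly (ibp_poly (Suc N)) (sigmoid lam (of_real (sg * v)))) \<le> 
          C * (u (sg * v) * (1 - u (sg * v)))"
      proof -
        let ?s = "sigmoid lam (of_real (sg * v))"
        have s: "?s = of_real (u (sg * v))" using real_sigmoid(1)[OF lam] unfolding u_def by blast
        have "poly (ibp_poly (Suc N)) ?s = poly ?P ?s * (?s * (1 - ?s))"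
          by (simp add: algebra_simps)
        also have "norm \<dots> = norm (poly ?P ?s) * (u (sg * v) * (1 - u (sg * v)))"
        proof -
          have "?s * (1 - ?s) = of_real (u (sg * v) * (1 - u (sg * v)))" unfolding s by simp
          moreover have "0 \<le> u (sg * v) * (1 - u (sg * v))"
            using real_sigmoid(2,3)[OF lam, of "sg * v"] unfolding u_def by (intro mult_nonneg_nonneg) auto
          ultimately show ?thesis by (simp only: norm_mult norm_of_real abs_of_nonneg)
        qed
        also have "\<dots> \<le> C * (u (sg * v) * (1 - u (sg * v)))"
          using real_sigmoid(2,3)[OF lam, of "sg * v"] unfolding u_def 
          by (intro mult_right_mono[OF C(2)] mult_nonneg_nonneg) auto
        finally show ?thesis .
      qed
      ultimately have "norm (exp (- a * of_real (phase lam (sg * v)))) 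
        * norm (poly (ibp_poly (Suc N)) (sigmoid lam (of_real (sg * v)))) \<le> 1 * (C * (u (sg * v) * (1 - u (sg * v))))"
        by (intro mult_mono) auto
      then show "norm (exp (- a * of_real (phase lam (sg * v))) 
        * poly (ibp_poly (Suc N)) (sigmoid lam (of_real (sg * v)))) \<le> C * (u (sg * v) * (1 - u (sg * v)))"
        by (simp add: norm_mult)
    qed
    moreover have "\<dots> \<le> C * 1"
      using ui(2) C(1) by (simp only: integral_mult_right) (intro mult_left_mono)
    moreover have "norm (of_real sg * ?I) = norm ?I" using sg by (auto simp: norm_mult)
    ultimately show ?thesis by (smt (verit, best) norm_triangle_ineq)
  qed
  then show ?thesis by blast
qed

section \<open>Lagrange inversion for the coefficients\<close>

lemma divided_difference_holomorphic:
  assumes "f holomorphic_on S" "open S" "c \<in> S"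
  shows "(\<lambda>z. if z = c then deriv f c else (f z - f c) / (z - c)) holomorphic_on S"
  using pole_lemma[OF assms(1), of c] assms by (simp add: interior_open)

text \<open>
  Both sides are residues at \<open>0\<close>: integrating \<open>1 / f ^ (n + 1)\<close> by parts \<open>n\<close> times around a small
  circle lowers the power of \<open>f\<close> while producing the weights \<open>ibp_poly\<close>.
\<close>
lemma b_neg_eq:
  assumes lam: "0 < lam"
  shows "b_neg n lam = (of_real lam + 1) ^ (2 * n + 1) * ibp_coeff lam n"
proof -
  let ?L = "of_real lam + 1 :: complex"
  have L0: "?L \<noteq> 0" using lam by (metis add_pos_pos less_irrefl of_real_1 of_real_add of_real_eq_0_iff zero_less_one)
  define f where "f = (\<lambda>t::complex. of_real lam * exp t + t - of_real lam)"
  define d where "d = (\<lambda>t. if t = 0 then ?L else f t / t)"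
  have f': "(f has_field_derivative (1 + of_real lam * exp t)) (at t)" for t
    unfolding f_def by (auto intro!: derivative_eq_intros)
  have fh: "f holomorphic_on UNIV" unfolding f_def by (intro holomorphic_intros)
  have f0: "f 0 = 0" by (simp add: f_def)
  have df: "deriv f 0 = ?L" using DERIV_imp_deriv[OF f'[of 0]] by (simp add: add.commute)
  have dh: "d holomorphic_on UNIV"
  proof -
    have "d = (\<lambda>z. if z = 0 then deriv f 0 else (f z - f 0) / (z - 0))"
      by (auto simp: d_def df f0)
    then show ?thesis using divided_difference_holomorphic[OF fh, of 0] by simp
  qed
  have "isCont d 0"
    using holomorphic_on_imp_continuous_on[OF dh] by (simp add: continuous_on_eq_continuous_at)
  then obtain r1 where r1: "r1 > 0" "\<And>t. dist 0 t < r1 \<Longrightarrow> d t \<noteq> 0"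
    using continuous_at_avoid[of 0 d 0] L0 by (auto simp: d_def)
  have "isCont (\<lambda>t. 1 + of_real lam * exp t :: complex) 0" by (intro continuous_intros)
  then obtain r2 where r2: "r2 > 0" "\<And>t. dist 0 t < r2 \<Longrightarrow> 1 + of_real lam * exp t \<noteq> (0::complex)"
    using continuous_at_avoid[of 0 "\<lambda>t. 1 + of_real lam * exp t :: complex" 0] L0 by (auto simp: add.commute)
  define r where "r = min r1 r2 / 2"
  define B where "B = ball (0::complex) (min r1 r2)"
  have r: "r > 0" using r1 r2 by (simp add: r_def)
  have cb: "cball 0 r \<subseteq> B" "ball 0 r \<subseteq> B" using r1 r2 by (auto simp: B_def r_def)
  have nz: "d t \<noteq> 0" "1 + of_real lam * exp t \<noteq> 0" if "t \<in> B" for t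
    using that r1 r2 by (auto simp: B_def)
  have fd: "f t = t * d t" for t by (simp add: d_def f0)
  let ?\<gamma> = "circlepath 0 r"
  have img: "path_image ?\<gamma> \<subseteq> B - {0}" using cb(1) r by (auto simp: path_image_circlepath_nonneg[of r])
  have fnz: "f t \<noteq> 0" if "t \<in> B - {0}" for t using nz(1)[of t] that by (auto simp: fd)
  have sh: "sigmoid lam holomorphic_on B"
    unfolding sigmoid_def using nz by (intro holomorphic_intros) auto
  have ph: "(\<lambda>t. poly p (g t)) holomorphic_on A" if "g holomorphic_on A" for p :: "complex poly" and g A
    by (rule holomorphic_on_compose_gen[OF that, unfolded o_def, of "poly p" UNIV]) (auto intro: holomorphic_intros)
  \<comment> \<open>The two extreme cases carry the two sides: \<open>I n 0\<close> has the
    high-order pole and yields \<open>b_neg\<close>, \<open>I 0 n\<close> has a simple pole and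
    yields \<open>ibp_coeff\<close>.\<close>
  define I where "I = (\<lambda>m k. contour_integral ?\<gamma> (\<lambda>t. poly (ibp_poly k) (sigmoid lam t) / f t ^ Suc m))"
  have ci: "(\<lambda>t. poly (ibp_poly k) (sigmoid lam t) / f t ^ Suc m) contour_integrable_on ?\<gamma>" for m k
  proof (rule contour_integrable_holomorphic_simple)
    show "(\<lambda>t. poly (ibp_poly k) (sigmoid lam t) / f t ^ Suc m) holomorphic_on (B - {0})"
      using fnz by (intro holomorphic_intros ph holomorphic_on_subset[OF sh] holomorphic_on_subset[OF fh]) auto
  qed (use img in \<open>auto simp: B_def\<close>)
  \<comment> \<open>The total derivative of (1 - u) p_k / f^(m+1) integrates to 0 around the circle,
    and (1 - u) f' = 1 removes the factor f' from the term where f is differentiated.\<close>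
  have step: "of_nat (Suc m) * I (Suc m) k = I m (Suc k)" for m k
  proof -
    define P where "P = [:1, -1:] * ibp_poly k"
    let ?F = "\<lambda>t. poly P (sigmoid lam t) / f t ^ Suc m"
    let ?F' = "\<lambda>t. poly (ibp_poly (Suc k)) (sigmoid lam t) / f t ^ Suc m 
                 - of_nat (Suc m) * (poly (ibp_poly k) (sigmoid lam t) / f t ^ Suc (Suc m))"
    have der: "(?F has_field_derivative ?F' t) (at t within B - {0})" if t: "t \<in> B - {0}" for t
    proof -
      have n2: "1 + of_real lam * exp t \<noteq> 0" using nz(2) t by auto
      have PQ: "poly P (sigmoid lam t) * (1 + of_real lam * exp t) = poly (ibp_poly k) (sigmoid lam t)"
        unfolding P_def by (rule poly_one_minus_sigmoid[OF n2])
      have "(?F has_field_derivative (poly (ibp_poly (Suc k)) (sigmoid lam t) * f t ^ Suc m - 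
          poly P (sigmoid lam t) * (of_nat (Suc m) * f t ^ m * (1 + of_real lam * exp t))) / (f t ^ Suc m * f t ^ Suc m)) (at t)"
        using DERIV_divide[OF ibp_poly_has_field_derivative[OF n2, where n = k, folded P_def] DERIV_power[OF f'[of t], of "Suc m"]] fnz[OF t]
        by (simp add: mult_ac)
      also have "(poly (ibp_poly (Suc k)) (sigmoid lam t) * f t ^ Suc m - 
          poly P (sigmoid lam t) * (of_nat (Suc m) * f t ^ m * (1 + of_real lam * exp t))) / (f t ^ Suc m * f t ^ Suc m) =
          (poly (ibp_poly (Suc k)) (sigmoid lam t) * f t ^ Suc m - 
          of_nat (Suc m) * f t ^ m * (poly P (sigmoid lam t) * (1 + of_real lam * exp t))) / (f t ^ Suc m * f t ^ Suc m)"
        by (simp only: ac_simps)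
      also have "\<dots> = ?F' t"
        unfolding PQ using fnz[OF t] by (simp add: divide_simps) (simp add: algebra_simps)
      finally show ?thesis by (rule has_field_derivative_at_within)
    qed
    have "(?F' has_contour_integral 0) ?\<gamma>"
      using contour_integral_primitive[OF der _ img] by simp
    moreover have "(?F' has_contour_integral (I m (Suc k) - of_nat (Suc m) * I (Suc m) k)) ?\<gamma>"
      unfolding I_def
      by (intro has_contour_integral_diff has_contour_integral_lmul has_contour_integral_integral ci)
    ultimately have "I m (Suc k) - of_nat (Suc m) * I (Suc m) k = 0"
      using has_contour_integral_unique by blast
    then show ?thesis by simp
  qed
  have ind: "fact m * I m k = I 0 (k + m)" for m k
  proof (induction m arbitrary: k)
    case (Suc m)
    have "fact (Suc m) * I (Suc m) k = fact m * (of_nat (Suc m) * I (Suc m) k)" by (simp add: algebra_simps)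
    also have "\<dots> = I 0 (Suc k + m)" unfolding step Suc ..
    finally show ?case by simp
  qed simp
  \<comment> \<open>As f = t d, the function 1 / f^(n+1) is d^-(n+1) divided by t^(n+1), so Cauchy's
    formula for the n-th derivative produces the derivative in \<open>b_neg\<close>.\<close>
  define D where "D = (deriv ^^ n) (\<lambda>t. (?L / d t) ^ Suc n) 0"
  have "((\<lambda>t. (?L / d t) ^ Suc n / (t - 0) ^ Suc n) has_contour_integral of_real (2 * pi) * \<i> / fact n * D) ?\<gamma>"
    unfolding D_def
  proof (rule Cauchy_has_contour_integral_higher_derivative_circlepath)
    have h: "(\<lambda>t. (?L / d t) ^ Suc n) holomorphic_on B"
      using nz(1) by (intro holomorphic_intros holomorphic_on_subset[OF dh]) auto
    show "continuous_on (cball 0 r) (\<lambda>t. (?L / d t) ^ Suc n)"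
      using holomorphic_on_imp_continuous_on[OF h] cb(1) continuous_on_subset by blast
    show "(\<lambda>t. (?L / d t) ^ Suc n) holomorphic_on ball 0 r" using h cb(2) holomorphic_on_subset by blast
  qed (use r in auto)
  then have "((\<lambda>t. inverse (?L ^ Suc n) * ((?L / d t) ^ Suc n / (t - 0) ^ Suc n)) has_contour_integral 
      inverse (?L ^ Suc n) * (of_real (2 * pi) * \<i> / fact n * D)) ?\<gamma>"
    by (rule has_contour_integral_lmul)
  moreover have "inverse (?L ^ Suc n) * ((?L / d t) ^ Suc n / (t - 0) ^ Suc n) = 
      poly (ibp_poly 0) (sigmoid lam t) / f t ^ Suc n" for t
    using L0 by (simp add: fd power_mult_distrib power_divide divide_simps)
  ultimately have "((\<lambda>t. poly (ibp_poly 0) (sigmoid lam t) / f t ^ Suc n) has_contour_integral 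
      inverse (?L ^ Suc n) * (of_real (2 * pi) * \<i> / fact n * D)) ?\<gamma>" by simp
  then have A: "I n 0 = inverse (?L ^ Suc n) * (of_real (2 * pi) * \<i> / fact n * D)"
    unfolding I_def by (rule contour_integral_unique)
  have "((\<lambda>t. (poly (ibp_poly n) (sigmoid lam t) / d t) / (t - 0)) has_contour_integral 
      2 * of_real pi * \<i> * (poly (ibp_poly n) (sigmoid lam 0) / d 0)) ?\<gamma>"
  proof (rule Cauchy_integral_circlepath)
    have h: "(\<lambda>t. poly (ibp_poly n) (sigmoid lam t) / d t) holomorphic_on B"
      using nz(1) by (intro holomorphic_intros ph sh holomorphic_on_subset[OF dh]) auto
    show "continuous_on (cball 0 r) (\<lambda>t. poly (ibp_poly n) (sigmoid lam t) / d t)"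
      using holomorphic_on_imp_continuous_on[OF h] cb(1) continuous_on_subset by blast
    show "(\<lambda>t. poly (ibp_poly n) (sigmoid lam t) / d t) holomorphic_on ball 0 r" 
      using h cb(2) holomorphic_on_subset by blast
  qed (use r in auto)
  moreover have "(poly (ibp_poly n) (sigmoid lam t) / d t) / (t - 0) = 
      poly (ibp_poly n) (sigmoid lam t) / f t ^ Suc 0" for t by (simp add: fd mult.commute)
  ultimately have "((\<lambda>t. poly (ibp_poly n) (sigmoid lam t) / f t ^ Suc 0) has_contour_integral 
      2 * of_real pi * \<i> * (poly (ibp_poly n) (sigmoid lam 0) / d 0)) ?\<gamma>" by (simp only:)
  then have "I 0 n = 2 * of_real pi * \<i> * (poly (ibp_poly n) (sigmoid lam 0) / d 0)"
    unfolding I_def by (rule contour_integral_unique)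
  also have "poly (ibp_poly n) (sigmoid lam 0) / d 0 = ibp_coeff lam n"
    using poly_one_minus_sigmoid[of lam 0 "ibp_poly n"] L0
    unfolding ibp_coeff_def d_def by (simp only: exp_zero mult_1_right add.commute if_True) (simp add: divide_simps)
  finally have "I 0 n = 2 * of_real pi * \<i> * ibp_coeff lam n" .
  with ind[of n 0] A have "2 * of_real pi * \<i> * ibp_coeff lam n = 2 * of_real pi * \<i> * (inverse (?L ^ Suc n) * D)"
    by (simp add: mult_ac)
  then have "ibp_coeff lam n = inverse (?L ^ Suc n) * D" by simp
  then have D: "D = ?L ^ Suc n * ibp_coeff lam n" by (metis L0 mult.assoc mult_1 power_not_zero right_inverse)
  have "(\<lambda>t. (if t = 0 then 1 else ?L * t / (of_real lam * exp t + t - of_real lam)) ^ (n + 1)) = (\<lambda>t. (?L / d t) ^ Suc n)"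
    using L0 by (auto simp: d_def f_def)
  then have "b_neg n lam = ?L ^ n * D" unfolding b_neg_def D_def by simp
  then show ?thesis unfolding D by (simp add: power_add mult_2 mult_2_right mult_ac)
qed

section \<open>Bounds for the gamma function\<close>

text \<open>t^x exp(-t/2) is largest at t = 2x; pulling out this maximum leaves the integral of
  exp(-t/2), which is 2. The loss of 2^x against Stirling's formula is affordable later because ln 2
  < 1.\<close>

lemma Gamma_plus1_le:
  fixes x :: real
  assumes x: "0 \<le> x"
  shows "Gamma (1 + x) \<le> 2 * exp (x * ln 2 + x * ln x - x)"
proof (cases "x = 0")
  case False
  with x have x: "0 < x" by (simp add: less_le)
  have I1: "((\<lambda>t. t powr x / exp t) has_integral Gamma (1 + x)) {0..}"
    using Gamma_integral_real[of "1 + x"] x by simp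
  have I2: "((\<lambda>t::real. exp (x * ln 2 + x * ln x - x) * exp (- (1/2) * t)) has_integral 
      exp (x * ln 2 + x * ln x - x) * (exp (- (1/2) * 0) / (1/2))) {0..}"
    by (intro has_integral_mult_right has_integral_exp_minus_to_infinity) simp
  have "Gamma (1 + x) \<le> exp (x * ln 2 + x * ln x - x) * (exp (- (1/2) * 0) / (1/2))"
  proof (rule has_integral_le[OF I1 I2])
    fix t :: real assume t: "t \<in> {0..}"
    show "t powr x / exp t \<le> exp (x * ln 2 + x * ln x - x) * exp (- (1/2) * t)"
    proof (cases "t = 0")
      case False
      with t have t: "t > 0" by simp
      have "ln (t / (2 * x)) \<le> t / (2 * x) - 1" using t x by (intro ln_le_minus_one) auto
      then have "x * ln (t / (2 * x)) \<le> x * (t / (2 * x) - 1)" using x by (intro mult_left_mono) auto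
      also have "\<dots> = t / 2 - x" using x by (simp add: field_simps)
      finally have "x * ln t - t \<le> x * ln 2 + x * ln x - x - t / 2"
        using t x by (simp add: ln_div ln_mult algebra_simps)
      then have "exp (x * ln t - t) \<le> exp (x * ln 2 + x * ln x - x - t / 2)" by simp
      moreover have "t powr x / exp t = exp (x * ln t - t)" using t by (simp add: powr_def exp_diff)
      ultimately show ?thesis by (simp flip: exp_add)
    qed simp
  qed
  then show ?thesis by simp
qed simp

text \<open>Only the part t >= x of Euler's integral is kept, where t^x >= x^x.\<close>

lemma Gamma_plus1_ge:
  fixes x :: real
  assumes x: "0 \<le> x"
  shows "exp (x * ln x - x) \<le> Gamma (1 + x)"
proof (cases "x = 0")
  case False
  with x have x: "0 < x" by (simp add: less_le)
  have I1: "((\<lambda>t. t powr x / exp t) has_integral Gamma (1 + x)) {0..}"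
    using Gamma_integral_real[of "1 + x"] x by simp
  have "((\<lambda>t::real. exp (x * ln x) * exp (- 1 * t)) has_integral exp (x * ln x) * (exp (- 1 * x) / 1)) {x..}"
    by (intro has_integral_mult_right has_integral_exp_minus_to_infinity) simp
  then have I2: "((\<lambda>t::real. if t \<in> {x..} then exp (x * ln x) * exp (- 1 * t) else 0) 
      has_integral exp (x * ln x) * (exp (- 1 * x) / 1)) {0..}"
    by (subst has_integral_restrict) (use x in auto)
  have "exp (x * ln x) * (exp (- 1 * x) / 1) \<le> Gamma (1 + x)"
  proof (rule has_integral_le[OF I2 I1])
    fix t :: real assume t: "t \<in> {0..}"
    show "(if t \<in> {x..} then exp (x * ln x) * exp (- 1 * t) else 0) \<le> t powr x / exp t"
    proof (cases "x \<le> t")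
      case True
      then have "x * ln x \<le> x * ln t" using x by (intro mult_left_mono) auto
      then have "exp (x * ln x) * exp (- t) \<le> exp (x * ln t) * exp (- t)" by simp
      then show ?thesis using True x by (simp add: powr_def exp_minus field_simps)
    qed simp
  qed
  then show ?thesis by (simp add: exp_diff exp_minus field_simps)
qed simp

lemma norm_Gamma_le:
  assumes "0 < Re w"
  shows "norm (Gamma w) \<le> Gamma (Re w)"
proof -
  have I1: "((\<lambda>t. of_real t powr (w - 1) / of_real (exp t)) has_integral Gamma w) {0..}"
    by (rule Gamma_integral_complex[OF assms])
  have I2: "((\<lambda>t. t powr (Re w - 1) / exp t) has_integral Gamma (Re w)) {0..}"
    by (rule Gamma_integral_real[OF assms])
  have "norm (integral {0..} (\<lambda>t. complex_of_real t powr (w - 1) / of_real (exp t))) \<le> 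
      integral {0..} (\<lambda>t. t powr (Re w - 1) / exp t)"
  proof (rule integral_norm_bound_integral)
    show "norm (complex_of_real t powr (w - 1) / of_real (exp t)) \<le> t powr (Re w - 1) / exp t"
      if "t \<in> {0..}" for t
      using that by (cases "t = 0") (auto simp: norm_divide norm_powr_real_powr)
  qed (use I1 I2 in \<open>auto simp: integrable_on_def\<close>)
  then show ?thesis using I1 I2 by (simp add: integral_unique)
qed

text \<open>Factor by factor: the ratio |c + i y| / c decreases as c > 0 grows, and every factor on
  the left has its real part larger by x.\<close>

lemma norm_pochhammer_ratio:
  assumes x: "0 \<le> x"
  shows "norm (pochhammer (Complex (1 + x) y) n) * pochhammer 1 n \<le> 
         pochhammer (1 + x) n * norm (pochhammer (Complex 1 y) n)"
proof (induction n)
  case (Suc n)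
  have "norm (Complex (1 + x) y + of_nat n) * (1 + real n) \<le> (1 + x + real n) * norm (Complex 1 y + of_nat n)"
  proof (rule power2_le_imp_le)
    have "(norm (Complex (1 + x) y + of_nat n) * (1 + real n))\<^sup>2 = 
        ((1 + x + real n)\<^sup>2 + y\<^sup>2) * (1 + real n)\<^sup>2"
      by (simp add: power_mult_distrib cmod_power2)
    also have "\<dots> \<le> (1 + x + real n)\<^sup>2 * ((1 + real n)\<^sup>2 + y\<^sup>2)"
    proof -
      have "(1 + real n)\<^sup>2 \<le> (1 + x + real n)\<^sup>2" using x by (intro power_mono) auto
      then have "y\<^sup>2 * (1 + real n)\<^sup>2 \<le> y\<^sup>2 * (1 + x + real n)\<^sup>2" by (intro mult_left_mono) auto
      then show ?thesis by (simp add: algebra_simps)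
    qed
    also have "\<dots> = ((1 + x + real n) * norm (Complex 1 y + of_nat n))\<^sup>2"
      by (simp add: power_mult_distrib cmod_power2)
    finally show "(norm (Complex (1 + x) y + of_nat n) * (1 + real n))\<^sup>2 \<le> 
       ((1 + x + real n) * norm (Complex 1 y + of_nat n))\<^sup>2" .
  qed (use x in auto)
  from mult_mono[OF Suc this] show ?case
    using x by (simp add: pochhammer_Suc norm_mult pochhammer_nonneg mult_ac)
qed simp

text \<open>Limit of the previous product inequality. It moves an estimate at real part 1 + x back
  to real part 1, where the reflection formula gives the exact modulus.\<close>

lemma norm_rGamma_ratio:
  assumes x: "0 \<le> x"
  shows "norm (rGamma (Complex (1 + x) y)) \<le> rGamma (1 + x) * norm (rGamma (Complex 1 y))"
proof -
  have "norm (rGamma (Complex (1 + x) y)) * rGamma 1 \<le> rGamma (1 + x) * norm (rGamma (Complex 1 y))"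
  proof (rule LIMSEQ_le)
    show "(\<lambda>n. norm (rGamma_series (Complex (1 + x) y) n) * rGamma_series 1 n)
        \<longlonglongrightarrow> norm (rGamma (Complex (1 + x) y)) * rGamma 1"
      by (intro tendsto_intros)
    show "(\<lambda>n. rGamma_series (1 + x) n * norm (rGamma_series (Complex 1 y) n))
        \<longlonglongrightarrow> rGamma (1 + x) * norm (rGamma (Complex 1 y))"
      by (intro tendsto_intros)
    have "norm (rGamma_series (Complex (1 + x) y) n) * rGamma_series 1 n \<le> 
        rGamma_series (1 + x) n * norm (rGamma_series (Complex 1 y) n)" for n
    proof -
      have "norm (exp (Complex u y * of_real (ln (of_nat n)))) = exp (u * ln (real n))" for u by simp
      then show ?thesis
        using norm_pochhammer_ratio[OF x, of y "n + 1"]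
        unfolding rGamma_series_def norm_divide norm_mult
        by (simp add: divide_right_mono mult_ac)
    qed
    then show "\<exists>N. \<forall>n\<ge>N. norm (rGamma_series (Complex (1 + x) y) n) * rGamma_series 1 n \<le> 
        rGamma_series (1 + x) n * norm (rGamma_series (Complex 1 y) n)" by blast
  qed
  then show ?thesis by simp
qed

lemma rGamma_reflection_shifted:
  "rGamma (1 + z) * rGamma (1 - z) * z = sin (of_real pi * z) / of_real pi" for z :: complex
proof -
  have "rGamma (1 + z) * rGamma (1 - z) * z = (z * rGamma (z + 1)) * rGamma (1 - z)"
    by (simp only: ac_simps)
  also have "\<dots> = sin (of_real pi * z) / of_real pi"
    unfolding rGamma_plus1 by (rule rGamma_reflection_complex)
  finally show ?thesis .
qed

lemma sinh_abs_squared: "(sinh \<bar>y\<bar>)\<^sup>2 = (exp (2 * y) + inverse (exp (2 * y)) - 2) / (4::real)"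
proof -
  define e where "e = exp y"
  have e: "e > 0" by (simp add: e_def)
  have "(sinh \<bar>y\<bar>)\<^sup>2 = (sinh y)\<^sup>2" by (simp add: abs_if)
  also have "\<dots> = ((e - inverse e) / 2)\<^sup>2" by (simp add: sinh_def e_def exp_minus)
  also have "\<dots> = (e\<^sup>2 + inverse (e\<^sup>2) - 2) / 4"
    using e by (simp add: power2_eq_square field_simps)
  finally show ?thesis unfolding e_def exp_double .
qed

lemma norm_sin_ge_sinh: "sinh \<bar>Im z\<bar> \<le> norm (sin z)"
proof (rule power2_le_imp_le)
  have "(sinh \<bar>Im z\<bar>)\<^sup>2 = (exp (2 * Im z) + inverse (exp (2 * Im z)) - 2) / 4"
    by (rule sinh_abs_squared)
  also have "\<dots> \<le> (norm (sin z))\<^sup>2"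
    unfolding norm_sin_squared using cos_le_one[of "2 * Re z"] by (intro divide_right_mono) auto
  finally show "(sinh \<bar>Im z\<bar>)\<^sup>2 \<le> (norm (sin z))\<^sup>2" .
qed auto

lemma norm_sin_imaginary: "norm (sin (Complex 0 y)) = sinh \<bar>y\<bar>"
proof (rule power2_eq_imp_eq)
  show "(norm (sin (Complex 0 y)))\<^sup>2 = (sinh \<bar>y\<bar>)\<^sup>2"
    unfolding norm_sin_squared sinh_abs_squared by simp
qed auto

text \<open>Reflection is used twice: at -a, with |sin(pi a)| >= sinh(pi |Im a|), and on the line of
  real part 1, where it evaluates the modulus R of the reciprocal gamma function. The hyperbolic
  sine cancels between the two, so no asymptotic estimate of it is needed.\<close>

lemma norm_Gamma_uminus_le:
  assumes x: "0 \<le> Re a" and y: "Im a \<noteq> 0"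
  shows "norm (Gamma (- a)) \<le> 1 / (\<bar>Im a\<bar> * Gamma (1 + Re a))"
proof -
  define Y where "Y = \<bar>Im a\<bar>"
  have Y: "Y > 0" using y by (simp add: Y_def)
  define S where "S = sinh (pi * Y)"
  have S: "S > 0" using Y by (simp add: S_def)
  have SY: "pi * Y \<le> S"
    unfolding S_def using Y real_le_x_sinh[of "pi * Y"] by (simp add: sinh_def exp_minus)
  define R where "R = norm (rGamma (Complex 1 (Im a)))"
  \<comment> \<open>The numbers 1 + i y and 1 - i y are conjugate, so the reflection formula at i y
    contains R squared.\<close>
  have R: "Y * R\<^sup>2 = S / pi"
  proof -
    have 1: "Complex 1 (Im a) = 1 + Complex 0 (Im a)" "cnj (Complex 1 (Im a)) = 1 - Complex 0 (Im a)"
      by (auto simp: complex_eq_iff)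
    have "norm (rGamma (1 - Complex 0 (Im a))) = R"
      unfolding R_def 1(2)[symmetric] by (metis complex_mod_cnj cnj_rGamma)
    moreover have "norm (rGamma (1 + Complex 0 (Im a))) = R" unfolding R_def 1(1) ..
    moreover have "norm (Complex 0 (Im a)) = Y" by (simp add: Y_def complex_norm)
    moreover have "norm (sin (of_real pi * Complex 0 (Im a))) = S"
    proof -
      have "of_real pi * Complex 0 (Im a) = Complex 0 (pi * Im a)" by (simp add: complex_eq_iff)
      then show ?thesis using norm_sin_imaginary[of "pi * Im a"] by (simp add: S_def Y_def abs_mult)
    qed
    ultimately show ?thesis
      using arg_cong[OF rGamma_reflection_shifted[of "Complex 0 (Im a)"], of norm]
      by (simp add: norm_mult norm_divide power2_eq_square mult_ac)
  qed
  have g: "Gamma (1 + Re a) > 0" using x by (intro Gamma_real_pos) simp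
  have "rGamma (- a) * rGamma (1 + a) = sin (of_real pi * (- a)) / of_real pi"
    using rGamma_reflection_complex[of "- a"] by simp
  then have *: "norm (rGamma (- a)) * norm (rGamma (1 + a)) = norm (sin (of_real pi * a)) / pi"
    by (metis (no_types, lifting) norm_mult norm_divide mult_minus_right sin_minus norm_minus_cancel norm_of_real abs_of_pos pi_gt_zero)
  have "S \<le> norm (sin (of_real pi * a))"
    using norm_sin_ge_sinh[of "of_real pi * a"] by (simp add: S_def Y_def abs_mult)
  with * have "S / pi \<le> norm (rGamma (- a)) * norm (rGamma (1 + a))" by (simp add: divide_right_mono)
  also have "\<dots> \<le> norm (rGamma (- a)) * (rGamma (1 + Re a) * R)"
  proof -
    have "1 + a = Complex (1 + Re a) (Im a)" by (simp add: complex_eq_iff)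
    then show ?thesis unfolding R_def using norm_rGamma_ratio[OF x, of "Im a"] by (intro mult_left_mono) auto
  qed
  finally have "Y * R\<^sup>2 \<le> norm (rGamma (- a)) * rGamma (1 + Re a) * R" unfolding R by simp
  moreover have Rpos: "R > 0"
  proof -
    have "R \<noteq> 0" using R S Y by auto
    then show ?thesis unfolding R_def by auto
  qed
  ultimately have 2: "Y * R \<le> norm (rGamma (- a)) * rGamma (1 + Re a)"
    by (simp add: power2_eq_square mult.assoc[symmetric])
  \<comment> \<open>This is sinh(pi Y) >= pi Y.\<close>
  have "1 \<le> R\<^sup>2"
  proof -
    have "pi * Y * 1 \<le> pi * Y * R\<^sup>2" using SY R by (simp add: field_simps)
    then show ?thesis using Y by simp
  qed
  then have "1 \<le> R" using Rpos power2_le_imp_le[of 1 R] by simp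
  then have "Y * 1 \<le> Y * R" using Y by (intro mult_left_mono) auto
  with 2 have 3: "Y * Gamma (1 + Re a) \<le> norm (rGamma (- a))"
  proof -
    have "Y * Gamma (1 + Re a) \<le> Y * R * Gamma (1 + Re a)"
      using g \<open>Y * 1 \<le> Y * R\<close> by (intro mult_right_mono) auto
    also have "\<dots> \<le> norm (rGamma (- a)) * rGamma (1 + Re a) * Gamma (1 + Re a)"
      using g 2 by (intro mult_right_mono) auto
    also have "\<dots> = norm (rGamma (- a))" using g by (simp add: rGamma_inverse_Gamma)
    finally show ?thesis .
  qed
  have "norm (Gamma (- a)) = 1 / norm (rGamma (- a))"
    by (simp add: Gamma_def norm_inverse divide_inverse)
  also have "\<dots> \<le> 1 / (Y * Gamma (1 + Re a))"
    using 3 less_le_trans[OF mult_pos_pos[OF Y g] 3] Y g by (intro divide_left_mono mult_pos_pos) auto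
  finally show ?thesis by (simp add: Y_def)
qed

section \<open>Exponential smallness of the jump close to the imaginary axis\<close>

lemma abs_Arg_ge_pi_half:
  assumes "Re a \<le> 0" "a \<noteq> 0"
  shows "pi / 2 \<le> \<bar>Arg a\<bar>"
proof (rule ccontr)
  assume "\<not> pi / 2 \<le> \<bar>Arg a\<bar>"
  then have "cos (Arg a) > 0" by (intro cos_gt_zero_pi) auto
  then show False using assms by (simp add: cos_Arg zero_less_divide_iff)
qed

lemma abs_Arg_ge_pi_quarter:
  assumes "\<bar>Re a\<bar> \<le> \<bar>Im a\<bar>" "a \<noteq> 0"
  shows "pi / 4 \<le> \<bar>Arg a\<bar>"
proof (rule ccontr)
  assume "\<not> pi / 4 \<le> \<bar>Arg a\<bar>"
  then have "cos (2 * Arg a) > 0" by (intro cos_gt_zero_pi) auto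
  moreover have "cos (2 * Arg a) = ((Re a)\<^sup>2 - (Im a)\<^sup>2) / (norm a)\<^sup>2"
    using assms(2) by (simp add: cos_double cos_Arg sin_Arg power_divide diff_divide_distrib)
  ultimately show False using assms abs_le_square_iff[of "Re a" "Im a"] 
    by (simp add: zero_less_divide_iff)
qed

lemma Im_mult_Arg: "Im a * Arg a = \<bar>Im a\<bar> * \<bar>Arg a\<bar>"
  using Arg_less_0[of a] Arg_neg_iff[of a] by (cases "0 \<le> Im a") (auto simp: abs_if)

lemma norm_power_factor:
  assumes lam: "0 < lam" and a: "a \<noteq> 0"
  shows "norm ((of_real lam * a) powr a * exp (of_real lam * a)) = 
    exp (Re a * (ln lam + ln (norm a)) - \<bar>Im a\<bar> * \<bar>Arg a\<bar> + lam * Re a)"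
proof -
  have "Ln (of_real lam * a) = of_real (ln lam) + Ln a" using Ln_times_of_real[OF lam a] lam by (simp add: Ln_of_real)
  moreover have "Re (Ln a) = ln (norm a)" "Im (Ln a) = Arg a" using a by (auto simp: Arg_eq_Im_Ln)
  ultimately have "norm ((of_real lam * a) powr a) = exp (Re a * (ln lam + ln (norm a)) - Im a * Arg a)"
    using lam a by (simp add: powr_def)
  then show ?thesis by (simp add: norm_mult Im_mult_Arg flip: exp_add)
qed

text \<open>The factor |a| turns Gamma(-a) into Gamma(1 - a), whose argument has real part at least
  1. The decay comes from |Im a| |Arg a| in the modulus of the power; the terms in p = -Re a are
  nonpositive except for the crude p ln 2.\<close>

lemma Gamma_jump_bound_left:
  assumes lam: "0 < lam" and L: "0 \<le> lam + ln lam + 1" 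
    and a: "Im a \<noteq> 0" "Re a \<le> 0" "- Re a \<le> \<bar>Im a\<bar>"
  shows "norm a * norm (Gamma_jump lam a) \<le> 2 * exp (- norm a / 10)"
proof -
  define p y where "p = - Re a" and "y = \<bar>Im a\<bar>"
  have py: "0 \<le> p" "p \<le> y" "0 < y" using a by (auto simp: p_def y_def)
  have a0: "a \<noteq> 0" using a by auto
  have pn: "p \<le> norm a" using abs_Re_le_cmod[of a] py by (simp add: p_def)
  have n2: "norm a \<le> 2 * y" using cmod_le[of a] py by (simp add: p_def y_def)
  have w0: "- a \<notin> \<int>\<^sub>\<le>\<^sub>0" "- a \<noteq> 0" using a by (auto elim!: nonpos_Ints_cases simp: complex_eq_iff)
  have "Gamma (- a + 1) = - a * Gamma (- a)" using Gamma_plus1[of "- a"] w0 by simp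
  then have "norm a * norm (Gamma (- a)) = norm (Gamma (1 + - a))" by (simp add: norm_mult add.commute)
  also have "\<dots> \<le> Gamma (Re (1 + - a))" by (rule norm_Gamma_le) (use py in \<open>simp add: p_def\<close>)
  also have "Re (1 + - a) = 1 + p" by (simp add: p_def)
  also have "Gamma (1 + p) \<le> 2 * exp (p * ln 2 + p * ln p - p)" by (rule Gamma_plus1_le[OF py(1)])
  finally have g: "norm a * norm (Gamma (- a)) \<le> 2 * exp (p * ln 2 + p * ln p - p)" .
  have "norm a * norm (Gamma_jump lam a) = 
      norm a * norm (Gamma (- a)) * exp (Re a * (ln lam + ln (norm a)) - \<bar>Im a\<bar> * \<bar>Arg a\<bar> + lam * Re a)"
    unfolding Gamma_jump_def mult.assoc norm_mult[of "Gamma (- a)"] norm_power_factor[OF lam a0] ..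
  also have "\<dots> \<le> 2 * exp (p * ln 2 + p * ln p - p) * 
      exp (Re a * (ln lam + ln (norm a)) - \<bar>Im a\<bar> * \<bar>Arg a\<bar> + lam * Re a)"
    by (intro mult_right_mono g) auto
  also have "\<dots> = 2 * exp (p * ln 2 + p * (ln p - ln (norm a)) - p * (lam + ln lam + 1) - y * \<bar>Arg a\<bar>)"
    unfolding mult.assoc exp_add[symmetric] by (simp add: p_def y_def algebra_simps)
  also have "\<dots> \<le> 2 * exp (- norm a / 10)"
  proof -
    have "p * (ln p - ln (norm a)) \<le> 0"
    proof (cases "p = 0")
      case False
      then have "0 < p" using py by simp
      then have "ln p \<le> ln (norm a)" using pn a0 by (subst ln_le_cancel_iff) auto
      then show ?thesis using py by (intro mult_nonneg_nonpos) auto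
    qed simp
    moreover have "0 \<le> p * (lam + ln lam + 1)" using py L by simp
    moreover have "p * ln 2 \<le> y * 1" using py ln_2_less_1 by (intro mult_mono) auto
    \<comment> \<open>The angle gains 3 y / 2 (pi > 3), the term p ln 2 costs at most y, and |a| <=
      2 y: the exponent is at most -y/2, hence at most -|a|/4.\<close>
    moreover have "y * (3 / 2) \<le> y * \<bar>Arg a\<bar>"
      using py abs_Arg_ge_pi_half[OF a(2) a0] pi_gt3 by (intro mult_left_mono) auto
    moreover have "p * ln 2 + A - B - C \<le> - norm a / 10" 
      if "A \<le> 0" "0 \<le> B" "p * ln 2 \<le> y * 1" "y * (3 / 2) \<le> C" for A B C
      using that n2 py by linarith
    ultimately have "p * ln 2 + p * (ln p - ln (norm a)) - p * (lam + ln lam + 1) - y * \<bar>Arg a\<bar> \<le> - norm a / 10"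
      by blast
    then show ?thesis by simp
  qed
  finally show ?thesis .
qed

text \<open>Here Gamma(-a) lies on the side of its poles, so \<open>norm_Gamma_uminus_le\<close>
  replaces Euler's integral. |Arg a| may now be as small as pi/4, so the constants are chosen with
  more care.\<close>

lemma Gamma_jump_bound_right:
  assumes lam: "0 < lam" and L: "lam + ln lam + 1 \<le> 0" 
    and a: "Im a \<noteq> 0" "0 \<le> Re a" "Re a \<le> \<bar>Im a\<bar>"
  shows "norm a * norm (Gamma_jump lam a) \<le> 2 * exp (- norm a / 10)"
proof -
  define x y where "x = Re a" and "y = \<bar>Im a\<bar>"
  have xy: "0 \<le> x" "x \<le> y" "0 < y" using a by (auto simp: x_def y_def)
  have a0: "a \<noteq> 0" using a by auto
  have n2: "norm a \<le> 2 * y" using cmod_le[of a] xy by (simp add: x_def y_def)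
  \<comment> \<open>The number 283/200 lies just above the square root of 2.\<close>
  have n3: "norm a \<le> 283 / 200 * y"
  proof (rule power2_le_imp_le)
    have "(norm a)\<^sup>2 = x\<^sup>2 + y\<^sup>2" by (simp add: cmod_power2 x_def y_def)
    also have "\<dots> \<le> 2 * y\<^sup>2" using power_mono[OF xy(2,1), of 2] by simp
    also have "\<dots> \<le> (283 / 200 * y)\<^sup>2" by (simp add: power_mult_distrib power2_eq_square)
    finally show "(norm a)\<^sup>2 \<le> (283 / 200 * y)\<^sup>2" .
  qed (use xy in auto)
  have G0: "Gamma (1 + x) > 0" using xy by (intro Gamma_real_pos) simp
  have "norm (Gamma (- a)) \<le> 1 / (y * Gamma (1 + x))"
    using norm_Gamma_uminus_le[OF a(2,1)] by (simp add: x_def y_def)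
  also have "\<dots> \<le> 1 / (y * exp (x * ln x - x))"
    using xy G0 Gamma_plus1_ge[OF xy(1)] by (intro divide_left_mono mult_left_mono) auto
  also have "\<dots> = 1 / y * exp (x - x * ln x)" by (simp add: exp_diff)
  finally have "norm a * norm (Gamma (- a)) \<le> norm a * (1 / y * exp (x - x * ln x))"
    by (intro mult_left_mono) auto
  also have "\<dots> \<le> 2 * y * (1 / y * exp (x - x * ln x))" using n2 xy by (intro mult_right_mono) auto
  also have "\<dots> = 2 * exp (x - x * ln x)" using xy by simp
  finally have g: "norm a * norm (Gamma (- a)) \<le> 2 * exp (x - x * ln x)" .
  have "norm a * norm (Gamma_jump lam a) = 
      norm a * norm (Gamma (- a)) * exp (Re a * (ln lam + ln (norm a)) - \<bar>Im a\<bar> * \<bar>Arg a\<bar> + lam * Re a)"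
    unfolding Gamma_jump_def mult.assoc norm_mult[of "Gamma (- a)"] norm_power_factor[OF lam a0] ..
  also have "\<dots> \<le> 2 * exp (x - x * ln x) * 
      exp (Re a * (ln lam + ln (norm a)) - \<bar>Im a\<bar> * \<bar>Arg a\<bar> + lam * Re a)"
    by (intro mult_right_mono g) auto
  also have "\<dots> = 2 * exp (x * (ln (norm a) - ln x) + x * (lam + ln lam + 1) - y * \<bar>Arg a\<bar>)"
    unfolding mult.assoc exp_add[symmetric] by (simp add: x_def y_def algebra_simps)
  also have "\<dots> \<le> 2 * exp (- norm a / 10)"
  proof -
    \<comment> \<open>The exact maximum over x is |a|/e, and 2/5 is a rational upper bound of
      1/e.\<close>
    have "x * (ln (norm a) - ln x) \<le> norm a * (2 / 5)"
    proof (cases "x = 0")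
      case False
      then have x: "x > 0" using xy by simp
      have e: "ln (5 / 2 :: real) \<le> 1"
      proof -
        have "5 / 2 \<le> exp (1::real)" using exp_lower_Taylor_quadratic[of 1] by simp
        then show ?thesis by (metis exp_ge_zero ln_exp ln_mono divide_pos_pos zero_less_numeral)
      qed
      have "ln (norm a / x * (2 / 5)) \<le> norm a / x * (2 / 5) - 1" using x a0 by (intro ln_le_minus_one) auto
      moreover have "ln (norm a / x * (2 / 5)) = ln (norm a) - ln x - ln (5 / 2)"
        using x a0 by (simp add: ln_mult ln_div)
      ultimately have "ln (norm a) - ln x \<le> norm a / x * (2 / 5)" using e by linarith
      then have "x * (ln (norm a) - ln x) \<le> x * (norm a / x * (2 / 5))" using x by (intro mult_left_mono) auto
      then show ?thesis using x by simp
    qed simp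
    moreover have "x * (lam + ln lam + 1) \<le> 0" using xy L by (intro mult_nonneg_nonpos) auto
    moreover have "y * (157 / 200) \<le> y * \<bar>Arg a\<bar>"
    proof -
      have "(157 / 200 :: real) \<le> pi / 4" using pi_approx by simp
      also have "\<dots> \<le> \<bar>Arg a\<bar>" using a a0 by (intro abs_Arg_ge_pi_quarter) auto
      finally show ?thesis using xy by (intro mult_left_mono) auto
    qed
    \<comment> \<open>The exponent is at most (2/5 - 157/283) |a|, which is below -|a|/10. This
      margin is narrower than that of the left case.\<close>
    moreover have "A + B - C \<le> - norm a / 10" if "A \<le> norm a * (2 / 5)" "B \<le> 0" "y * (157 / 200) \<le> C" for A B C
      using that n3 xy by linarith
    ultimately have "x * (ln (norm a) - ln x) + x * (lam + ln lam + 1) - y * \<bar>Arg a\<bar> \<le> - norm a / 10"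
      by blast
    then show ?thesis by simp
  qed
  finally show ?thesis .
qed

lemma exp_decay_power_bound: "\<exists>C. \<forall>r::real\<ge>0. r ^ n * exp (- r / 10) \<le> C"
proof -
  have "((\<lambda>r::real. r ^ n * exp (- r / 10)) \<longlongrightarrow> 0) at_top" by real_asymp
  then have "\<forall>\<^sub>F r in at_top. r ^ n * exp (- r / 10) < (1::real)" by (rule order_tendstoD) simp
  then obtain R where R: "\<And>r. r \<ge> R \<Longrightarrow> r ^ n * exp (- r / 10) < (1::real)"
    by (auto simp: eventually_at_top_linorder)
  have "r ^ n * exp (- r / 10) \<le> max 1 (R ^ n)" if r: "r \<ge> 0" for r
  proof (cases "r \<ge> R")
    case False
    then have "r ^ n * exp (- r / 10) \<le> R ^ n * 1" using r by (intro mult_mono power_mono) auto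
    then show ?thesis by simp
  qed (use R[of r] in simp)
  then show ?thesis by blast
qed

section \<open>The two branches and their remainders\<close>

text \<open>This is F1. The Laplace integral covers the negative axis, on which F and J have their
  cut; F - J continues it across the imaginary axis. The two formulas agree for Re a < 0 off the
  real axis, so the case split creates no discontinuity there.\<close>

definition lower_branch :: "real \<Rightarrow> complex \<Rightarrow> complex" where
  "lower_branch lam a = 
     (if Re a < 0 then laplace_branch lam (- 1) a else normalized_Gamma lam a - Gamma_jump lam a)"

definition ibp_sum :: "real \<Rightarrow> nat \<Rightarrow> complex \<Rightarrow> complex" where
  "ibp_sum lam N a = (\<Sum>n<N. ibp_coeff lam n / a ^ Suc n)"

lemma normalized_Gamma_minus_lower_branch:
  assumes "0 < lam" "Im a \<noteq> 0"
  shows "normalized_Gamma lam a - lower_branch lam a = Gamma_jump lam a"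
  using normalized_Gamma_minus_jump[OF assms(1), of a] assms(2)
  by (auto simp: lower_branch_def algebra_simps)

lemma lower_branch_holomorphic:
  assumes lam: "0 < lam"
  shows "lower_branch lam holomorphic_on {a. Re a < 0 \<or> Im a \<noteq> 0}"
proof -
  have 1: "lower_branch lam holomorphic_on {a. - 1 * Re a > 0}"
    by (rule holomorphic_transform[OF laplace_branch_holomorphic[OF lam, of "- 1"]]) 
       (auto simp: lower_branch_def)
  have 2: "lower_branch lam holomorphic_on {a. Im a \<noteq> 0}"
  proof (rule holomorphic_transform)
    show "(\<lambda>a. normalized_Gamma lam a - Gamma_jump lam a) holomorphic_on {a. Im a \<noteq> 0}"
      by (intro holomorphic_intros Gamma_jump_holomorphic[OF lam]
          holomorphic_on_subset[OF normalized_Gamma_holomorphic[OF lam]])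
         (auto simp: complex_nonpos_Reals_iff)
    show "normalized_Gamma lam a - Gamma_jump lam a = lower_branch lam a" if "a \<in> {a. Im a \<noteq> 0}" for a
      using normalized_Gamma_minus_lower_branch[OF lam, of a] that by (auto simp: algebra_simps)
  qed
  have "open {a::complex. - 1 * Re a > 0}" "open {a::complex. Im a \<noteq> 0}"
    by (intro open_Collect_less open_Collect_neq continuous_intros)+
  from holomorphic_on_Un[OF 1 2 this] have "lower_branch lam holomorphic_on {a. - 1 * Re a > 0} \<union> {a. Im a \<noteq> 0}" .
  also have "{a. - 1 * Re a > 0} \<union> {a. Im a \<noteq> 0} = {a. Re a < 0 \<or> Im a \<noteq> 0}" by auto
  finally show ?thesis .
qed

lemma ibp_sum_holomorphic: "ibp_sum lam N holomorphic_on - {0}"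
  unfolding ibp_sum_def by (intro holomorphic_intros) auto

lemma laplace_remainder_bounded:
  assumes "0 < lam" "sg = 1 \<or> sg = - 1"
  shows "\<exists>C. \<forall>a. sg * Re a > 0 \<longrightarrow> norm (a ^ Suc N * (laplace_branch lam sg a - ibp_sum lam N a)) \<le> C"
  using laplace_branch_remainder_bounded[OF assms] unfolding ibp_sum_def .

text \<open>On the open half-plane F is its Laplace integral. The same constant serves on the
  imaginary axis without 0, by continuity of F along a + 1/(n+1).\<close>

lemma normalized_Gamma_remainder_bounded_right:
  assumes lam: "0 < lam"
  shows "\<exists>C. \<forall>a. 0 \<le> Re a \<and> a \<noteq> 0 \<longrightarrow> norm (a ^ Suc N * (normalized_Gamma lam a - ibp_sum lam N a)) \<le> C"
proof -
  obtain C where C: "\<And>a. 1 * Re a > 0 \<Longrightarrow> norm (a ^ Suc N * (laplace_branch lam 1 a - ibp_sum lam N a)) \<le> C"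
    using laplace_remainder_bounded[OF lam, of 1 N] by blast
  let ?E = "\<lambda>a. a ^ Suc N * (normalized_Gamma lam a - ibp_sum lam N a)"
  have pos: "norm (?E a) \<le> C" if "Re a > 0" for a
    using C[of a] that normalized_Gamma_eq_laplace[OF lam that] by simp
  have "norm (?E a) \<le> C" if a: "0 \<le> Re a" "a \<noteq> 0" for a
  proof (cases "Re a > 0")
    case False
    with a have "Im a \<noteq> 0" by (auto simp: complex_eq_iff)
    then have an: "a \<in> - \<real>\<^sub>\<le>\<^sub>0" by (auto simp: complex_nonpos_Reals_iff)
    have "?E holomorphic_on - \<real>\<^sub>\<le>\<^sub>0"
      by (intro holomorphic_intros normalized_Gamma_holomorphic[OF lam] holomorphic_on_subset[OF ibp_sum_holomorphic]) auto
    then have "isCont ?E a"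
      using holomorphic_on_imp_continuous_on continuous_on_eq_continuous_at[OF slit_plane_open] an by blast
    moreover have "(\<lambda>n. a + of_real (inverse (real (Suc n)))) \<longlonglongrightarrow> a + of_real 0"
      by (intro tendsto_intros LIMSEQ_inverse_real_of_nat)
    ultimately have "(\<lambda>n. ?E (a + of_real (inverse (real (Suc n))))) \<longlonglongrightarrow> ?E a"
      by (intro isCont_tendsto_compose[where g = ?E]) auto
    then have "(\<lambda>n. norm (?E (a + of_real (inverse (real (Suc n)))))) \<longlonglongrightarrow> norm (?E a)"
      by (rule tendsto_norm)
    then show ?thesis
    proof (rule LIMSEQ_le_const2)
      have "Re (a + of_real (inverse (real (Suc n)))) > 0" for n
        using a by (simp add: add_nonneg_pos del: of_nat_Suc)
      then show "\<exists>n0. \<forall>n\<ge>n0. norm (?E (a + of_real (inverse (real (Suc n))))) \<le> C"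
        using pos by blast
    qed
  qed (use pos in simp)
  then show ?thesis by blast
qed

lemma Gamma_jump_power_bounded:
  assumes lam: "0 < lam"
  shows "\<exists>C. \<forall>a. Im a \<noteq> 0 \<and> 
     (0 \<le> lam + ln lam + 1 \<and> Re a \<le> 0 \<and> - Re a \<le> \<bar>Im a\<bar> \<or>
      lam + ln lam + 1 \<le> 0 \<and> 0 \<le> Re a \<and> Re a \<le> \<bar>Im a\<bar>) \<longrightarrow>
     norm (a ^ Suc N * Gamma_jump lam a) \<le> C"
proof -
  obtain C where C: "\<And>r::real. r \<ge> 0 \<Longrightarrow> r ^ N * exp (- r / 10) \<le> C"
    using exp_decay_power_bound by blast
  have "norm (a ^ Suc N * Gamma_jump lam a) \<le> 2 * C"
    if "norm a * norm (Gamma_jump lam a) \<le> 2 * exp (- norm a / 10)" for a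
  proof -
    have "norm (a ^ Suc N * Gamma_jump lam a) = norm a ^ N * (norm a * norm (Gamma_jump lam a))"
      by (simp add: norm_mult norm_power)
    also have "\<dots> \<le> norm a ^ N * (2 * exp (- norm a / 10))" using that by (intro mult_left_mono) auto
    also have "\<dots> \<le> 2 * C" using C[of "norm a"] by simp
    finally show ?thesis .
  qed
  then show ?thesis
    using Gamma_jump_bound_left[OF lam] Gamma_jump_bound_right[OF lam] by blast
qed

text \<open>Beyond the imaginary axis F = F1 + J: the remainder of F1 is bounded by its own Laplace
  integral, and J is exponentially small when L >= 0. With omega >= pi/4 the region described
  contains the closed sector |arg a| <= pi - omega.\<close>

lemma normalized_Gamma_remainder_bounded:
  assumes lam: "0 < lam"
  shows "\<exists>C. \<forall>a. 0 < Re a \<or> (0 \<le> lam + ln lam + 1 \<and> Re a \<le> 0 \<and> Im a \<noteq> 0 \<and> - Re a \<le> \<bar>Im a\<bar>) \<longrightarrow>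
     norm (a ^ Suc N * (normalized_Gamma lam a - ibp_sum lam N a)) \<le> C"
proof -
  obtain C1 where C1: "\<And>a. 0 \<le> Re a \<and> a \<noteq> 0 \<Longrightarrow> norm (a ^ Suc N * (normalized_Gamma lam a - ibp_sum lam N a)) \<le> C1"
    using normalized_Gamma_remainder_bounded_right[OF lam] by metis
  obtain C2 where C2: "\<And>a. - 1 * Re a > 0 \<Longrightarrow> norm (a ^ Suc N * (laplace_branch lam (- 1) a - ibp_sum lam N a)) \<le> C2"
    using laplace_remainder_bounded[OF lam, of "- 1" N] by blast
  obtain C3 where C3: "\<And>a. Im a \<noteq> 0 \<and> 
     (0 \<le> lam + ln lam + 1 \<and> Re a \<le> 0 \<and> - Re a \<le> \<bar>Im a\<bar> \<or>
      lam + ln lam + 1 \<le> 0 \<and> 0 \<le> Re a \<and> Re a \<le> \<bar>Im a\<bar>) \<Longrightarrow> norm (a ^ Suc N * Gamma_jump lam a) \<le> C3"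
    using Gamma_jump_power_bounded[OF lam, of N] by metis
  have "norm (a ^ Suc N * (normalized_Gamma lam a - ibp_sum lam N a)) \<le> max C1 (C2 + C3)"
    if "0 < Re a \<or> (0 \<le> lam + ln lam + 1 \<and> Re a \<le> 0 \<and> Im a \<noteq> 0 \<and> - Re a \<le> \<bar>Im a\<bar>)" for a
  proof (cases "0 \<le> Re a")
    case True
    then have "a \<noteq> 0" using that by auto
    then show ?thesis using C1[of a] True by simp
  next
    case False
    then have a: "0 \<le> lam + ln lam + 1" "Re a < 0" "Im a \<noteq> 0" "- Re a \<le> \<bar>Im a\<bar>" using that by auto
    have "a ^ Suc N * (normalized_Gamma lam a - ibp_sum lam N a) = 
        a ^ Suc N * (laplace_branch lam (- 1) a - ibp_sum lam N a) + a ^ Suc N * Gamma_jump lam a"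
      using normalized_Gamma_minus_jump[OF lam a(2,3)] by (simp add: algebra_simps)
    then have "norm (a ^ Suc N * (normalized_Gamma lam a - ibp_sum lam N a)) \<le> 
        norm (a ^ Suc N * (laplace_branch lam (- 1) a - ibp_sum lam N a)) + norm (a ^ Suc N * Gamma_jump lam a)"
      by (metis norm_triangle_ineq)
    also have "\<dots> \<le> C2 + C3" using a by (intro add_mono C2 C3) auto
    finally show ?thesis by simp
  qed
  then show ?thesis by blast
qed

text \<open>The mirror case: for Re a >= 0 the branch is F - J, with F bounded up to the imaginary
  axis and J exponentially small when L <= 0.\<close>

lemma lower_branch_remainder_bounded:
  assumes lam: "0 < lam"
  shows "\<exists>C. \<forall>a. Re a < 0 \<or> (lam + ln lam + 1 \<le> 0 \<and> 0 \<le> Re a \<and> Im a \<noteq> 0 \<and> Re a \<le> \<bar>Im a\<bar>) \<longrightarrow>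
     norm (a ^ Suc N * (lower_branch lam a - ibp_sum lam N a)) \<le> C"
proof -
  obtain C1 where C1: "\<And>a. 0 \<le> Re a \<and> a \<noteq> 0 \<Longrightarrow> norm (a ^ Suc N * (normalized_Gamma lam a - ibp_sum lam N a)) \<le> C1"
    using normalized_Gamma_remainder_bounded_right[OF lam] by metis
  obtain C2 where C2: "\<And>a. - 1 * Re a > 0 \<Longrightarrow> norm (a ^ Suc N * (laplace_branch lam (- 1) a - ibp_sum lam N a)) \<le> C2"
    using laplace_remainder_bounded[OF lam, of "- 1" N] by blast
  obtain C3 where C3: "\<And>a. Im a \<noteq> 0 \<and> 
     (0 \<le> lam + ln lam + 1 \<and> Re a \<le> 0 \<and> - Re a \<le> \<bar>Im a\<bar> \<or>
      lam + ln lam + 1 \<le> 0 \<and> 0 \<le> Re a \<and> Re a \<le> \<bar>Im a\<bar>) \<Longrightarrow> norm (a ^ Suc N * Gamma_jump lam a) \<le> C3"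
    using Gamma_jump_power_bounded[OF lam, of N] by metis
  have "norm (a ^ Suc N * (lower_branch lam a - ibp_sum lam N a)) \<le> max C2 (C1 + C3)"
    if "Re a < 0 \<or> (lam + ln lam + 1 \<le> 0 \<and> 0 \<le> Re a \<and> Im a \<noteq> 0 \<and> Re a \<le> \<bar>Im a\<bar>)" for a
  proof (cases "Re a < 0")
    case True
    then show ?thesis using C2[of a] by (simp add: lower_branch_def)
  next
    case False
    then have a: "lam + ln lam + 1 \<le> 0" "0 \<le> Re a" "Im a \<noteq> 0" "Re a \<le> \<bar>Im a\<bar>" using that by auto
    then have a0: "a \<noteq> 0" by auto
    have "a ^ Suc N * (lower_branch lam a - ibp_sum lam N a) = 
        a ^ Suc N * (normalized_Gamma lam a - ibp_sum lam N a) - a ^ Suc N * Gamma_jump lam a"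
      using False by (simp add: lower_branch_def algebra_simps)
    then have "norm (a ^ Suc N * (lower_branch lam a - ibp_sum lam N a)) \<le> 
        norm (a ^ Suc N * (normalized_Gamma lam a - ibp_sum lam N a)) + norm (a ^ Suc N * Gamma_jump lam a)"
      by (metis norm_triangle_ineq4)
    also have "\<dots> \<le> C1 + C3" using a a0 by (intro add_mono C1 C3) auto
    finally show ?thesis by simp
  qed
  then show ?thesis by blast
qed

section \<open>A dispersion relation in logarithmic coordinates\<close>

lemma contour_integral_linepath_same_Im:
  fixes f :: "complex \<Rightarrow> complex"
  assumes "a < b"
  shows "contour_integral (linepath (Complex a c) (Complex b c)) f = integral {a..b} (\<lambda>x. f (Complex x c))"
proof -
  let ?z = "Complex a c" and ?z' = "Complex b c"
  have "contour_integral (linepath ?z ?z') f = (?z' - ?z) * integral {0..1} (\<lambda>x. f (linepath ?z ?z' x))"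
    by (simp add: contour_integral_integral)
  also have "?z' - ?z = of_real (b - a)"
    by (simp add: complex_eq_iff)
  also have "integral {0..1} (\<lambda>x. f (linepath ?z ?z' x)) = integral {0..1} (\<lambda>x. f (Complex (linepath a b x) c))"
    by (simp add: linepath_def Complex_eq scaleR_conv_of_real algebra_simps)
  also have "\<dots> = integral {0..(b - a) / (b - a)} (\<lambda>x. f (Complex (a + (b - a) * x) c))"
    using \<open>a < b\<close> by (simp add: algebra_simps linepath_def)
  also have "{0..(b - a) / (b - a)} = (\<lambda>x. x / (b - a)) ` {0..b - a}"
    using \<open>a < b\<close> by simp
  also have "integral \<dots> (\<lambda>x. f (Complex (a + (b - a) * x) c)) =
             integral {a-a..b-a} (\<lambda>x. f (Complex (x + a) c)) / of_real (b - a)"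
    using \<open>a < b\<close> by (subst integral_stretch_real) (auto simp: scaleR_conv_of_real add_ac)
  also have "\<dots> = integral {a..b} (\<lambda>x. f (Complex x c)) / of_real (b - a)"
    by (subst integral_shift_real_ivl) (rule refl)
  finally show ?thesis
    using \<open>a < b\<close> by (simp add: complex_eq_iff)
qed

text \<open>The horizontal edges become real integrals, which later match the rays; the vertical
  edges stay contour integrals because they are only estimated.\<close>

lemma contour_integral_rectpath:
  fixes f :: "complex \<Rightarrow> complex"
  assumes f: "continuous_on (path_image (rectpath (Complex (- R) c) (Complex R d))) f" and "0 < R"
  shows "contour_integral (rectpath (Complex (- R) c) (Complex R d)) f =
    integral {- R..R} (\<lambda>x. f (Complex x c)) - integral {- R..R} (\<lambda>x. f (Complex x d))
    + (contour_integral (linepath (Complex R c) (Complex R d)) f 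
       - contour_integral (linepath (Complex (- R) c) (Complex (- R) d)) f)"
proof -
  have cs: "continuous_on (closed_segment (Complex (- R) c) (Complex R c)) f" 
    "continuous_on (closed_segment (Complex R c) (Complex R d)) f" 
    "continuous_on (closed_segment (Complex R d) (Complex (- R) d)) f" 
    "continuous_on (closed_segment (Complex (- R) d) (Complex (- R) c)) f"
    by (rule continuous_on_subset[OF f], simp add: rectpath_def Let_def path_image_join; blast)+
  note ci = contour_integrable_continuous_linepath[OF cs(1)] contour_integrable_continuous_linepath[OF cs(2)]
    contour_integrable_continuous_linepath[OF cs(3)] contour_integrable_continuous_linepath[OF cs(4)]
  note r1 = contour_integral_reverse_linepath[OF cs(3)]
  note r2 = contour_integral_reverse_linepath[OF cs(4)]
  have h: "contour_integral (linepath (Complex (- R) e) (Complex R e)) f = integral {- R..R} (\<lambda>x. f (Complex x e))" for e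
    using assms(2) by (intro contour_integral_linepath_same_Im) auto
  have "contour_integral (rectpath (Complex (- R) c) (Complex R d)) f = 
     contour_integral (linepath (Complex (- R) c) (Complex R c)) f + 
     (contour_integral (linepath (Complex R c) (Complex R d)) f + 
     (contour_integral (linepath (Complex R d) (Complex (- R) d)) f +
      contour_integral (linepath (Complex (- R) d) (Complex (- R) c)) f))"
    unfolding rectpath_def Let_def by (simp add: ci contour_integrable_joinI)
  then show ?thesis unfolding r1 r2 h by simp
qed

lemma exp_Complex_slit_plane:
  assumes "\<bar>\<phi>\<bar> < pi"
  shows "exp (Complex x \<phi>) \<notin> \<real>\<^sub>\<le>\<^sub>0"
proof
  assume "exp (Complex x \<phi>) \<in> \<real>\<^sub>\<le>\<^sub>0"
  then have *: "sin \<phi> = 0" "cos \<phi> \<le> 0" by (auto simp: complex_nonpos_Reals_iff Re_exp Im_exp mult_le_0_iff)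
  then have "\<phi> = 0" using assms sin_eq_0_pi[of \<phi>] by auto
  then show False using * by simp
qed

lemma exp_Complex_slit_plane_left:
  assumes "0 < \<phi>" "\<phi> < 2 * pi"
  shows "Re (exp (Complex x \<phi>)) < 0 \<or> Im (exp (Complex x \<phi>)) \<noteq> 0"
proof (cases "sin \<phi> = 0")
  case True
  then have "sin (\<phi> - pi) = 0" by simp
  then have "\<phi> - pi = 0" using assms sin_eq_0_pi[of "\<phi> - pi"] by linarith
  then have "\<phi> = pi" by simp
  then have "cos \<phi> = - 1" by simp
  then show ?thesis by (simp add: Re_exp)
qed (simp add: Im_exp)

text \<open>The logarithms of a have imaginary parts Arg a + 2 pi n, and all of these miss the open
  interval. Hence the kernel has no pole in the strip used for \<open>Q\<close>.\<close>

lemma exp_Complex_ne: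
  assumes "a \<noteq> 0" "\<bar>Arg a\<bar> < \<phi>" "\<phi> < 2 * pi - \<bar>Arg a\<bar>"
  shows "exp (Complex x \<phi>) \<noteq> a"
proof
  assume "exp (Complex x \<phi>) = a"
  then have "exp (Complex x \<phi>) = exp (Ln a)" using assms(1) by simp
  from iffD1[OF exp_eq this] obtain n :: int where "Complex x \<phi> = Ln a + (of_int (2 * n) * pi) * \<i>" ..
  then have "Im (Complex x \<phi>) = Im (Ln a + (of_int (2 * n) * pi) * \<i>)" by (rule arg_cong)
  then have eq: "\<phi> = Arg a + 2 * pi * of_int n" using Arg_eq_Im_Ln[OF assms(1)] by (simp add: mult_ac)
  consider "n \<le> - 1" | "n = 0" | "n \<ge> 1" by linarith
  then show False
  proof cases
    case 1
    then have "2 * pi * of_int n \<le> 2 * pi * (- 1)" by (intro mult_left_mono) auto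
    then show False using eq assms by linarith
  next
    case 3
    then have "2 * pi * 1 \<le> 2 * pi * of_int n" by (intro mult_left_mono) auto
    then show False using eq assms by linarith
  qed (use eq assms in auto)
qed

text \<open>
  In the coordinate \<open>z = ln s\<close> the sectors become strips, which are convex, and truncated sectors
  become rectangles; the edge at height \<open>2 * pi - \<beta>\<close> is the one at \<open>- \<beta>\<close> by periodicity.
\<close>
lemma dispersion_bound:
  fixes P Q :: "complex \<Rightarrow> complex"
  assumes beta: "0 < \<beta>" "\<beta> < pi" and a: "a \<noteq> 0" "\<bar>Arg a\<bar> < \<beta>"
    and P: "P holomorphic_on - \<real>\<^sub>\<le>\<^sub>0" and Q: "Q holomorphic_on {s. Re s < 0 \<or> Im s \<noteq> 0}"
    and bP: "\<And>x \<phi>. \<bar>\<phi>\<bar> \<le> \<beta> \<Longrightarrow> norm (P (exp (Complex x \<phi>))) \<le> M * min 1 (exp (- x))"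
    and bQ: "\<And>x \<phi>. \<beta> \<le> \<phi> \<Longrightarrow> \<phi> \<le> 2 * pi - \<beta> \<Longrightarrow> norm (Q (exp (Complex x \<phi>))) \<le> M * min 1 (exp (- x))"
  defines "D \<equiv> \<lambda>z. (P (exp z) - Q (exp z)) * (exp z / (exp z - a))"
  shows "\<exists>M' R0. \<forall>R\<ge>R0. 2 * pi * norm (P a) \<le> norm (integral {- R..R} (\<lambda>x. D (Complex x (- \<beta>))))
     + norm (integral {- R..R} (\<lambda>x. D (Complex x \<beta>))) + M' * exp (- R)"
proof -
  define kP where "kP = (\<lambda>z. P (exp z) * (exp z / (exp z - a)))"
  define kQ where "kQ = (\<lambda>z. Q (exp z) * (exp z / (exp z - a)))"
  have M0: "0 \<le> M" using order_trans[OF norm_ge_zero bP[of 0 0]] beta by simp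
  \<comment> \<open>Because e >= 2, this choice gives exp R >= 2 |a| and exp(-R) <= |a|/2, so both
    vertical edges stay away from the pole. There the kernel is at most 2 on the right and at most 2
    exp(-R)/|a| on the left; \<open>M1\<close> covers both cases.\<close>
  define R0 where "R0 = \<bar>ln (norm a)\<bar> + 1"
  define M1 where "M1 = 2 * M * (1 + 1 / norm a)"
  have e2: "2 \<le> exp (1::real)" using exp_ge_add_one_self[of 1] by simp
  have big: "2 * norm a \<le> exp R" and small: "exp (- R) \<le> norm a / 2" if R: "R \<ge> R0" for R
  proof -
    have "2 * norm a \<le> exp 1 * exp (ln (norm a))" using a(1) e2 by simp
    also have "\<dots> = exp (1 + ln (norm a))" by (simp add: exp_add)
    also have "\<dots> \<le> exp R" using R by (simp add: R0_def)
    finally show "2 * norm a \<le> exp R" .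
    have "2 * exp (- R) \<le> exp 1 * exp (- R)" using e2 by simp
    also have "\<dots> = exp (1 - R)" by (simp add: exp_diff exp_minus divide_inverse)
    also have "\<dots> \<le> exp (ln (norm a))" using R unfolding R0_def exp_le_cancel_iff by linarith
    also have "\<dots> = norm a" using a(1) by simp
    finally show "exp (- R) \<le> norm a / 2" by simp
  qed
  have kern: "norm (w * (exp (Complex x \<phi>) / (exp (Complex x \<phi>) - a))) \<le> M1 * exp (- R)"
    if R: "R \<ge> R0" "x = R \<or> x = - R" and w: "norm w \<le> M * min 1 (exp (- x))" for R x \<phi> w
  proof -
    let ?s = "exp (Complex x \<phi>)"
    have ns: "norm ?s = exp x" by simp
    from R(2) show ?thesis
    proof
      assume x: "x = R"
      have "exp R / 2 \<le> norm ?s - norm a" using big[OF R(1)] ns x by simp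
      also have "\<dots> \<le> norm (?s - a)" by (rule norm_triangle_ineq2)
      finally have d: "exp R / 2 \<le> norm (?s - a)" .
      have "norm ?s / norm (?s - a) \<le> norm ?s / (exp R / 2)"
        by (intro divide_left_mono mult_pos_pos d less_le_trans[OF _ d]) auto
      then have "norm (?s / (?s - a)) \<le> 2" using x by (simp add: norm_divide)
      moreover have "norm w \<le> M * exp (- R)" 
        using order_trans[OF w mult_left_mono[OF min.cobounded2 M0]] x by simp
      ultimately have "norm w * norm (?s / (?s - a)) \<le> (M * exp (- R)) * 2"
        using M0 by (intro mult_mono) auto
      also have "\<dots> \<le> M1 * exp (- R)" using M0 by (simp add: M1_def algebra_simps)
      finally show ?thesis unfolding norm_mult .
    next
      assume x: "x = - R"
      have "norm a / 2 \<le> norm a - norm ?s" using small[OF R(1)] ns x by simp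
      also have "\<dots> \<le> norm (?s - a)" by (metis norm_minus_commute norm_triangle_ineq2)
      finally have d: "norm a / 2 \<le> norm (?s - a)" .
      have "norm ?s / norm (?s - a) \<le> norm ?s / (norm a / 2)"
        using a(1) by (intro divide_left_mono mult_pos_pos d less_le_trans[OF _ d]) auto
      then have "norm (?s / (?s - a)) \<le> exp (- R) / (norm a / 2)" using x by (simp add: norm_divide)
      moreover have "norm w \<le> M" 
        using order_trans[OF w mult_left_mono[OF min.cobounded1 M0]] by simp
      ultimately have "norm w * norm (?s / (?s - a)) \<le> M * (exp (- R) / (norm a / 2))"
        using M0 by (intro mult_mono) auto
      also have "\<dots> \<le> M1 * exp (- R)" using M0 by (simp add: M1_def algebra_simps)
      finally show ?thesis unfolding norm_mult .
    qed
  qed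
  have M1: "0 \<le> M1" using M0 by (simp add: M1_def)
  have vert: "norm (contour_integral (linepath (Complex x c) (Complex x d)) (\<lambda>z. f (exp z) * (exp z / (exp z - a)))) 
      \<le> M1 * exp (- R) * (2 * pi)"
    if R: "R \<ge> R0" "x = R \<or> x = - R" and cd: "c < d" "d - c \<le> 2 * pi"
      and fb: "\<And>\<phi>. c \<le> \<phi> \<Longrightarrow> \<phi> \<le> d \<Longrightarrow> norm (f (exp (Complex x \<phi>))) \<le> M * min 1 (exp (- x))"
      and ci: "(\<lambda>z. f (exp z) * (exp z / (exp z - a))) contour_integrable_on linepath (Complex x c) (Complex x d)"
    for R x c d f
  proof -
    have "norm (contour_integral (linepath (Complex x c) (Complex x d)) (\<lambda>z. f (exp z) * (exp z / (exp z - a)))) 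
      \<le> M1 * exp (- R) * norm (Complex x d - Complex x c)"
    proof (rule contour_integral_bound_linepath[OF ci])
      fix z assume "z \<in> closed_segment (Complex x c) (Complex x d)"
      then have z: "Re z = x" "c \<le> Im z" "Im z \<le> d"
        using cd by (auto simp: closed_segment_same_Re closed_segment_eq_real_ivl)
      then have zz: "z = Complex x (Im z)" by (simp add: complex_eq_iff)
      show "norm (f (exp z) * (exp z / (exp z - a))) \<le> M1 * exp (- R)"
        using kern[OF R fb[OF z(2,3)], of "Im z"] zz by simp
    qed (use M1 in auto)
    also have "Complex x d - Complex x c = \<i> * of_real (d - c)" by (simp add: complex_eq_iff)
    also have "norm (\<i> * of_real (d - c)) = d - c" using cd by (simp only: norm_mult norm_of_real) simp
    also have "M1 * exp (- R) * (d - c) \<le> M1 * exp (- R) * (2 * pi)"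
      using M1 cd by (intro mult_left_mono) auto
    finally show ?thesis .
  qed
  \<comment> \<open>The first strip is the image of the slit plane under the principal logarithm.
    The second keeps strictly away from the heights of all logarithms of a, which makes
    \<open>kQ\<close> holomorphic on all of it.\<close>
  let ?S1 = "{z. - pi < Im z} \<inter> {z. Im z < pi}"
  let ?S2 = "{z. \<bar>Arg a\<bar> < Im z} \<inter> {z. Im z < 2 * pi - \<bar>Arg a\<bar>}"
  have conv: "convex ?S1" "convex ?S2"
    by (intro convex_Int convex_halfspace_Im_gt convex_halfspace_Im_lt)+
  have op: "open ?S1" by (intro open_Int open_Collect_less continuous_intros)
  have ePS: "exp z \<in> - \<real>\<^sub>\<le>\<^sub>0" if "z \<in> ?S1" for z
    using exp_Complex_slit_plane[of "Im z" "Re z"] that by (auto simp: abs_less_iff)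
  have Pexp: "(\<lambda>z. P (exp z)) holomorphic_on ?S1"
    by (rule holomorphic_on_compose_gen[OF holomorphic_on_exp P, unfolded o_def]) (use ePS in auto)
  have eQS: "exp z \<in> {s. Re s < 0 \<or> Im s \<noteq> 0}" if "z \<in> ?S2" for z
  proof -
    have "0 < Im z" "Im z < 2 * pi" using that abs_ge_zero[of "Arg a"] by (auto simp del: abs_ge_zero)
    then show ?thesis using exp_Complex_slit_plane_left[of "Im z" "Re z"] by simp
  qed
  have Qexp: "(\<lambda>z. Q (exp z)) holomorphic_on ?S2"
    by (rule holomorphic_on_compose_gen[OF holomorphic_on_exp Q, unfolded o_def]) (use eQS in auto)
  have kQh: "kQ holomorphic_on ?S2"
  proof -
    have "exp z - a \<noteq> 0" if "z \<in> ?S2" for z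
      using exp_Complex_ne[OF a(1), of "Im z" "Re z"] that by auto
    then show ?thesis unfolding kQ_def by (intro holomorphic_intros Qexp) auto
  qed
  define z0 where "z0 = Ln a"
  have ez0: "exp z0 = a" using a(1) by (simp add: z0_def)
  have Iz0: "Im z0 = Arg a" using a(1) by (simp add: z0_def Arg_eq_Im_Ln)
  have z0S: "z0 \<in> ?S1" using a(2) beta Iz0 by auto
  have uniq: "z = z0" if "z \<in> ?S1" "exp z = a" for z
    using that Ln_exp[of z] by (auto simp: z0_def)
  \<comment> \<open>The divided difference of exp at z0 = Ln a has no zero on the strip, so the
    kernel exp z / (exp z - a) becomes a Cauchy kernel 1 / (z - z0) times a holomorphic function
    whose value at z0 gives P a.\<close>
  define g where "g = (\<lambda>z. if z = z0 then deriv exp z0 else (exp z - exp z0) / (z - z0))"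
  have gh: "g holomorphic_on ?S1"
    unfolding g_def by (rule divided_difference_holomorphic[OF holomorphic_on_exp op z0S])
  have g0: "g z0 = a" using DERIV_imp_deriv[OF DERIV_exp[of z0]] by (simp add: g_def ez0)
  have gnz: "g z \<noteq> 0" if "z \<in> ?S1" for z
  proof (cases "z = z0")
    case False
    then have "exp z - exp z0 \<noteq> 0" using uniq[OF that] ez0 by auto
    then show ?thesis using False by (simp add: g_def)
  qed (use g0 a(1) in simp)
  define h where "h = (\<lambda>z. P (exp z) * exp z / g z)"
  have hh: "h holomorphic_on ?S1" unfolding h_def using gnz by (intro holomorphic_intros Pexp gh) auto
  have h0: "h z0 = P a" using a(1) by (simp add: h_def ez0 g0)
  have hk: "h z / (z - z0) = kP z" if "z \<in> ?S1" "z \<noteq> z0" for z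
    using that(2) by (simp add: h_def kP_def g_def ez0)
  have kPh: "kP holomorphic_on ?S1 - {z0}"
  proof -
    have "exp z - a \<noteq> 0" if "z \<in> ?S1 - {z0}" for z using uniq[of z] that by auto
    then show ?thesis unfolding kP_def by (intro holomorphic_intros holomorphic_on_subset[OF Pexp]) auto
  qed
  \<comment> \<open>The error constant counts four vertical edges, each of length at most 2
    pi.\<close>
  have main: "2 * pi * norm (P a) \<le> norm (integral {- R..R} (\<lambda>x. D (Complex x (- \<beta>))))
     + norm (integral {- R..R} (\<lambda>x. D (Complex x \<beta>))) + (8 * pi * M1) * exp (- R)" if R: "R \<ge> R0" for R
  proof -
    have Rpos: "0 < R" using R by (simp add: R0_def)
    let ?p1 = "rectpath (Complex (- R) (- \<beta>)) (Complex R \<beta>)"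
    let ?p2 = "rectpath (Complex (- R) \<beta>) (Complex R (2 * pi - \<beta>))"
    let ?I = "\<lambda>c f. integral {- R..R} (\<lambda>x. f (Complex x c) :: complex)"
    let ?V = "\<lambda>x c d f. contour_integral (linepath (Complex x c) (Complex x d)) f"
    have Rz0: "\<bar>Re z0\<bar> < R" using R a(1) by (simp add: z0_def R0_def)
    have z0box: "z0 \<in> box (Complex (- R) (- \<beta>)) (Complex R \<beta>)"
      using Rz0 Iz0 a(2) by (auto simp: in_box_complex_iff)
    have im1: "path_image ?p1 \<subseteq> ?S1 - {z0}"
    proof -
      have "path_image ?p1 \<subseteq> cbox (Complex (- R) (- \<beta>)) (Complex R \<beta>)"
        using Rpos beta by (intro path_image_rectpath_subset_cbox) auto
      moreover have "path_image ?p1 \<inter> box (Complex (- R) (- \<beta>)) (Complex R \<beta>) = {}"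
        using Rpos beta by (intro path_image_rectpath_inter_box) auto
      ultimately show ?thesis using z0box beta by (auto simp: in_cbox_complex_iff)
    qed
    have im2: "path_image ?p2 \<subseteq> ?S2"
    proof -
      have "path_image ?p2 \<subseteq> cbox (Complex (- R) \<beta>) (Complex R (2 * pi - \<beta>))"
        using Rpos beta by (intro path_image_rectpath_subset_cbox) auto
      then show ?thesis using a(2) by (auto simp: in_cbox_complex_iff)
    qed
    have "((\<lambda>w. h w / (w - z0)) has_contour_integral (2 * pi * \<i> * winding_number ?p1 z0 * h z0)) ?p1"
    proof (rule Cauchy_integral_formula_convex_simple[OF conv(1) hh])
      show "z0 \<in> interior ?S1" using z0S interior_open[OF op] by simp
    qed (use im1 in simp_all)
    then have "((\<lambda>w. h w / (w - z0)) has_contour_integral (2 * pi * \<i> * P a)) ?p1"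
      using winding_number_rectpath[OF z0box] by (simp add: h0)
    then have "(kP has_contour_integral (2 * pi * \<i> * P a)) ?p1"
      by (rule has_contour_integral_eq) (use hk im1 in auto)
    then have 1: "2 * pi * \<i> * P a = ?I (- \<beta>) kP - ?I \<beta> kP + (?V R (- \<beta>) \<beta> kP - ?V (- R) (- \<beta>) \<beta> kP)"
      using contour_integral_rectpath[OF continuous_on_subset[OF holomorphic_on_imp_continuous_on[OF kPh] im1] Rpos]
      by (simp add: contour_integral_unique)
    have "(kQ has_contour_integral 0) ?p2"
      by (rule Cauchy_theorem_convex_simple[OF kQh conv(2)]) (use im2 in auto)
    then have 2: "0 = ?I \<beta> kQ - ?I (2 * pi - \<beta>) kQ + (?V R \<beta> (2 * pi - \<beta>) kQ - ?V (- R) \<beta> (2 * pi - \<beta>) kQ)"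
      using contour_integral_rectpath[OF continuous_on_subset[OF holomorphic_on_imp_continuous_on[OF kQh] im2] Rpos]
      by (simp add: contour_integral_unique)
    have lineP: "(\<lambda>x. kP (Complex x c)) integrable_on {- R..R}" if "\<bar>c\<bar> = \<beta>" for c
      using that a(2) Iz0 beta
      by (intro integrable_continuous_interval continuous_on_compose2[OF holomorphic_on_imp_continuous_on[OF kPh]])
         (auto intro!: continuous_intros simp: Complex_eq)
    have lineQ: "(\<lambda>x. kQ (Complex x c)) integrable_on {- R..R}" if "c = \<beta> \<or> c = 2 * pi - \<beta>" for c
      using that a(2) beta
      by (intro integrable_continuous_interval continuous_on_compose2[OF holomorphic_on_imp_continuous_on[OF kQh]])
         (auto intro!: continuous_intros simp: Complex_eq)
    \<comment> \<open>Hence the upper edge of the second rectangle pairs with the lower edge of the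
      first one, and on both rays only the difference of \<open>P\<close> and \<open>Q\<close>
      survives.\<close>
    have per: "kQ (Complex x (2 * pi - \<beta>)) = kQ (Complex x (- \<beta>))" for x
    proof -
      have "exp (Complex x (2 * pi - \<beta>)) = exp (Complex x (- \<beta>))"
        by (simp add: complex_eq_iff Re_exp Im_exp cos_diff sin_diff)
      then show ?thesis by (simp add: kQ_def)
    qed
    have Dk: "D z = kP z - kQ z" for z unfolding D_def kP_def kQ_def by (rule left_diff_distrib)
    have "?I (- \<beta>) D = ?I (- \<beta>) kP - ?I (2 * pi - \<beta>) kQ"
      unfolding Dk using integral_diff[OF lineP[of "- \<beta>"] lineQ[of "2 * pi - \<beta>"]] beta by (simp add: per)
    moreover have "?I \<beta> D = ?I \<beta> kP - ?I \<beta> kQ"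
      unfolding Dk using beta by (intro integral_diff lineP lineQ) auto
    \<comment> \<open>Linear bookkeeping: the sum of the two rectangle identities, with the
      horizontal edges grouped by ray.\<close>
    moreover have "A = D1 - D2 + (V1 - V2) + (W1 - W2)" 
      if "A = K1 - K2 + (V1 - V2)" "0 = Q1 - Q2 + (W1 - W2)" "D1 = K1 - Q2" "D2 = K2 - Q1"
      for A D1 D2 K1 K2 Q1 Q2 V1 V2 W1 W2 :: complex
      using that by algebra
    ultimately have "2 * pi * \<i> * P a = ?I (- \<beta>) D - ?I \<beta> D + (?V R (- \<beta>) \<beta> kP - ?V (- R) (- \<beta>) \<beta> kP)
        + (?V R \<beta> (2 * pi - \<beta>) kQ - ?V (- R) \<beta> (2 * pi - \<beta>) kQ)"
      using 1 2 by blast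
    then have "norm (2 * pi * \<i> * P a) \<le> norm (?I (- \<beta>) D) + norm (?I \<beta> D) + 
       (norm (?V R (- \<beta>) \<beta> kP) + norm (?V (- R) (- \<beta>) \<beta> kP)) +
       (norm (?V R \<beta> (2 * pi - \<beta>) kQ) + norm (?V (- R) \<beta> (2 * pi - \<beta>) kQ))"
      by (smt (verit) norm_triangle_ineq norm_triangle_ineq4)
    moreover have "norm (?V x (- \<beta>) \<beta> kP) \<le> M1 * exp (- R) * (2 * pi)" if "x = R \<or> x = - R" for x
      unfolding kP_def
    proof (rule vert[OF R that])
      show "(\<lambda>z. P (exp z) * (exp z / (exp z - a))) contour_integrable_on linepath (Complex x (- \<beta>)) (Complex x \<beta>)"
        unfolding kP_def[symmetric]
        using that Rz0 beta
        by (intro contour_integrable_continuous_linepath continuous_on_subset[OF holomorphic_on_imp_continuous_on[OF kPh]])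
           (auto simp: closed_segment_same_Re closed_segment_eq_real_ivl)
    qed (use beta bP in auto)
    moreover have "norm (?V x \<beta> (2 * pi - \<beta>) kQ) \<le> M1 * exp (- R) * (2 * pi)" if "x = R \<or> x = - R" for x
      unfolding kQ_def
    proof (rule vert[OF R that])
      show "(\<lambda>z. Q (exp z) * (exp z / (exp z - a))) contour_integrable_on linepath (Complex x \<beta>) (Complex x (2 * pi - \<beta>))"
        unfolding kQ_def[symmetric]
        using beta a(2)
        by (intro contour_integrable_continuous_linepath continuous_on_subset[OF holomorphic_on_imp_continuous_on[OF kQh]])
           (auto simp: closed_segment_same_Re closed_segment_eq_real_ivl)
    qed (use beta bQ in auto)
    ultimately have "norm (2 * pi * \<i> * P a) \<le> norm (?I (- \<beta>) D) + norm (?I \<beta> D) + 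
       (M1 * exp (- R) * (2 * pi) + M1 * exp (- R) * (2 * pi)) + (M1 * exp (- R) * (2 * pi) + M1 * exp (- R) * (2 * pi))"
      by (smt (verit))
    then show ?thesis by (simp add: norm_mult algebra_simps)
  qed
  then show ?thesis by blast
qed

section \<open>The angle of the base point\<close>

text \<open>A positive product forces a positive solution, and w exp w is strictly increasing there,
  which settles uniqueness. Existence follows from the intermediate value theorem on [0, x], since x
  exp x >= x.\<close>

lemma lambert_W_eq:
  assumes "0 < x"
  shows "0 < lambert_W x" "lambert_W x * exp (lambert_W x) = x"
proof -
  let ?f = "\<lambda>w::real. w * exp w"
  have mono: "?f u < ?f v" if "0 \<le> u" "u < v" for u v
    using that by (intro mult_strict_mono) auto
  have "\<exists>w. 0 \<le> w \<and> w \<le> x \<and> ?f w = x"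
  proof (rule IVT')
    show "?f 0 \<le> x" "(0::real) \<le> x" using assms by auto
    have "x * 1 \<le> x * exp x" using assms by (intro mult_left_mono) auto
    then show "x \<le> ?f x" by simp
  qed (intro continuous_intros)
  then obtain w where w: "0 \<le> w" "?f w = x" by blast
  have pos: "0 < v" if "?f v = x" for v using that assms by (metis exp_gt_zero zero_less_mult_pos2)
  have "lambert_W x = w" unfolding lambert_W_def
  proof (rule the_equality)
    show "- 1 \<le> w \<and> w * exp w = x" using w by simp
    fix v assume "- 1 \<le> v \<and> v * exp v = x"
    then have v: "?f v = x" by simp
    show "v = w"
      using mono[of v w] mono[of w v] pos[OF v] v w by (cases v w rule: linorder_cases) auto
  qed
  then show "0 < lambert_W x" "lambert_W x * exp (lambert_W x) = x" using w pos by auto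
qed

text \<open>The logarithm of the equation W exp W = exp(c - 1). It turns the bounds on lam into |L|
  <= pi, as lam + ln lam is increasing.\<close>

lemma lambert_W_log:
  "lambert_W (exp (c - 1)) + ln (lambert_W (exp (c - 1))) + 1 = c"
proof -
  note W = lambert_W_eq[of "exp (c - 1)", OF exp_gt_zero]
  have "ln (lambert_W (exp (c - 1)) * exp (lambert_W (exp (c - 1)))) = c - 1" unfolding W(2) by simp
  then show ?thesis using W(1) by (simp add: ln_mult)
qed

lemma log_bounds_from_lambert_W:
  assumes lam: "0 < lam"
    and "lambert_W (exp (- pi - 1)) \<le> lam" and "lam \<le> lambert_W (exp (pi - 1))"
  shows "- pi \<le> lam + ln lam + 1" "lam + ln lam + 1 \<le> pi"
proof -
  have W: "0 < lambert_W (exp (c - 1))" for c using lambert_W_eq(1)[OF exp_gt_zero] .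
  have "ln (lambert_W (exp (- pi - 1))) \<le> ln lam" using assms W[of "- pi"] by simp
  then show "- pi \<le> lam + ln lam + 1" using lambert_W_log[of "- pi"] assms by linarith
  have "ln lam \<le> ln (lambert_W (exp (pi - 1)))" using assms W[of pi] by simp
  then show "lam + ln lam + 1 \<le> pi" using lambert_W_log[of pi] assms by linarith
qed

lemma omega_polar:
  assumes lam: "0 < lam"
  shows "0 < omega lam" "omega lam < pi" 
    "norm (base_point lam) * cos (omega lam) = lam + ln lam + 1" 
    "norm (base_point lam) * sin (omega lam) = pi" "0 < norm (base_point lam)"
proof -
  have Im: "Im (base_point lam) = pi" "Re (base_point lam) = lam + ln lam + 1" by (auto simp: base_point_def)
  then have nz: "base_point lam \<noteq> 0" by auto
  show "0 < omega lam" "omega lam < pi" using Arg_lt_pi[of "base_point lam"] Im unfolding omega_def by auto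
  show "norm (base_point lam) * cos (omega lam) = lam + ln lam + 1" 
    "norm (base_point lam) * sin (omega lam) = pi" "0 < norm (base_point lam)"
    using nz Im by (auto simp: omega_def cos_Arg sin_Arg)
qed

text \<open>The base point has imaginary part pi and real part between -pi and pi, so its angle is
  within pi/4 of the vertical.\<close>

lemma omega_range:
  assumes "0 < lam" "- pi \<le> lam + ln lam + 1" "lam + ln lam + 1 \<le> pi"
  shows "pi / 4 \<le> omega lam" "omega lam \<le> 3 * pi / 4"
proof -
  note o = omega_polar[OF assms(1)]
  show "pi / 4 \<le> omega lam"
  proof (rule ccontr)
    assume "\<not> pi / 4 \<le> omega lam"
    then have "sin (pi / 4 - omega lam) > 0" using o by (intro sin_gt_zero) auto
    then have "norm (base_point lam) * (cos (omega lam) - sin (omega lam)) > 0" 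
      using o(5) by (simp add: sin_diff sin_45 cos_45)
    then show False using o assms by (simp add: right_diff_distrib)
  qed
  show "omega lam \<le> 3 * pi / 4"
  proof (rule ccontr)
    assume "\<not> omega lam \<le> 3 * pi / 4"
    then have "cos (pi - (omega lam - pi / 4)) > 0" using o by (intro cos_gt_zero_pi) auto
    then have "cos (omega lam - pi / 4) < 0" unfolding cos_pi_minus by simp
    then have "(cos (omega lam) + sin (omega lam)) * (sqrt 2 / 2) < 0"
      by (simp add: cos_diff sin_45 cos_45 algebra_simps)
    then have "- cos (omega lam) - sin (omega lam) > 0" by (simp add: mult_less_0_iff)
    then have "norm (base_point lam) * (- cos (omega lam) - sin (omega lam)) > 0" using o(5) by simp
    then show False using o assms by (simp add: right_diff_distrib)
  qed
qed

lemma omega_sign: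
  assumes "0 < lam" 
  shows "omega lam \<le> pi / 2 \<Longrightarrow> 0 \<le> lam + ln lam + 1" "pi / 2 \<le> omega lam \<Longrightarrow> lam + ln lam + 1 \<le> 0"
proof -
  note o = omega_polar[OF assms(1)]
  show "0 \<le> lam + ln lam + 1" if "omega lam \<le> pi / 2"
  proof -
    have "0 \<le> cos (omega lam)" using that o by (intro cos_ge_zero) auto
    then show ?thesis using o(3,5) by (metis mult_nonneg_nonneg less_imp_le)
  qed
  show "lam + ln lam + 1 \<le> 0" if "pi / 2 \<le> omega lam"
  proof -
    have "0 \<le> cos (pi - omega lam)" using that o by (intro cos_ge_zero) auto
    then have "cos (omega lam) \<le> 0" by simp
    then show ?thesis using o(3,5) by (metis mult_nonneg_nonpos less_imp_le)
  qed
qed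

section \<open>The kernel and the jump on the Stokes rays\<close>

text \<open>The squared norm is r^2 + t^2 + 2 r t cos(theta - omega). Dropping the terms in t gives
  the first bound; completing the square in t, that is, projecting onto the line of the ray, gives
  the second.\<close>

lemma csc_kernel_bounds:
  assumes r: "0 < r" and t: "0 < (t::real)"
  shows "0 \<le> cos (\<theta> - \<omega>) \<Longrightarrow> r \<le> norm (of_real r * cis \<theta> + of_real t * cis \<omega>)"
    and "r * \<bar>sin (\<theta> - \<omega>)\<bar> \<le> norm (of_real r * cis \<theta> + of_real t * cis \<omega>)"
proof -
  let ?w = "of_real r * cis \<theta> + of_real t * cis \<omega>"
  have "(norm ?w)\<^sup>2 = (r * cos \<theta> + t * cos \<omega>)\<^sup>2 + (r * sin \<theta> + t * sin \<omega>)\<^sup>2"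
    by (simp add: cmod_power2)
  also have "\<dots> = r\<^sup>2 * ((cos \<theta>)\<^sup>2 + (sin \<theta>)\<^sup>2) + t\<^sup>2 * ((cos \<omega>)\<^sup>2 + (sin \<omega>)\<^sup>2) 
      + 2 * r * t * (cos \<theta> * cos \<omega> + sin \<theta> * sin \<omega>)"
    by algebra
  also have "\<dots> = r\<^sup>2 + t\<^sup>2 + 2 * r * t * cos (\<theta> - \<omega>)"
    by (simp add: cos_diff)
  finally have n: "(norm ?w)\<^sup>2 = r\<^sup>2 + t\<^sup>2 + 2 * r * t * cos (\<theta> - \<omega>)" .
  show "r \<le> norm ?w" if "0 \<le> cos (\<theta> - \<omega>)"
    by (rule power2_le_imp_le) (use n that r t in auto)
  have "(r * \<bar>sin (\<theta> - \<omega>)\<bar>)\<^sup>2 + (t + r * cos (\<theta> - \<omega>))\<^sup>2 = (norm ?w)\<^sup>2"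
  proof -
    have "(r * \<bar>sin (\<theta> - \<omega>)\<bar>)\<^sup>2 = r\<^sup>2 * (sin (\<theta> - \<omega>))\<^sup>2" by (simp add: power_mult_distrib)
    then show ?thesis unfolding n using sin_cos_squared_add[of "\<theta> - \<omega>"] by algebra
  qed
  then have "(r * \<bar>sin (\<theta> - \<omega>)\<bar>)\<^sup>2 \<le> (norm ?w)\<^sup>2" by (metis le_add_same_cancel1 zero_le_power2)
  then show "r * \<bar>sin (\<theta> - \<omega>)\<bar> \<le> norm ?w" by (rule power2_le_imp_le) simp
qed

lemma C1_kernel_bound:
  assumes om: "pi / 4 \<le> \<omega>" "\<omega> < pi" and th: "\<bar>\<theta>\<bar> < - \<omega> + pi" and r: "0 < r" and t: "0 < t"
  shows "r \<le> C1 \<omega> \<theta> * norm (of_real r * cis \<theta> + of_real t * cis \<omega>)" "0 < C1 \<omega> \<theta>"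
proof -
  have "r \<le> C1 \<omega> \<theta> * norm (of_real r * cis \<theta> + of_real t * cis \<omega>) \<and> 0 < C1 \<omega> \<theta>"
  proof (cases "\<theta> < \<omega> - pi / 2")
    case True
    then have "sin (\<omega> - \<theta>) > 0" using om th by (intro sin_gt_zero) auto
    then have s: "sin (\<theta> - \<omega>) < 0" using sin_minus[of "\<omega> - \<theta>"] by simp
    have "C1 \<omega> \<theta> = 1 / \<bar>sin (\<theta> - \<omega>)\<bar>" using True th by (auto simp: C1_def csc_def)
    then have C: "0 < C1 \<omega> \<theta>" "C1 \<omega> \<theta> * \<bar>sin (\<theta> - \<omega>)\<bar> = 1" using s by auto
    have "r = C1 \<omega> \<theta> * (r * \<bar>sin (\<theta> - \<omega>)\<bar>)" using C(2) by (simp add: mult.left_commute)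
    also have "\<dots> \<le> C1 \<omega> \<theta> * norm (of_real r * cis \<theta> + of_real t * cis \<omega>)"
      using C(1) by (intro mult_left_mono csc_kernel_bounds(2)[OF r t]) auto
    finally show ?thesis using C(1) by blast
  next
    case False
    \<comment> \<open>The upper end of the range is where omega >= pi/4 enters: theta - omega < pi -
      2 omega <= pi/2.\<close>
    then have "0 \<le> cos (\<theta> - \<omega>)" using om th by (intro cos_ge_zero) auto
    then show ?thesis using False csc_kernel_bounds(1)[OF r t] by (simp add: C1_def)
  qed
  then show "r \<le> C1 \<omega> \<theta> * norm (of_real r * cis \<theta> + of_real t * cis \<omega>)" "0 < C1 \<omega> \<theta>" by auto
qed

text \<open>Reflection in the real axis exchanges the two rays.\<close>

lemma C2_eq_C1: "C2 \<omega> \<theta> = C1 \<omega> (- \<theta>)"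
proof -
  have "- \<theta> - \<omega> = - (\<theta> + \<omega>)" by simp
  then have "\<bar>csc (- \<theta> - \<omega>)\<bar> = \<bar>csc (\<theta> + \<omega>)\<bar>" unfolding csc_def by (simp only: sin_minus)
  then show ?thesis by (auto simp: C1_def C2_def)
qed

lemma C2_kernel_bound:
  assumes om: "pi / 4 \<le> \<omega>" "\<omega> < pi" and th: "\<bar>\<theta>\<bar> < - \<omega> + pi" and r: "0 < r" and t: "0 < t"
  shows "r \<le> C2 \<omega> \<theta> * norm (of_real r * cis \<theta> + of_real t * cis (- \<omega>))" "0 < C2 \<omega> \<theta>"
proof -
  have "cnj (of_real r * cis (- \<theta>) + of_real t * cis \<omega>) = of_real r * cis \<theta> + of_real t * cis (- \<omega>)"
    by (simp add: cis_cnj)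
  then have "norm (of_real r * cis (- \<theta>) + of_real t * cis \<omega>) = norm (of_real r * cis \<theta> + of_real t * cis (- \<omega>))"
    by (metis complex_mod_cnj)
  then show "r \<le> C2 \<omega> \<theta> * norm (of_real r * cis \<theta> + of_real t * cis (- \<omega>))" "0 < C2 \<omega> \<theta>"
    using C1_kernel_bound[OF om _ r t, of "- \<theta>"] th unfolding C2_eq_C1 by auto
qed

lemma Gamma_jump_cnj:
  assumes lam: "0 < lam" and a: "Im a \<noteq> 0"
  shows "norm (Gamma_jump lam (cnj a)) = norm (Gamma_jump lam a)"
proof -
  have a0: "a \<noteq> 0" "cnj a \<noteq> 0" using a by auto
  have "\<bar>Arg (cnj a)\<bar> = \<bar>Arg a\<bar>" using a by (subst Arg_cnj) (auto simp: complex_is_Real_iff)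
  moreover have "norm (Gamma (- cnj a)) = norm (Gamma (- a))"
    by (metis cnj_Gamma complex_cnj_minus complex_mod_cnj)
  ultimately show ?thesis
    unfolding Gamma_jump_def mult.assoc norm_mult[of "Gamma (- _)"] norm_power_factor[OF lam a0(1)] norm_power_factor[OF lam a0(2)]
    by simp
qed

text \<open>With w = t e^(i omega), the power in J sees the angle omega - pi of -w and the power in
  the scaled gamma function the angle omega of w. The terms with t omega sin omega and all of ln t
  except -(ln t)/2 cancel, leaving -t (L cos omega + pi sin omega).\<close>

lemma Gamma_jump_ray:
  assumes lam: "0 < lam" and t: "0 < t"
  shows "norm (Gamma_jump lam (- (of_real t * exp (\<i> * of_real (omega lam))))) = 
    sqrt (2 * pi) * (t powr (- 1 / 2) * exp (- t * norm (base_point lam)) * 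
      norm (scaled_Gamma (of_real t * exp (\<i> * of_real (omega lam)))))"
proof -
  note o = omega_polar[OF lam]
  let ?om = "omega lam"
  let ?w = "of_real t * exp (\<i> * of_real ?om)"
  have w: "?w \<noteq> 0" "- ?w \<noteq> 0" "norm ?w = t" "norm (- ?w) = t" using t by (auto simp: norm_mult)
  have re: "Re ?w = t * cos ?om" "Im ?w = t * sin ?om" "Re (- ?w) = - (t * cos ?om)" "Im (- ?w) = - (t * sin ?om)"
    by (auto simp: Re_exp Im_exp)
  have sp: "sin ?om > 0" using o by (intro sin_gt_zero) auto
  have Aw: "Arg ?w = ?om" by (rule Arg_unique[of t]) (use o t in auto)
  have Amw: "Arg (- ?w) = ?om - pi"
  proof (rule Arg_unique[of t])
    have "exp (\<i> * complex_of_real (?om - pi)) = - exp (\<i> * of_real ?om)"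
      by (simp add: complex_eq_iff Re_exp Im_exp cos_diff sin_diff)
    then show "of_real t * exp (\<i> * complex_of_real (?om - pi)) = - ?w" by simp
  qed (use o t in auto)
  have J: "norm (Gamma_jump lam (- ?w)) = norm (Gamma ?w) * 
      exp (- (t * cos ?om) * (ln lam + ln t) - t * sin ?om * (pi - ?om) + lam * - (t * cos ?om))"
    unfolding Gamma_jump_def mult.assoc norm_mult[of "Gamma (- _)"] norm_power_factor[OF lam w(2)] w(4) re Amw
    using sp o t by (simp add: abs_mult)
  have LW: "Ln ?w = of_real (ln t) + \<i> * of_real ?om"
    using w Aw by (simp add: complex_eq_iff Arg_eq_Im_Ln)
  have "norm (?w powr (?w - 1 / 2)) = exp ((t * cos ?om - 1 / 2) * ln t - t * sin ?om * ?om)"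
    unfolding powr_def LW using w(1) re by simp
  then have S: "norm (scaled_Gamma ?w) = norm (Gamma ?w) / 
      (sqrt (2 * pi) * exp ((t * cos ?om - 1 / 2) * ln t - t * sin ?om * ?om) * exp (- (t * cos ?om)))"
    unfolding scaled_Gamma_def norm_divide norm_mult using re by simp
  \<comment> \<open>The base point projected onto its own direction; this identifies the
    exponent.\<close>
  have bp: "norm (base_point lam) = (lam + ln lam + 1) * cos ?om + pi * sin ?om"
  proof -
    have "norm (base_point lam) = norm (base_point lam) * ((cos ?om)\<^sup>2 + (sin ?om)\<^sup>2)" by simp
    also have "\<dots> = (norm (base_point lam) * cos ?om) * cos ?om + (norm (base_point lam) * sin ?om) * sin ?om"
      by (simp only: distrib_left power2_eq_square mult.assoc)
    finally show ?thesis using o by simp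
  qed
  have "sqrt (2 * pi) * (t powr (- 1 / 2) * exp (- t * norm (base_point lam)) * norm (scaled_Gamma ?w)) = 
     norm (Gamma ?w) * (exp (- 1 / 2 * ln t) * exp (- t * norm (base_point lam)) 
     / (exp ((t * cos ?om - 1 / 2) * ln t - t * sin ?om * ?om) * exp (- (t * cos ?om))))"
    unfolding S using t by (simp add: powr_def)
  also have "exp (- 1 / 2 * ln t) * exp (- t * norm (base_point lam)) 
     / (exp ((t * cos ?om - 1 / 2) * ln t - t * sin ?om * ?om) * exp (- (t * cos ?om))) = 
      exp (- (t * cos ?om) * (ln lam + ln t) - t * sin ?om * (pi - ?om) + lam * - (t * cos ?om))"
    unfolding exp_add[symmetric] exp_diff[symmetric] bp by (rule arg_cong[where f = exp]) (simp add: algebra_simps)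
  finally show ?thesis using J by simp
qed

lemma minus_cos_le_sin:
  assumes "\<bar>\<phi>\<bar> \<le> 3 * pi / 4"
  shows "- cos \<phi> \<le> \<bar>sin \<phi>\<bar>"
proof -
  have *: "- cos x \<le> sin x" if "0 \<le> x" "x \<le> 3 * pi / 4" for x
  proof -
    have "0 \<le> cos (x - pi / 4)" using that by (intro cos_ge_zero) auto
    then have "0 \<le> (cos x + sin x) * (sqrt 2 / 2)" by (simp add: cos_diff sin_45 cos_45 algebra_simps)
    then show ?thesis by (simp add: zero_le_mult_iff)
  qed
  show ?thesis
    using *[of "\<bar>\<phi>\<bar>"] assms by (cases "0 \<le> \<phi>") auto
qed

section \<open>The remainder bound\<close>

text \<open>Since z + a = (lam + 1) a, the powers of lam + 1 in \<open>b_neg_eq\<close> cancel, and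
  the sum becomes the partial sum in powers of 1/a.\<close>

lemma remainder_eq:
  assumes lam: "0 < lam" and a: "a \<noteq> 0"
  shows "remainder N a lam = normalized_Gamma lam a - ibp_sum lam N a"
proof -
  have L0: "of_real lam + 1 \<noteq> (0::complex)"
    using lam by (metis add_pos_pos less_irrefl of_real_1 of_real_add of_real_eq_0_iff zero_less_one)
  have "a ^ n * b_neg n lam / (of_real lam * a + a) ^ (2 * n + 1) = ibp_coeff lam n / a ^ Suc n" for n
  proof -
    have "of_real lam * a + a = (of_real lam + 1) * a" by (simp add: algebra_simps)
    then have "a ^ n * b_neg n lam / (of_real lam * a + a) ^ (2 * n + 1) =
       ((of_real lam + 1) ^ (2 * n + 1) * (ibp_coeff lam n * a ^ n)) / ((of_real lam + 1) ^ (2 * n + 1) * a ^ (2 * n + 1))"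
      unfolding b_neg_eq[OF lam] by (simp only: power_mult_distrib ac_simps)
    also have "\<dots> = ibp_coeff lam n * a ^ n / a ^ (2 * n + 1)"
      by (rule mult_divide_mult_cancel_left[OF power_not_zero[OF L0]])
    also have "a ^ (2 * n + 1) = a ^ n * a ^ Suc n" by (simp add: mult_2 power_add)
    also have "ibp_coeff lam n * a ^ n / (a ^ n * a ^ Suc n) = ibp_coeff lam n / a ^ Suc n" using a by simp
    finally show ?thesis .
  qed
  then show ?thesis
    unfolding remainder_def Let_def normalized_Gamma_def ibp_sum_def by simp
qed

text \<open>Far out, the bound of order N gives the decay 1/|s|. On the unit disc the bound of order
  0, |s g| <= C0, takes over: because N > 0, both s^N g and every s^N / s^(n+1) with n < N stay
  bounded. In logarithmic coordinates 1/|s| is exp(-x).\<close>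

lemma scaled_remainder_min_bound:
  assumes s: "s \<noteq> 0" and N: "0 < N" 
    and C: "norm (s ^ Suc N * (g - ibp_sum lam N s)) \<le> C"
    and C0: "norm (s ^ Suc 0 * (g - ibp_sum lam 0 s)) \<le> C0"
  shows "norm (s ^ N * (g - ibp_sum lam N s)) \<le> (C + C0 + (\<Sum>n<N. norm (ibp_coeff lam n))) * min 1 (1 / norm s)"
proof -
  let ?B = "\<Sum>n<N. norm (ibp_coeff lam n)"
  have pos: "0 \<le> C" "0 \<le> C0" "0 \<le> ?B"
    using order_trans[OF norm_ge_zero C] order_trans[OF norm_ge_zero C0] by (auto intro: sum_nonneg)
  have sN: "norm s * norm (s ^ N * (g - ibp_sum lam N s)) \<le> C" using C by (simp add: norm_mult mult.assoc)
  show ?thesis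
  proof (cases "norm s \<le> 1")
    case True
    obtain k where k: "N = Suc k" using N gr0_implies_Suc by blast
    have p1: "norm s ^ m \<le> 1" for m using True by (intro power_le_one) auto
    have "norm (s ^ N * g) = norm s ^ k * norm (s ^ Suc 0 * (g - ibp_sum lam 0 s))"
      unfolding k by (simp add: norm_mult norm_power ibp_sum_def mult_ac)
    also have "\<dots> \<le> 1 * C0" using p1 C0 by (intro mult_mono) auto
    finally have 1: "norm (s ^ N * g) \<le> C0" by simp
    have "norm (s ^ N * ibp_sum lam N s) \<le> (\<Sum>n<N. norm (s ^ N * (ibp_coeff lam n / s ^ Suc n)))"
      unfolding ibp_sum_def sum_distrib_left by (rule norm_sum)
    also have "\<dots> \<le> ?B"
    proof (rule sum_mono)
      fix n assume "n \<in> {..<N}"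
      then have "N = (N - Suc n) + Suc n" by simp
      then have "s ^ N = s ^ (N - Suc n) * s ^ Suc n" by (metis power_add)
      then have "norm (s ^ N * (ibp_coeff lam n / s ^ Suc n)) = norm s ^ (N - Suc n) * norm (ibp_coeff lam n)"
        using s by (simp add: norm_mult norm_power)
      also have "\<dots> \<le> 1 * norm (ibp_coeff lam n)" using p1 by (intro mult_right_mono) auto
      finally show "norm (s ^ N * (ibp_coeff lam n / s ^ Suc n)) \<le> norm (ibp_coeff lam n)" by simp
    qed
    finally have 2: "norm (s ^ N * ibp_sum lam N s) \<le> ?B" .
    have "norm (s ^ N * (g - ibp_sum lam N s)) \<le> norm (s ^ N * g) + norm (s ^ N * ibp_sum lam N s)"
      unfolding right_diff_distrib by (rule norm_triangle_ineq4)
    also have "\<dots> \<le> C + C0 + ?B" using 1 2 pos by simp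
    finally show ?thesis using True s by (simp add: min_def divide_simps)
  next
    case False
    then have "norm (s ^ N * (g - ibp_sum lam N s)) \<le> C / norm s" 
      using sN s by (simp add: pos_le_divide_eq[of "norm s"] mult.commute)
    also have "\<dots> \<le> (C + C0 + ?B) * (1 / norm s)" using pos by (simp add: divide_right_mono)
    also have "1 / norm s = min 1 (1 / norm s)" by (rule min_absorb2[symmetric]) (use False in \<open>auto simp: divide_le_eq_1\<close>)
    finally show ?thesis .
  qed
qed

section \<open>The two closed sectors, their common rays and the final estimate\<close>

locale gamma_sector =
  fixes lam :: real
  assumes lam: "0 < lam" and om: "pi / 4 \<le> omega lam" "omega lam \<le> 3 * pi / 4"
begin

abbreviation "om \<equiv> omega lam"
abbreviation "bet \<equiv> pi - omega lam"

text \<open>If the cosine is not positive then |phi| >= pi/2, so omega <= pi/2 and L >= 0; and |phi|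
  <= pi - omega <= 3 pi/4 puts the point where |Re| <= |Im|.\<close>

lemma upper_sector:
  assumes "\<bar>\<phi>\<bar> \<le> bet"
  shows "0 < Re (exp (Complex x \<phi>)) \<or> (0 \<le> lam + ln lam + 1 \<and> Re (exp (Complex x \<phi>)) \<le> 0 \<and> 
    Im (exp (Complex x \<phi>)) \<noteq> 0 \<and> - Re (exp (Complex x \<phi>)) \<le> \<bar>Im (exp (Complex x \<phi>))\<bar>)"
proof (cases "0 < cos \<phi>")
  case False
  then have "\<not> \<bar>\<phi>\<bar> < pi / 2" using cos_gt_zero_pi[of \<phi>] unfolding abs_less_iff by linarith
  then have L: "0 \<le> lam + ln lam + 1" using assms by (intro omega_sign(1)[OF lam]) auto
  have "sin \<bar>\<phi>\<bar> > 0" using \<open>\<not> \<bar>\<phi>\<bar> < pi / 2\<close> assms om pi_gt_zero by (intro sin_gt_zero) linarith+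
  then have "sin \<phi> \<noteq> 0" by (auto simp: abs_if split: if_splits)
  moreover have "exp x * (- cos \<phi>) \<le> exp x * \<bar>sin \<phi>\<bar>"
    using assms om by (intro mult_left_mono minus_cos_le_sin) auto
  ultimately show ?thesis using L False by (simp add: Re_exp Im_exp abs_mult mult_le_0_iff)
qed (simp add: Re_exp)

text \<open>The same argument for phi - pi, whose modulus is at most omega <= 3 pi/4, with the sign
  of L reversed.\<close>

lemma lower_sector:
  assumes "bet \<le> \<phi>" "\<phi> \<le> 2 * pi - bet"
  shows "Re (exp (Complex x \<phi>)) < 0 \<or> (lam + ln lam + 1 \<le> 0 \<and> 0 \<le> Re (exp (Complex x \<phi>)) \<and> 
    Im (exp (Complex x \<phi>)) \<noteq> 0 \<and> Re (exp (Complex x \<phi>)) \<le> \<bar>Im (exp (Complex x \<phi>))\<bar>)"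
proof (cases "0 < cos (\<phi> - pi)")
  case False
  then have "\<not> \<bar>\<phi> - pi\<bar> < pi / 2" using cos_gt_zero_pi[of "\<phi> - pi"] unfolding abs_less_iff by linarith
  then have L: "lam + ln lam + 1 \<le> 0" using assms by (intro omega_sign(2)[OF lam]) linarith
  have "sin \<bar>\<phi> - pi\<bar> > 0" using \<open>\<not> \<bar>\<phi> - pi\<bar> < pi / 2\<close> assms om pi_gt_zero by (intro sin_gt_zero) linarith+
  then have "sin \<phi> \<noteq> 0" by (auto simp: abs_if split: if_splits)
  moreover have "exp x * (- cos (\<phi> - pi)) \<le> exp x * \<bar>sin (\<phi> - pi)\<bar>"
  proof (intro mult_left_mono minus_cos_le_sin)
    show "\<bar>\<phi> - pi\<bar> \<le> 3 * pi / 4" using assms om unfolding abs_le_iff by linarith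
  qed auto
  ultimately show ?thesis using L False by (simp add: Re_exp Im_exp abs_mult)
qed (simp add: Re_exp mult_less_0_iff)

definition ray :: "real \<Rightarrow> complex" where
  "ray t = of_real t * exp (\<i> * of_real om)"

definition ray_integrand :: "nat \<Rightarrow> real \<Rightarrow> real" where
  "ray_integrand N t = t powr (real N - 1 / 2) * exp (- t * norm (base_point lam)) * norm (scaled_Gamma (ray t))"

lemma sin_omega_pos: "0 < sin om"
  using omega_polar(1,2)[OF lam] by (intro sin_gt_zero) auto

lemma ray_Re_Im: "Re (ray t) = t * cos om" "Im (ray t) = t * sin om" "0 < t \<Longrightarrow> norm (ray t) = t"
  by (auto simp: ray_def Re_exp Im_exp norm_mult)

lemma ray_jump:
  assumes "0 < t"
  shows "t ^ N * norm (Gamma_jump lam (- ray t)) = sqrt (2 * pi) * ray_integrand N t"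
proof -
  have "t powr (real N - 1 / 2) = t ^ N * t powr (- 1 / 2)"
    using assms powr_add[of t "real N" "- 1 / 2"] by (simp add: powr_realpow)
  then show ?thesis
    unfolding ray_integrand_def ray_def Gamma_jump_ray[OF lam assms] by simp
qed

text \<open>The sign of cos omega decides on which side of the imaginary axis the ray lies, and by
  \<open>omega_sign\<close> L has the sign required by the jump bound on that side.\<close>

lemma ray_jump_bound:
  assumes "0 < t"
  shows "t * norm (Gamma_jump lam (- ray t)) \<le> 2 * exp (- t / 10)"
proof -
  have Im: "Im (- ray t) \<noteq> 0" "\<bar>Im (- ray t)\<bar> = t * sin om" "Re (- ray t) = - (t * cos om)"
    using sin_omega_pos assms by (auto simp: ray_Re_Im)
  have n: "norm (- ray t) = t" using ray_Re_Im(3)[OF assms] by simp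
  show ?thesis
  proof (cases "om \<le> pi / 2")
    case True
    have "0 \<le> cos om" using True om by (intro cos_ge_zero) auto
    moreover have "cos om \<le> sin om" 
      using minus_cos_le_sin[of "pi - om"] om sin_omega_pos by simp
    ultimately have "norm (- ray t) * norm (Gamma_jump lam (- ray t)) \<le> 2 * exp (- norm (- ray t) / 10)"
      using assms Im by (intro Gamma_jump_bound_left[OF lam omega_sign(1)[OF lam True]]) auto
    then show ?thesis unfolding n .
  next
    case False
    have "0 \<le> cos (pi - om)" using False om by (intro cos_ge_zero) auto
    moreover have "- cos om \<le> sin om" 
      using minus_cos_le_sin[of om] om sin_omega_pos by simp
    then have "t * (- cos om) \<le> t * sin om" using assms by (intro mult_left_mono) auto
    ultimately have "norm (- ray t) * norm (Gamma_jump lam (- ray t)) \<le> 2 * exp (- norm (- ray t) / 10)"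
      using assms Im False by (intro Gamma_jump_bound_right[OF lam omega_sign(2)[OF lam]]) (auto simp: mult_le_0_iff)
    then show ?thesis unfolding n .
  qed
qed

lemma ray_integrand_integrable:
  assumes N: "0 < N"
  shows "ray_integrand N integrable_on {0..}"
proof -
  obtain k where k: "N = Suc k" using N gr0_implies_Suc by blast
  obtain C where C: "\<And>r::real. r \<ge> 0 \<Longrightarrow> r ^ k * exp (- r / 10) \<le> C"
    using exp_decay_power_bound by blast
  let ?c = "1 / sqrt (2 * pi)"
  have eq: "ray_integrand N t = ?c * (t ^ N * norm (Gamma_jump lam (- ray t)))" if "0 < t" for t
    using ray_jump[OF that, of N] by (simp add: field_simps)
  have cont: "continuous_on {0<..} (\<lambda>t. ?c * (t ^ N * norm (Gamma_jump lam (- ray t))))"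
  proof (intro continuous_intros continuous_on_compose2[OF holomorphic_on_imp_continuous_on[OF Gamma_jump_holomorphic[OF lam]]])
    show "continuous_on {0<..} ray" unfolding ray_def by (intro continuous_intros)
    show "(\<lambda>t. - ray t) ` {0<..} \<subseteq> {a. Im a \<noteq> 0}" using sin_omega_pos by (auto simp: ray_Re_Im)
  qed
  have "(\<lambda>t. ?c * (t ^ N * norm (Gamma_jump lam (- ray t)))) absolutely_integrable_on {0<..}"
  proof (rule measurable_bounded_by_integrable_imp_absolutely_integrable)
    show "(\<lambda>t. ?c * (t ^ N * norm (Gamma_jump lam (- ray t)))) \<in> borel_measurable (lebesgue_on {0<..})"
      by (intro continuous_imp_measurable_on_sets_lebesgue cont) auto
    have "((\<lambda>t::real. ?c * (2 * (2 ^ k * C)) * exp (- (1 / 20) * t)) has_integral 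
       ?c * (2 * (2 ^ k * C)) * (exp (- (1 / 20) * 0) / (1 / 20))) {0..}"
      by (intro has_integral_mult_right has_integral_exp_minus_to_infinity) simp
    then have "(\<lambda>t::real. ?c * (2 * (2 ^ k * C)) * exp (- (1 / 20) * t)) integrable_on {0..}"
      by (auto simp: integrable_on_def)
    then show "(\<lambda>t::real. ?c * (2 * (2 ^ k * C)) * exp (- (1 / 20) * t)) integrable_on {0<..}"
      by (rule integrable_spike_set)
         (rule negligible_subset[OF negligible_sing[of 0]], force, rule negligible_subset[OF negligible_empty], force)
    fix t :: real assume "t \<in> {0<..}"
    then have t: "0 < t" by simp
    have "t ^ N * norm (Gamma_jump lam (- ray t)) = t ^ k * (t * norm (Gamma_jump lam (- ray t)))"
      by (simp add: k)
    also have "\<dots> \<le> t ^ k * (2 * exp (- t / 10))" using t by (intro mult_left_mono ray_jump_bound) auto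
    \<comment> \<open>The decay exp(-t/10) is halved: one factor exp(-t/20) absorbs t^k, the other
      is the integrable majorant.\<close>
    also have "\<dots> = 2 * (2 ^ k * ((t / 2) ^ k * exp (- (t / 2) / 10))) * exp (- (1 / 20) * t)"
      by (simp add: power_divide mult.assoc flip: exp_add)
    also have "\<dots> \<le> 2 * (2 ^ k * C) * exp (- (1 / 20) * t)"
      using t by (intro mult_right_mono mult_left_mono C) auto
    finally have "?c * (t ^ N * norm (Gamma_jump lam (- ray t))) \<le> ?c * (2 * (2 ^ k * C) * exp (- (1 / 20) * t))"
      by (intro mult_left_mono) auto
    then show "norm (?c * (t ^ N * norm (Gamma_jump lam (- ray t)))) \<le> ?c * (2 * (2 ^ k * C)) * exp (- (1 / 20) * t)"
      using t by simp
  qed auto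
  then have "(\<lambda>t. ?c * (t ^ N * norm (Gamma_jump lam (- ray t)))) integrable_on {0<..}"
    using set_lebesgue_integral_eq_integral(1) by blast
  then have "ray_integrand N integrable_on {0<..}"
    by (rule integrable_eq) (use eq in auto)
  then show ?thesis
    by (rule integrable_spike_set)
       (rule negligible_subset[OF negligible_empty], force, rule negligible_subset[OF negligible_sing[of 0]], force)
qed

lemma exp_ray: "exp (Complex x (- bet)) = - ray (exp x)" "exp (Complex x bet) = - cnj (ray (exp x))"
  by (auto simp: complex_eq_iff Re_exp Im_exp ray_Re_Im cos_diff sin_diff)

text \<open>With t = exp x the outer factor \<open>exp x\<close> is the Jacobian, so the majorant is
  the ray integral over [exp(-R), exp R], which may be enlarged to the half-line because the
  integrand is nonnegative.\<close>

lemma jump_integral_bound: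
  fixes D :: "real \<Rightarrow> complex"
  assumes N: "0 < N" and K: "0 < K"
    and D: "\<And>x. norm (D x) \<le> K * (exp x * (exp x ^ N * norm (Gamma_jump lam (- ray (exp x)))))"
  shows "norm (integral {- R..R} D) \<le> K * (sqrt (2 * pi) * integral {0..} (ray_integrand N))" 
proof (cases "0 \<le> R \<and> D integrable_on {- R..R}")
  \<comment> \<open>For negative \<open>R\<close> the interval is empty, and a non-integrable
    \<open>D\<close> has integral 0 by convention; so no integrability of \<open>D\<close> has to be
    assumed.\<close>
  case False
  have "0 \<le> integral {0..} (ray_integrand N)"
    by (intro integral_nonneg ray_integrand_integrable[OF N]) (simp add: ray_integrand_def)
  moreover have "integral {- R..R} D = 0" using False not_integrable_integral[of D "{- R..R}"] by (cases "0 \<le> R") auto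
  ultimately show ?thesis using K by simp
next
  case True
  let ?\<psi> = "\<lambda>t. t ^ N * norm (Gamma_jump lam (- ray t))"
  have cont: "continuous_on {exp (- R)..exp R} ?\<psi>"
  proof (intro continuous_intros continuous_on_compose2[OF holomorphic_on_imp_continuous_on[OF Gamma_jump_holomorphic[OF lam]]])
    show "continuous_on {exp (- R)..exp R} ray" unfolding ray_def by (intro continuous_intros)
    show "(\<lambda>t. - ray t) ` {exp (- R)..exp R} \<subseteq> {a. Im a \<noteq> 0}" 
      using sin_omega_pos less_le_trans[OF exp_gt_zero[of "- R"]] by (auto simp: ray_Re_Im)
  qed
  have sub: "((\<lambda>x. exp x *\<^sub>R ?\<psi> (exp x)) has_integral integral {exp (- R)..exp R} ?\<psi>) {- R..R}"
  proof (rule has_integral_substitution[OF _ _ _ cont])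
    show "(exp has_real_derivative exp x) (at x within {- R..R})" for x
      by (rule has_field_derivative_at_within[OF DERIV_exp])
  qed (use True in auto)
  have "norm (integral {- R..R} D) \<le> integral {- R..R} (\<lambda>x. K * (exp x *\<^sub>R ?\<psi> (exp x)))"
  proof (rule integral_norm_bound_integral)
    show "(\<lambda>x. K * (exp x *\<^sub>R ?\<psi> (exp x))) integrable_on {- R..R}"
      using has_integral_mult_right[OF sub, of K] by (auto simp: integrable_on_def)
  qed (use True D in auto)
  also have "\<dots> = K * integral {exp (- R)..exp R} ?\<psi>"
    using has_integral_mult_right[OF sub, of K] by (rule integral_unique)
  also have "integral {exp (- R)..exp R} ?\<psi> = integral {exp (- R)..exp R} (\<lambda>t. sqrt (2 * pi) * ray_integrand N t)"
    using less_le_trans[OF exp_gt_zero[of "- R"]] by (intro integral_cong) (auto intro!: ray_jump)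
  also have "\<dots> = sqrt (2 * pi) * integral {exp (- R)..exp R} (ray_integrand N)" by (rule integral_mult_right)
  also have "K * (sqrt (2 * pi) * integral {exp (- R)..exp R} (ray_integrand N)) \<le> K * (sqrt (2 * pi) * integral {0..} (ray_integrand N))"
  proof -
    have "integral {exp (- R)..exp R} (ray_integrand N) \<le> integral {0..} (ray_integrand N)"
    proof (rule integral_subset_le)
      show "{exp (- R)..exp R} \<subseteq> {0..}" using less_le_trans[OF exp_gt_zero[of "- R"]] by (auto intro: less_imp_le)
      then show "ray_integrand N integrable_on {exp (- R)..exp R}"
        using integrable_on_subinterval[OF ray_integrand_integrable[OF N]] by simp
    qed (auto simp: ray_integrand_integrable[OF N], simp add: ray_integrand_def)
    then show ?thesis using K by (intro mult_left_mono) auto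
  qed
  finally show ?thesis .
qed

text \<open>\<open>dispersion_bound\<close> with \<beta> = pi - omega, for s^N times the remainders
  of F and F1.\<close>

lemma remainder_bound:
  assumes N: "0 < N" and a: "a \<noteq> 0" and th: "\<bar>Arg a\<bar> < bet"
  shows "2 * pi * norm (a ^ N * remainder N a lam) \<le> 
    (C1 om (Arg a) + C2 om (Arg a)) / norm a * (sqrt (2 * pi) * integral {0..} (ray_integrand N))"
proof -
  have om': "om < pi" using omega_polar(2)[OF lam] .
  have bet: "0 < bet" "bet < pi" using om om' pi_gt_zero by linarith+
  define P where "P = (\<lambda>s. s ^ N * (normalized_Gamma lam s - ibp_sum lam N s))"
  define Q where "Q = (\<lambda>s. s ^ N * (lower_branch lam s - ibp_sum lam N s))"
  let ?D = "\<lambda>z. (P (exp z) - Q (exp z)) * (exp z / (exp z - a))"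
  let ?I = "integral {0..} (ray_integrand N)"
  have Pa: "P a = a ^ N * remainder N a lam" unfolding P_def remainder_eq[OF lam a] ..
  have Ph: "P holomorphic_on - \<real>\<^sub>\<le>\<^sub>0"
    unfolding P_def
    by (intro holomorphic_intros normalized_Gamma_holomorphic[OF lam] holomorphic_on_subset[OF ibp_sum_holomorphic]) auto
  have Qh: "Q holomorphic_on {s. Re s < 0 \<or> Im s \<noteq> 0}"
    unfolding Q_def
    by (intro holomorphic_intros lower_branch_holomorphic[OF lam] holomorphic_on_subset[OF ibp_sum_holomorphic]) auto
  let ?B = "\<Sum>n<N. norm (ibp_coeff lam n)"
  obtain CP CP0 where CP: 
    "\<And>s. 0 < Re s \<or> (0 \<le> lam + ln lam + 1 \<and> Re s \<le> 0 \<and> Im s \<noteq> 0 \<and> - Re s \<le> \<bar>Im s\<bar>) \<Longrightarrow> 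
      norm (s ^ Suc N * (normalized_Gamma lam s - ibp_sum lam N s)) \<le> CP"
    "\<And>s. 0 < Re s \<or> (0 \<le> lam + ln lam + 1 \<and> Re s \<le> 0 \<and> Im s \<noteq> 0 \<and> - Re s \<le> \<bar>Im s\<bar>) \<Longrightarrow> 
      norm (s ^ Suc 0 * (normalized_Gamma lam s - ibp_sum lam 0 s)) \<le> CP0"
    using normalized_Gamma_remainder_bounded[OF lam, of N] normalized_Gamma_remainder_bounded[OF lam, of 0] by metis
  obtain CQ CQ0 where CQ:
    "\<And>s. Re s < 0 \<or> (lam + ln lam + 1 \<le> 0 \<and> 0 \<le> Re s \<and> Im s \<noteq> 0 \<and> Re s \<le> \<bar>Im s\<bar>) \<Longrightarrow>
      norm (s ^ Suc N * (lower_branch lam s - ibp_sum lam N s)) \<le> CQ"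
    "\<And>s. Re s < 0 \<or> (lam + ln lam + 1 \<le> 0 \<and> 0 \<le> Re s \<and> Im s \<noteq> 0 \<and> Re s \<le> \<bar>Im s\<bar>) \<Longrightarrow>
      norm (s ^ Suc 0 * (lower_branch lam s - ibp_sum lam 0 s)) \<le> CQ0"
    using lower_branch_remainder_bounded[OF lam, of N] lower_branch_remainder_bounded[OF lam, of 0] by metis
  define M where "M = max (CP + CP0 + ?B) (CQ + CQ0 + ?B)"
  have inv: "1 / norm (exp (Complex x \<phi>)) = exp (- x)" for x \<phi> by (simp add: exp_minus divide_inverse)
  have min0: "0 \<le> min 1 (exp (- x))" for x :: real by simp
  have bP: "norm (P (exp (Complex x \<phi>))) \<le> M * min 1 (exp (- x))" if "\<bar>\<phi>\<bar> \<le> bet" for x \<phi>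
  proof -
    have "norm (P (exp (Complex x \<phi>))) \<le> (CP + CP0 + ?B) * min 1 (exp (- x))"
      unfolding P_def inv[of x \<phi>, symmetric]
      by (intro scaled_remainder_min_bound N CP upper_sector[OF that]) auto
    also have "\<dots> \<le> M * min 1 (exp (- x))" unfolding M_def by (intro mult_right_mono min0) auto
    finally show ?thesis .
  qed
  have bQ: "norm (Q (exp (Complex x \<phi>))) \<le> M * min 1 (exp (- x))" if "bet \<le> \<phi>" "\<phi> \<le> 2 * pi - bet" for x \<phi>
  proof -
    have "norm (Q (exp (Complex x \<phi>))) \<le> (CQ + CQ0 + ?B) * min 1 (exp (- x))"
      unfolding Q_def inv[of x \<phi>, symmetric]
      by (intro scaled_remainder_min_bound N CQ lower_sector[OF that]) auto
    also have "\<dots> \<le> M * min 1 (exp (- x))" unfolding M_def by (intro mult_right_mono min0) auto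
    finally show ?thesis .
  qed
  obtain M' R0 where disp: "\<And>R. R \<ge> R0 \<Longrightarrow> 2 * pi * norm (P a) \<le> 
     norm (integral {- R..R} (\<lambda>x. ?D (Complex x (- bet)))) + norm (integral {- R..R} (\<lambda>x. ?D (Complex x bet))) + M' * exp (- R)"
    using dispersion_bound[OF bet a th Ph Qh bP bQ] by blast
  have apolar: "a = of_real (norm a) * cis (Arg a)" using Arg_eq[OF a] by (simp add: cis_conv_exp)
  have na: "0 < norm a" using a by simp
  \<comment> \<open>The edge at height -bet consists of the points -t e^(i omega), so its distance
    from a is governed by C1; the conjugate edge belongs to C2.\<close>
  have c1: "norm (1 / (exp (Complex x (- bet)) - a)) \<le> C1 om (Arg a) / norm a" 
    and c2: "norm (1 / (exp (Complex x bet) - a)) \<le> C2 om (Arg a) / norm a" for x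
  proof -
    have e: "norm (1 / w) \<le> c / norm a" if "norm a \<le> c * norm w" "0 < c" for w :: complex and c
    proof -
      have "w \<noteq> 0" using that na by auto
      then show ?thesis using that na by (simp add: norm_divide divide_simps mult.commute)
    qed
    have e1: "exp (Complex x (- bet)) - a = - (a + of_real (exp x) * cis om)"
      unfolding exp_ray ray_def cis_conv_exp by simp
    note k1 = C1_kernel_bound[OF om(1) om' _ na exp_gt_zero[of x], of "Arg a", unfolded apolar[symmetric]]
    show "norm (1 / (exp (Complex x (- bet)) - a)) \<le> C1 om (Arg a) / norm a"
      by (rule e) (unfold e1 norm_minus_cancel, use k1 th in auto)
    have e2: "exp (Complex x bet) - a = - (a + of_real (exp x) * cis (- om))"
      unfolding exp_ray ray_def cis_conv_exp by (simp add: exp_cnj)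
    note k2 = C2_kernel_bound[OF om(1) om' _ na exp_gt_zero[of x], of "Arg a", unfolded apolar[symmetric]]
    show "norm (1 / (exp (Complex x bet) - a)) \<le> C2 om (Arg a) / norm a"
      by (rule e) (unfold e2 norm_minus_cancel, use k2 th in auto)
  qed
  \<comment> \<open>The common partial sum cancels and the difference of the branches is J.\<close>
  have diff: "P s - Q s = s ^ N * Gamma_jump lam s" if "Im s \<noteq> 0" for s
    unfolding P_def Q_def right_diff_distrib[symmetric] diff_diff_eq2 diff_add_cancel
      normalized_Gamma_minus_lower_branch[OF lam that, symmetric]
    by simp
  have Imray: "Im (ray (exp x)) \<noteq> 0" for x using sin_omega_pos by (simp add: ray_Re_Im)
  have D1: "norm (?D (Complex x (- bet))) \<le> C1 om (Arg a) / norm a * (exp x * (exp x ^ N * norm (Gamma_jump lam (- ray (exp x)))))" for x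
  proof -
    let ?s = "exp (Complex x (- bet))"
    have s: "?s = - ray (exp x)" by (rule exp_ray)
    have ns: "norm ?s = exp x" by simp
    have ims: "Im ?s \<noteq> 0" unfolding s using Imray[of x] by simp
    have "norm (?D (Complex x (- bet))) = exp x ^ N * norm (Gamma_jump lam ?s) * (exp x * norm (1 / (?s - a)))"
      unfolding diff[OF ims] norm_mult norm_divide norm_power ns by simp
    also have "\<dots> \<le> exp x ^ N * norm (Gamma_jump lam ?s) * (exp x * (C1 om (Arg a) / norm a))"
      by (intro mult_left_mono c1) auto
    finally show ?thesis unfolding s by (simp add: mult_ac)
  qed
  have D2: "norm (?D (Complex x bet)) \<le> C2 om (Arg a) / norm a * (exp x * (exp x ^ N * norm (Gamma_jump lam (- ray (exp x)))))" for x
  proof -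
    let ?s = "exp (Complex x bet)"
    have s: "?s = cnj (- ray (exp x))" using exp_ray(2) by simp
    have ns: "norm ?s = exp x" by simp
    have Js: "norm (Gamma_jump lam ?s) = norm (Gamma_jump lam (- ray (exp x)))"
      unfolding s using Imray by (intro Gamma_jump_cnj lam) auto
    have ims: "Im ?s \<noteq> 0" unfolding s using Imray[of x] by simp
    have "norm (?D (Complex x bet)) = exp x ^ N * norm (Gamma_jump lam ?s) * (exp x * norm (1 / (?s - a)))"
      unfolding diff[OF ims] norm_mult norm_divide norm_power ns by simp
    also have "\<dots> \<le> exp x ^ N * norm (Gamma_jump lam ?s) * (exp x * (C2 om (Arg a) / norm a))"
      by (intro mult_left_mono c2) auto
    finally show ?thesis unfolding Js by (simp add: mult_ac)
  qed
  have Cpos: "0 < C1 om (Arg a) / norm a" "0 < C2 om (Arg a) / norm a"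
    using C1_kernel_bound(2)[OF om(1) om' _ na zero_less_one] C2_kernel_bound(2)[OF om(1) om' _ na zero_less_one] th na by auto
  let ?X = "(C1 om (Arg a) + C2 om (Arg a)) / norm a * (sqrt (2 * pi) * ?I)"
  have bound: "2 * pi * norm (P a) \<le> ?X + M' * exp (- R)" if "R \<ge> R0" for R
    using disp[OF that] jump_integral_bound[OF N Cpos(1) D1, of R] jump_integral_bound[OF N Cpos(2) D2, of R]
    by (simp add: add_divide_distrib distrib_right)
  \<comment> \<open>Only the vertical edges depend on R by now; they disappear in the limit.\<close>
  have "((\<lambda>R. ?X + M' * exp (- R)) \<longlongrightarrow> ?X + M' * 0) at_top"
    by (intro tendsto_intros) real_asymp
  then have "2 * pi * norm (P a) \<le> ?X + M' * 0"
    by (rule tendsto_lowerbound) (use bound in \<open>auto simp: eventually_at_top_linorder\<close>)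
  then show ?thesis unfolding Pa by simp
qed

end

theorem mainTheorem7:
  fixes lam \<omega> \<theta> :: real and a z :: complex and N :: nat
  assumes "0 < lam"
    and "lambert_W (exp (- pi - 1)) \<le> lam" and "lam \<le> lambert_W (exp (pi - 1))"
    and "0 < N"
    and "a \<noteq> 0"
    and "z = of_real lam * a"
    and "\<theta> = Arg a"
    and "\<omega> = omega lam"
    and "\<bar>\<theta>\<bar> < - \<omega> + pi"
  shows "pi / 4 \<le> \<omega> \<and> \<omega> \<le> 3 * pi / 4 \<and>
    norm (remainder N a lam) \<le>
      norm (a ^ N / (z + a) ^ (2 * N + 1)) *
      (2 * (lam + 1) ^ (2 * N + 1) / sqrt (2 * pi)) *
      integral {0..} (\<lambda>t. t powr (real N - 1 / 2) * exp (- t * norm (base_point lam)) *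
                          norm (scaled_Gamma (of_real t * exp (\<i> * of_real \<omega>)))) *
      (1 / 2 * (C1 \<omega> \<theta> + C2 \<omega> \<theta>))"
proof -
  note om = omega_range[OF assms(1) log_bounds_from_lambert_W[OF assms(1-3)]]
  interpret gamma_sector lam by unfold_locales (use assms(1) om in auto)
  define I where "I = integral {0..} (ray_integrand N)"
  have I: "integral {0..} (\<lambda>t. t powr (real N - 1 / 2) * exp (- t * norm (base_point lam)) *
                          norm (scaled_Gamma (of_real t * exp (\<i> * of_real \<omega>)))) = I"
    unfolding I_def ray_integrand_def ray_def assms(8) ..
  define K where "K = C1 \<omega> \<theta> + C2 \<omega> \<theta>"
  define r where "r = norm a"
  have r: "0 < r" using assms(5) by (simp add: r_def)
  have L: "0 < lam + 1" using assms(1) by simp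
  have bnd: "2 * pi * (r ^ N * norm (remainder N a lam)) \<le> K / r * (sqrt (2 * pi) * I)"
    using remainder_bound[OF assms(4,5)] assms(7-9) unfolding K_def I_def r_def by (simp add: norm_mult norm_power)
  have "norm (z + a) = (lam + 1) * r"
  proof -
    have "z + a = of_real (lam + 1) * a" unfolding assms(6) by (simp add: algebra_simps)
    then show ?thesis using L unfolding r_def by (simp only: norm_mult norm_of_real abs_of_pos)
  qed
  then have n1: "norm (a ^ N / (z + a) ^ (2 * N + 1)) = r ^ N / ((lam + 1) * r) ^ (2 * N + 1)"
    by (simp only: norm_divide norm_power r_def)
  \<comment> \<open>The powers of lam + 1 cancel, because |z + a| = (lam + 1) r, and so do the
    factors 2 and 1/2.\<close>
  have "r ^ N / ((lam + 1) * r) ^ (2 * N + 1) * (2 * (lam + 1) ^ (2 * N + 1) / sqrt (2 * pi)) * I * (1 / 2 * K) =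
      K * I / (r ^ Suc N * sqrt (2 * pi))"
  proof -
    have e: "((lam + 1) * r) ^ (2 * N + 1) = (lam + 1) ^ (2 * N + 1) * (r ^ N * r ^ Suc N)"
      unfolding power_mult_distrib by (simp add: mult_2 power_add)
    show ?thesis unfolding e using r L by (simp add: divide_simps)
  qed
  moreover have "norm (remainder N a lam) \<le> K * I / (r ^ Suc N * sqrt (2 * pi))"
  proof -
    \<comment> \<open>One root of 2 pi on the left cancels the one produced by
      \<open>ray_jump\<close>; the other becomes the denominator of the claim.\<close>
    have s: "2 * pi = sqrt (2 * pi) * sqrt (2 * pi)" "0 < sqrt (2 * pi)" by auto
    have "sqrt (2 * pi) * (sqrt (2 * pi) * (r ^ N * norm (remainder N a lam))) \<le> sqrt (2 * pi) * (K / r * I)"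
      using bnd by (subst (asm) s(1)) (simp add: mult_ac)
    then have "sqrt (2 * pi) * (r ^ N * norm (remainder N a lam)) \<le> K / r * I" using s(2) by (rule mult_left_le_imp_le)
    then show ?thesis using r s(2) by (simp add: field_simps)
  qed
  ultimately have "norm (remainder N a lam) \<le> 
      r ^ N / ((lam + 1) * r) ^ (2 * N + 1) * (2 * (lam + 1) ^ (2 * N + 1) / sqrt (2 * pi)) * I * (1 / 2 * K)"
    by (simp only:)
  moreover have "pi / 4 \<le> \<omega> \<and> \<omega> \<le> 3 * pi / 4" using om assms(8) by simp
  ultimately show ?thesis unfolding I n1 K_def[symmetric] by blast
qed

end
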